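(* Let $p_0 = \left(1-\frac{\log \pi}{\log 4}\right)^{-1}$ and let $0<p\le p_0$. Let $d\ge1$ be an integer, let $a_1,\ldots,a_d,b_1,\ldots,b_d\in\mathbb{C}$, and consider the functions on $\mathbb{T}^\infty$ $$\varphi(z)=a_1z_1+a_2z_2+\cdots+a_dz_d,\qquad f(z)=b_1z_1+b_2z_2+\cdots+b_dz_d.$$ Then $$|\langle f,\varphi\rangle|\le\|H_\varphi\|_{\mathcal{S}_p}\,\|f\|_1.$$
   Context: $\mathbb{T}^\infty$ is the countably infinite product of unit circles $\mathbb{T}=\{z\in\mathbb{C}:|z|=1\}$, with coordinates $z=(z_1,z_2,\ldots)$, equipped with its normalized Haar measure (the product of the normalized Lebesgue measures in each variable). $\langle u,v\rangle=\int_{\mathbb{T}^\infty}u\overline{v}$ denotes the inner product of $L^2(\mathbb{T}^\infty)$ and $\|\cdot\|_1$ the norm of $L^1(\mathbb{T}^\infty)$. For $n\in\mathbb{N}$ with prime factorization $n=\prod_j p_j^{\kappa_j}$ ($p_j$ the $j$th prime), put $\kappa(n)=(\kappa_1,\kappa_2,\ldots)$ and $z^{\kappa(n)}=\prod_j z_j^{\kappa_j}$. The Hardy space $H^2(\mathbb{D}^\infty)$ is identified with the closed subspace of $L^2(\mathbb{T}^\infty)$ having orthonormal basis $\{z^{\kappa(n)}\}_{n\ge1}$. A polynomial is a finite linear combination of the monomials $z^{\kappa(n)}$. Each $\varphi\in L^2(\mathbb{T}^\infty)$ induces a (possibly unbounded) multiplicative Hankel form on $H^2(\mathbb{D}^\infty)\times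 H^2(\mathbb{D}^\infty)$, $H_\varphi(fg)=\langle fg,\varphi\rangle$, defined at least for polynomials $f,g$. In the basis $\{z^{\kappa(n)}\}$ the form has the infinite matrix $M_\varrho=(\varrho_{mn})_{m,n\ge1}$ (index of the entry is the product $mn$), where $\varrho_n=\langle z^{\kappa(n)},\varphi\rangle$. The form $H_\varphi$ belongs to the Schatten class $\mathcal{S}_p$, $0<p<\infty$, if $M_\varrho$ defines a compact operator on $\ell^2(\mathbb{N})$ whose singular value sequence $\Lambda$ (with multiplicity) is in $\ell^p$, and then $\|H_\varphi\|_{\mathcal{S}_p}=\|\Lambda\|_{\ell^p}$ (where $\|\Lambda\|_{\ell^p}=(\sum_k\lambda_k^p)^{1/p}$). *)

theory Defs
  imports "HOL-Probability.Probability" "HOL-Computational_Algebra.Primes"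
    "HOL-Library.Function_Algebras" "HOL-Library.Infinite_Set"
begin

section \<open>The infinite torus\<close>

definition circle_measure :: "complex measure" where
  "circle_measure = distr (uniform_measure lborel {0..2 * pi}) (restrict_space borel (sphere 0 1)) cis"

text \<open>Coordinates are numbered from 0, so \<open>z j\<close> is the variable usually written \<open>z\<^sub>j\<^sub>+\<^sub>1\<close>.\<close>

definition torus :: "(nat \<Rightarrow> complex) measure" where
  "torus = PiM UNIV (\<lambda>_. circle_measure)"

definition torus_inner ::
    "((nat \<Rightarrow> complex) \<Rightarrow> complex) \<Rightarrow> ((nat \<Rightarrow> complex) \<Rightarrow> complex) \<Rightarrow> complex" where
  "torus_inner u v = (LINT z|torus. u z * cnj (v z))"

definition torus_norm1 :: "((nat \<Rightarrow> complex) \<Rightarrow> complex) \<Rightarrow> real" where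
  "torus_norm1 u = (LINT z|torus. cmod (u z))"

lemma prob_space_circle_measure: "prob_space circle_measure"
proof -
  have "cis \<in> uniform_measure lborel {0..2 * pi} \<rightarrow>\<^sub>M restrict_space borel (sphere 0 1)"
  proof (rule measurable_restrict_space2)
    show "cis \<in> uniform_measure lborel {0..2 * pi} \<rightarrow>\<^sub>M borel"
      by (subst measurable_cong_sets[where M' = borel and N' = borel])
        (auto intro!: borel_measurable_continuous_onI continuous_intros)
  qed auto
  moreover have "prob_space (uniform_measure lborel {0..2 * pi})"
    by (rule prob_space_uniform_measure) auto
  ultimately show ?thesis
    unfolding circle_measure_def by (intro prob_space.prob_space_distr)
qed

section \<open>Monomials indexed by positive integers\<close>

text \<open>\<open>enumerate {q. prime q} j\<close> is the prime attached to the coordinate \<open>z j\<close>; it is 2 for \<open>j = 0\<close>.\<close>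

definition prime_exponent :: "nat \<Rightarrow> nat \<Rightarrow> nat" where
  "prime_exponent n j = multiplicity (enumerate {q::nat. prime q} j) n"

text \<open>For \<open>n > 0\<close> the index set of the product is finite.\<close>

definition torus_monomial :: "nat \<Rightarrow> (nat \<Rightarrow> complex) \<Rightarrow> complex" where
  "torus_monomial n z = (\<Prod>j | prime_exponent n j \<noteq> 0. z j ^ prime_exponent n j)"

section \<open>Matrices acting on square-summable sequences\<close>

definition ell2 :: "(nat \<Rightarrow> complex) set" where
  "ell2 = {x. summable (\<lambda>n. (cmod (x n))\<^sup>2)}"

definition ell2_norm :: "(nat \<Rightarrow> complex) \<Rightarrow> real" where
  "ell2_norm x = sqrt (\<Sum>n. (cmod (x n))\<^sup>2)"

definition matrix_apply :: "(nat \<Rightarrow> nat \<Rightarrow> complex) \<Rightarrow> (nat \<Rightarrow> complex) \<Rightarrow> nat \<Rightarrow> complex" where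
  "matrix_apply A x m = (\<Sum>n. A m n * x n)"

definition matrix_adjoint :: "(nat \<Rightarrow> nat \<Rightarrow> complex) \<Rightarrow> nat \<Rightarrow> nat \<Rightarrow> complex" where
  "matrix_adjoint A m n = cnj (A n m)"

definition matrix_on_ell2 :: "(nat \<Rightarrow> nat \<Rightarrow> complex) \<Rightarrow> bool" where
  "matrix_on_ell2 A \<longleftrightarrow>
     (\<forall>x\<in>ell2. (\<forall>m. summable (\<lambda>n. A m n * x n)) \<and> matrix_apply A x \<in> ell2)"

definition compact_matrix :: "(nat \<Rightarrow> nat \<Rightarrow> complex) \<Rightarrow> bool" where
  "compact_matrix A \<longleftrightarrow> matrix_on_ell2 A \<and>
     (\<forall>X. (\<forall>k. X k \<in> ell2 \<and> ell2_norm (X k) \<le> 1) \<longrightarrow>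
        (\<exists>r::nat \<Rightarrow> nat. \<exists>y\<in>ell2. strict_mono r \<and>
           (\<lambda>k. ell2_norm (\<lambda>n. matrix_apply A (X (r k)) n - y n)) \<longlonglongrightarrow> 0))"

section \<open>Singular values and Schatten classes\<close>

definition seq_scale :: "complex \<Rightarrow> (nat \<Rightarrow> complex) \<Rightarrow> nat \<Rightarrow> complex" where
  "seq_scale c x = (\<lambda>n. c * x n)"

lemma vector_space_seq_scale: "vector_space seq_scale"
    by unfold_locales (simp_all add: seq_scale_def fun_eq_iff distrib_left distrib_right)

text \<open>The eigenspace of \<open>A\<^sup>* A\<close> for the eigenvalue \<open>s\<^sup>2\<close>.\<close>

definition singular_space :: "(nat \<Rightarrow> nat \<Rightarrow> complex) \<Rightarrow> real \<Rightarrow> (nat \<Rightarrow> complex) set" where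
  "singular_space A s =
     {x \<in> ell2. matrix_apply (matrix_adjoint A) (matrix_apply A x) = seq_scale (of_real (s\<^sup>2)) x}"

text \<open>
  The singular values are the square roots of the eigenvalues of \<open>A\<^sup>* A\<close>, listed in decreasing
  order, each positive one as often as the complex dimension of its eigenspace (finite for compact
  \<open>A\<close>). If there are only finitely many positive ones, the sequence is continued by zeros. Zero
  gets no multiplicity condition: it does not contribute to the Schatten norm, and when there are
  infinitely many positive singular values it is absent from the list even if \<open>A\<close> has a kernel.
\<close>

definition is_singular_value_seq :: "(nat \<Rightarrow> nat \<Rightarrow> complex) \<Rightarrow> (nat \<Rightarrow> real) \<Rightarrow> bool" where
  "is_singular_value_seq A \<Lambda> \<longleftrightarrow>
     decseq \<Lambda> \<and> (\<forall>k. 0 \<le> \<Lambda> k) \<and> \<Lambda> \<longlonglongrightarrow> 0 \<and>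
     (\<forall>s>0. card {k. \<Lambda> k = s} = vector_space.dim seq_scale (singular_space A s))"

definition singular_values :: "(nat \<Rightarrow> nat \<Rightarrow> complex) \<Rightarrow> nat \<Rightarrow> real" where
  "singular_values A = (THE \<Lambda>. is_singular_value_seq A \<Lambda>)"

definition schatten_class :: "real \<Rightarrow> (nat \<Rightarrow> nat \<Rightarrow> complex) set" where
  "schatten_class p = {A. compact_matrix A \<and> summable (\<lambda>k. singular_values A k powr p)}"

definition schatten_norm :: "real \<Rightarrow> (nat \<Rightarrow> nat \<Rightarrow> complex) \<Rightarrow> real" where
  "schatten_norm p A = (\<Sum>k. singular_values A k powr p) powr (1 / p)"

section \<open>Multiplicative Hankel forms\<close>

definition hankel_form ::
    "((nat \<Rightarrow> complex) \<Rightarrow> complex) \<Rightarrow> ((nat \<Rightarrow> complex) \<Rightarrow> complex) \<Rightarrow>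
     ((nat \<Rightarrow> complex) \<Rightarrow> complex) \<Rightarrow> complex" where
  "hankel_form \<phi> f g = torus_inner (\<lambda>z. f z * g z) \<phi>"

definition hankel_coeff :: "((nat \<Rightarrow> complex) \<Rightarrow> complex) \<Rightarrow> nat \<Rightarrow> complex" where
  "hankel_coeff \<phi> n = torus_inner (torus_monomial n) \<phi>"

text \<open>Rows and columns are numbered from 0 here, so row \<open>m\<close> belongs to the integer \<open>m + 1\<close>.\<close>

definition hankel_matrix :: "((nat \<Rightarrow> complex) \<Rightarrow> complex) \<Rightarrow> nat \<Rightarrow> nat \<Rightarrow> complex" where
  "hankel_matrix \<phi> m n = hankel_coeff \<phi> (Suc m * Suc n)"

lemma prime_enumerate: "prime (enumerate {q::nat. prime q} j)"
  using enumerate_in_set[OF primes_infinite] by auto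

lemma finite_prime_exponent:
  assumes "n > 0"
  shows "finite {j. prime_exponent n j \<noteq> 0}"
proof (rule finite_imageD)
  show "inj_on (enumerate {q::nat. prime q}) {j. prime_exponent n j \<noteq> 0}"
    by (rule inj_on_subset[OF _ subset_UNIV])
      (rule strict_mono_imp_inj_on, rule strict_mono_enumerate, rule primes_infinite)
  have "enumerate {q. prime q} j dvd n" if "prime_exponent n j \<noteq> 0" for j
    using that not_dvd_imp_multiplicity_0[of "enumerate {q. prime q} j" n]
    unfolding prime_exponent_def by argo
  then have "enumerate {q. prime q} ` {j. prime_exponent n j \<noteq> 0} \<subseteq> {d. d dvd n}"
    by auto
  moreover have "finite {d. d dvd n}"
    using assms by simp
  ultimately show "finite (enumerate {q::nat. prime q} ` {j. prime_exponent n j \<noteq> 0})"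
    by (rule finite_subset)
qed

lemma torus_monomial_mult:
  assumes "m > 0" "n > 0"
  shows "torus_monomial (m * n) z = torus_monomial m z * torus_monomial n z"
proof -
  let ?S = "\<lambda>n. {j. prime_exponent n j \<noteq> 0}"
  let ?U = "?S m \<union> ?S n"
  have fin: "finite ?U"
    using finite_prime_exponent assms by blast
  have add: "prime_exponent (m * n) j = prime_exponent m j + prime_exponent n j" for j
    using assms prime_enumerate[of j] unfolding prime_exponent_def
    by (intro prime_elem_multiplicity_mult_distrib) auto
  have ext: "torus_monomial k z = (\<Prod>j\<in>?U. z j ^ prime_exponent k j)" if "?S k \<subseteq> ?U" for k
    unfolding torus_monomial_def by (rule prod.mono_neutral_left[OF fin that]) auto
  have "torus_monomial (m * n) z = (\<Prod>j\<in>?U. z j ^ prime_exponent m j * z j ^ prime_exponent n j)"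
    using ext[of "m * n"] by (auto simp: add power_add)
  also have "\<dots> = torus_monomial m z * torus_monomial n z"
    using ext[of m] ext[of n] by (simp add: prod.distrib)
  finally show ?thesis .
qed

lemma hankel_matrix_eq_form:
  "hankel_matrix \<phi> m n = hankel_form \<phi> (torus_monomial (Suc m)) (torus_monomial (Suc n))"
  unfolding hankel_matrix_def hankel_coeff_def hankel_form_def
  by (subst torus_monomial_mult[symmetric]) auto

end

theory Submission
  imports Defs "HOL-Real_Asymp.Real_Asymp"
begin

text \<open>
  A product \<open>m n\<close> of positive integers is prime only if one factor is 1. The Hankel matrix of
  \<open>\<phi> = \<Sum> a\<^sub>j z\<^sub>j\<close> therefore couples only the constant 1 with the variables: it is the adjacency
  matrix of a star whose edges carry the conjugates of the \<open>a\<^sub>j\<close>. If \<open>a\<close> is not zero, this matrix has rank two,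
  and both its nonzero singular values are the Euclidean norm of \<open>a\<close>. In any case its Schatten norm is
  \<open>2 powr (1 / p) * \<parallel>a\<parallel>\<close>. Since \<open>\<langle>f, \<phi>\<rangle>\<close> is the inner product of \<open>b\<close> and \<open>a\<close>, the Cauchy-Schwarz
  inequality reduces the claim to a lower bound of \<open>\<parallel>f\<parallel>\<^sub>1\<close> by the Euclidean norm of \<open>b\<close>. The bound on \<open>p\<close> says
  exactly that \<open>2 powr (1 / p)\<close> is at least \<open>2 / sqrt pi\<close>, the inverse of the optimal constant in the Khinchine
  inequality for independent variables uniformly distributed on the circle (a result of Sawa):
  \<open>sqrt pi / 2 * \<parallel>b\<parallel> \<le> \<parallel>\<Sum> b\<^sub>i z\<^sub>i\<parallel>\<^sub>1\<close>, here \<open>khinchine_steinhaus\<close>.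

  For this inequality let \<open>J(t)\<close> be the mean of \<open>cos (t * Re w)\<close> over the circle, the Bessel function of order
  zero, and let \<open>S = \<Sum> b\<^sub>i z\<^sub>i\<close>. The integral of \<open>1 - J(t \<bar>x\<bar>)\<close> against \<open>dt / t\<^sup>2\<close> over the positive half-line
  is \<open>\<bar>x\<bar>\<close>, and the mean of \<open>J(t \<bar>S\<bar>)\<close> is the product of the \<open>J(t \<bar>b\<^sub>i\<bar>)\<close>. So \<open>\<parallel>S\<parallel>\<^sub>1\<close> is the integral of one
  minus this product. The weighted inequality of arithmetic and geometric means separates the factors and leaves
  the one-variable integrals \<open>H(s) = \<integral> (1 - \<bar>J(t)\<bar> powr s) dt / t\<^sup>2\<close>. The Gaussian \<open>exp (- t\<^sup>2 / 4)\<close>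
  in place of \<open>J\<close> would give \<open>sqrt (pi * s) / 2\<close>, and the heart of the proof is that \<open>H(s)\<close> is at least this value
  for \<open>s \<ge> 2\<close> (\<open>bessel_power_integral_ge\<close>). At \<open>s = 2\<close> the integral is \<open>4 / pi\<close>, the mean of \<open>\<bar>1 + w\<bar>\<close>, which beats
  the Gaussian value \<open>sqrt (pi / 2)\<close> by a margin. This margin carries over to larger \<open>s\<close>: up to some point
  \<open>\<bar>J\<bar>\<close> stays below the Gaussian, and beyond it \<open>\<bar>J\<bar>\<close> stays below the value \<open>\<rho>\<close> which the Gaussian takes there. A
  pointwise comparison with the factor \<open>\<rho> powr (s - 2)\<close> then loses only the Gaussian tail beyond that point,
  which is smaller than the margin.

  Let \<open>V\<close> be the sum of all \<open>\<bar>b\<^sub>i\<bar>\<^sup>2\<close>. If each of them is at most \<open>V / 2\<close>, the weights \<open>\<bar>b\<^sub>i\<bar>\<^sup>2 / V\<close> give the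
  inequality at once. Otherwise normalise the largest coefficient to modulus 1 and let \<open>V\<close>, now less than 1, be
  the sum over the other coefficients. If \<open>V \<ge> 3 / 5\<close>, the large coefficient receives the weight 1/2
  and contributes the exact value \<open>H(2) = 4 / pi\<close>. If \<open>V \<le> 3 / 5\<close>, averaging over the large
  variable alone bounds \<open>\<parallel>S\<parallel>\<^sub>1\<close> below by a polynomial in the second and fourth moments of the remaining sum.
\<close>

section \<open>Integration over the circle\<close>

lemma sets_circle_measure [measurable_cong]:
  "sets circle_measure = sets (restrict_space borel (sphere 0 1))"
  by (simp add: circle_measure_def)

lemma space_circle_measure: "space circle_measure = sphere 0 1"
  by (simp add: circle_measure_def space_restrict_space)

interpretation circle: prob_space circle_measure
  by (rule prob_space_circle_measure)

interpretation circle_product: product_prob_space "\<lambda>_::nat. circle_measure" UNIV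
  by (intro product_prob_spaceI prob_space_circle_measure)

lemma borel_measurable_circle [measurable]:
  "h \<in> borel_measurable borel \<Longrightarrow> h \<in> borel_measurable circle_measure"
  by (simp add: circle_measure_def measurable_distr_eq1 measurable_restrict_space1)

lemma integrable_circle:
  fixes h :: "complex \<Rightarrow> 'a::{banach, second_countable_topology}"
  assumes "continuous_on UNIV h"
  shows "integrable circle_measure h"
proof -
  have "compact (h ` sphere 0 1)"
    by (intro compact_continuous_image continuous_on_subset[OF assms]) auto
  then obtain B where "\<And>w. w \<in> sphere 0 1 \<Longrightarrow> norm (h w) \<le> B"
    by (meson compact_imp_bounded bounded_iff image_eqI)
  then show ?thesis
    by (intro circle.integrable_const_bound[where B = B] AE_I2
        borel_measurable_circle borel_measurable_continuous_onI assms)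
      (simp add: space_circle_measure)
qed

lemma integral_circle:
  fixes h :: "complex \<Rightarrow> 'a::euclidean_space"
  assumes "continuous_on UNIV h"
  shows "(LINT w|circle_measure. h w) = (1 / (2 * pi)) *\<^sub>R integral {0..2 * pi} (\<lambda>\<theta>. h (cis \<theta>))"
proof -
  have cis: "cis \<in> uniform_measure lborel {0..2 * pi} \<rightarrow>\<^sub>M restrict_space borel (sphere 0 1)"
  proof (rule measurable_restrict_space2)
    show "cis \<in> uniform_measure lborel {0..2 * pi} \<rightarrow>\<^sub>M borel"
      by (subst measurable_cong_sets[where M' = borel and N' = borel])
        (simp_all add: borel_measurable_continuous_onI continuous_intros)
  qed auto
  have h: "h \<in> borel_measurable borel"
    using assms by (rule borel_measurable_continuous_onI)
  have "(LINT w|circle_measure. h w) = (LINT \<theta>|uniform_measure lborel {0..2 * pi}. h (cis \<theta>))"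
    unfolding circle_measure_def
    by (rule integral_distr[OF cis]) (rule measurable_restrict_space1[OF h])
  also have "\<dots> = (LINT \<theta>|lborel. (indicator {0..2 * pi} \<theta> / (2 * pi)) *\<^sub>R h (cis \<theta>))"
  proof -
    have density: "uniform_measure lborel {0..2 * pi} =
        density lborel (\<lambda>\<theta>. ennreal (indicator {0..2 * pi} \<theta> / (2 * pi)))"
      unfolding uniform_measure_def
      by (intro density_cong AE_I2) (simp_all add: indicator_def divide_ennreal[symmetric])
    show ?thesis
      unfolding density
    proof (rule integral_density)
      show "(\<lambda>\<theta>. h (cis \<theta>)) \<in> borel_measurable lborel"
        unfolding measurable_lborel2
        by (intro measurable_compose[OF _ h] borel_measurable_continuous_onI continuous_intros)
      show "(\<lambda>\<theta>::real. indicator {0..2 * pi} \<theta> / (2 * pi)) \<in> borel_measurable lborel"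
        by measurable
      show "AE \<theta> in lborel. 0 \<le> indicator {0..2 * pi} \<theta> / (2 * pi)"
        by (rule AE_I2) (simp add: indicator_def)
    qed
  qed
  also have "\<dots> = (1 / (2 * pi)) *\<^sub>R (LINT \<theta>:{0..2 * pi}|lborel. h (cis \<theta>))"
    by (simp only: set_lebesgue_integral_def integral_scaleR_right[symmetric] scaleR_scaleR
        times_divide_eq_left mult_1)
  also have "(LINT \<theta>:{0..2 * pi}|lborel. h (cis \<theta>)) = integral {0..2 * pi} (\<lambda>\<theta>. h (cis \<theta>))"
  proof (intro set_borel_integral_eq_integral borel_integrable_atLeastAtMost')
    show "continuous_on {0..2 * pi} (\<lambda>\<theta>. h (cis \<theta>))"
      by (rule continuous_on_compose2[OF assms]) (auto intro!: continuous_intros)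
  qed
  finally show ?thesis .
qed

lemma integral_circle_FTC:
  fixes h F :: "_ \<Rightarrow> 'a::euclidean_space"
  assumes "continuous_on UNIV h"
    and "\<And>\<theta>. (F has_vector_derivative h (cis \<theta>)) (at \<theta>)"
  shows "(LINT w|circle_measure. h w) = (1 / (2 * pi)) *\<^sub>R (F (2 * pi) - F 0)"
  using integral_unique[OF fundamental_theorem_of_calculus[of 0 "2 * pi" F "\<lambda>\<theta>. h (cis \<theta>)"]] assms
  by (simp add: integral_circle has_vector_derivative_at_within)

lemma integral_circle_power:
  "(LINT w|circle_measure. w ^ k) = (if k = 0 then 1 else 0)"
proof (cases "k = 0")
  case False
  have "((\<lambda>\<theta>. exp (\<i> * k * complex_of_real \<theta>) / (\<i> * k)) has_vector_derivative cis \<theta> ^ k) (at \<theta>)" for \<theta>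
    by (rule has_vector_derivative_real_field)
      (use False in \<open>auto intro!: derivative_eq_intros simp: DeMoivre cis_conv_exp exp_of_nat_mult[symmetric] mult_ac\<close>)
  then have "(LINT w|circle_measure. w ^ k) = (1 / (2 * pi)) *\<^sub>R
      (exp (\<i> * k * complex_of_real (2 * pi)) / (\<i> * k) - exp (\<i> * k * complex_of_real 0) / (\<i> * k))"
    by (intro integral_circle_FTC continuous_intros)
  also have "exp (\<i> * k * complex_of_real (2 * pi)) = 1"
    using exp_integer_2pi[of "of_nat k"] by (simp add: mult_ac)
  finally show ?thesis using False by simp
qed (simp add: circle.prob_space)

text \<open>
  A rotation shifts the angle, and the shifted interval is cut at \<open>2 * pi\<close> and reassembled by periodicity.
\<close>

lemma integral_circle_rotate:
  fixes h :: "complex \<Rightarrow> 'a::euclidean_space"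
  assumes h: "continuous_on UNIV h" and "cmod u = 1"
  shows "(LINT w|circle_measure. h (u * w)) = (LINT w|circle_measure. h w)"
proof -
  obtain a where a: "0 \<le> a" "a < 2 * pi" "u = cis a"
    using assms Arg2pi[of u] by (metis Arg2pi_eq Arg2pi_ge_0 Arg2pi_lt_2pi cis_conv_exp mult_1 of_real_1)
  let ?g = "\<lambda>\<theta>. h (cis \<theta>)"
  have cont: "continuous_on S ?g" for S
    by (intro continuous_on_compose2[OF h]) (auto intro!: continuous_intros)
  have int: "?g integrable_on {x..y}" for x y
    by (intro integrable_continuous_interval cont)
  have "integral {0..2 * pi} (\<lambda>\<theta>. h (u * cis \<theta>)) = integral {0..2 * pi} (\<lambda>\<theta>. ?g (\<theta> + a))"
    by (simp add: a cis_mult add.commute)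
  also have "\<dots> = integral {a..2 * pi + a} ?g"
    using integral_shift_real_ivl[of a a "2 * pi + a" ?g] by simp
  also have "\<dots> = integral {a..2 * pi} ?g + integral {2 * pi..2 * pi + a} ?g"
    using a by (intro Henstock_Kurzweil_Integration.integral_combine[symmetric] int) auto
  also have "integral {2 * pi..2 * pi + a} ?g = integral {0..a} (\<lambda>\<theta>. ?g (\<theta> + 2 * pi))"
    using integral_shift_real_ivl[of "2 * pi" "2 * pi" "2 * pi + a" ?g] by simp
  also have "\<dots> = integral {0..a} ?g"
    by (simp add: cis_mult[symmetric])
  also have "integral {a..2 * pi} ?g + integral {0..a} ?g = integral {0..2 * pi} ?g"
    using a by (subst add.commute) (intro Henstock_Kurzweil_Integration.integral_combine int, auto)
  finally show ?thesis
    using h by (simp add: integral_circle continuous_on_compose2[OF h] continuous_on_mult_left)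
qed

section \<open>Linear functions on the torus\<close>

lemma steinhaus_sum_measurable [measurable]:
  "(\<lambda>z. \<Sum>i\<in>I. b i * z i) \<in> borel_measurable (PiM I (\<lambda>_::nat. circle_measure))"
proof -
  have "(\<lambda>w. c * w) \<in> borel_measurable circle_measure" for c
    by (intro borel_measurable_circle borel_measurable_continuous_onI continuous_intros)
  then show ?thesis
    by (intro borel_measurable_sum measurable_compose[OF measurable_component_singleton])
qed

lemma space_circle_product: "z \<in> space (PiM I (\<lambda>_::nat. circle_measure)) \<Longrightarrow> i \<in> I \<Longrightarrow> cmod (z i) = 1"
  by (auto simp: space_PiM space_circle_measure PiE_iff)

lemma integrable_steinhaus_sum:
  fixes h :: "complex \<Rightarrow> 'a::{banach, second_countable_topology}"
  assumes "continuous_on UNIV h"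
  shows "integrable (PiM I (\<lambda>_::nat. circle_measure)) (\<lambda>z. h (\<Sum>i\<in>I. b i * z i))"
proof -
  interpret P: prob_space "PiM I (\<lambda>_::nat. circle_measure)"
    by (intro prob_space_PiM prob_space_circle_measure)
  define R where "R = (\<Sum>i\<in>I. cmod (b i))"
  have "compact (h ` cball 0 R)"
    by (intro compact_continuous_image continuous_on_subset[OF assms]) auto
  then obtain B where B: "\<And>w. w \<in> cball 0 R \<Longrightarrow> norm (h w) \<le> B"
    by (meson compact_imp_bounded bounded_iff image_eqI)
  have "cmod (\<Sum>i\<in>I. b i * z i) \<le> R" if "z \<in> space (PiM I (\<lambda>_::nat. circle_measure))" for z
    unfolding R_def using space_circle_product[OF that]
    by (intro order_trans[OF norm_sum] sum_mono) (simp add: norm_mult)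
  then show ?thesis
    by (intro P.integrable_const_bound[where B = B] AE_I2 B
        measurable_compose[OF steinhaus_sum_measurable] borel_measurable_continuous_onI assms) simp
qed

text \<open>
  Averages of functions of \<open>\<Sum> b\<^sub>i z\<^sub>i\<close> are computed one variable at a time; all inductions below run
  through this step.
\<close>

lemma integral_steinhaus_sum_insert:
  fixes I :: "nat set" and h :: "complex \<Rightarrow> 'a::{banach, second_countable_topology}"
  assumes "continuous_on UNIV h" and "finite I" "j \<notin> I"
  shows "(LINT z|PiM (insert j I) (\<lambda>_. circle_measure). h (\<Sum>i\<in>insert j I. b i * z i)) =
    (LINT z|PiM I (\<lambda>_. circle_measure). LINT w|circle_measure. h ((\<Sum>i\<in>I. b i * z i) + b j * w))"
proof -
  have "(\<Sum>i\<in>insert j I. b i * (z(j := w)) i) = (\<Sum>i\<in>I. b i * z i) + b j * w" for z w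
    using assms by (simp add: add.commute cong: sum.cong_simp) (intro sum.cong, auto)
  then show ?thesis
    using circle_product.product_integral_insert[OF assms(2,3) integrable_steinhaus_sum[OF assms(1), of "insert j I" b]]
    by presburger
qed

lemma integral_torus_finite:
  fixes F :: "(nat \<Rightarrow> complex) \<Rightarrow> 'a::{banach, second_countable_topology}"
  assumes "finite I" and F: "F \<in> borel_measurable (PiM I (\<lambda>_. circle_measure))"
    and "\<And>z. F (restrict z I) = G z"
  shows "(LINT z|torus. G z) = (LINT z|PiM I (\<lambda>_. circle_measure). F z)"
proof -
  have "(LINT z|PiM I (\<lambda>_. circle_measure). F z) =
      (LINT z|distr torus (PiM I (\<lambda>_. circle_measure)) (\<lambda>z. restrict z I). F z)"
    unfolding torus_def using circle_product.distr_PiM_restrict_finite[of I] assms(1) by simp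
  also have "\<dots> = (LINT z|torus. F (restrict z I))"
    unfolding torus_def by (intro integral_distr F measurable_restrict_subset) simp
  finally show ?thesis
    using assms(3) by simp
qed

lemma integrable_torus_finite:
  fixes F :: "(nat \<Rightarrow> complex) \<Rightarrow> 'a::{banach, second_countable_topology}"
  assumes "finite I" and F: "integrable (PiM I (\<lambda>_. circle_measure)) F"
    and "\<And>z. F (restrict z I) = G z"
  shows "integrable torus G"
proof -
  have "integrable (distr torus (PiM I (\<lambda>_. circle_measure)) (\<lambda>z. restrict z I)) F"
    unfolding torus_def using circle_product.distr_PiM_restrict_finite[of I] assms(1) F by simp
  then have "integrable torus (\<lambda>z. F (restrict z I))"
    unfolding torus_def by (rule integrable_distr[rotated]) (intro measurable_restrict_subset, simp)
  then show ?thesis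
    using assms(3) by simp
qed

lemma integral_circle_power_cnj:
  "(LINT w|circle_measure. w ^ k * cnj w) = (if k = 1 then 1 else 0)"
proof (cases k)
  case 0
  have "(LINT w|circle_measure. cnj w) = cnj (LINT w|circle_measure. w ^ 1)"
    by simp
  also have "\<dots> = 0"
    unfolding integral_circle_power by simp
  finally show ?thesis
    using 0 by simp
next
  case (Suc m)
  have "(LINT w|circle_measure. w ^ k * cnj w) = (LINT w|circle_measure. w ^ m)"
    by (intro Bochner_Integration.integral_cong)
      (auto simp: Suc space_circle_measure mult.commute mult.left_commute complex_norm_square[symmetric] mult.assoc[symmetric])
  then show ?thesis
    using Suc by (simp add: integral_circle_power)
qed

abbreviation coordinate_prime :: "nat \<Rightarrow> nat" where
  "coordinate_prime \<equiv> enumerate {q. prime q}"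

lemma coordinate_prime_eq_iff: "coordinate_prime i = coordinate_prime j \<longleftrightarrow> i = j"
  using strict_mono_enumerate[OF primes_infinite] by (simp add: strict_mono_eq)

lemma prime_exponent_coordinate_prime: "prime_exponent (coordinate_prime j) i = (if i = j then 1 else 0)"
  using prime_enumerate[of j] prime_enumerate[of i] coordinate_prime_eq_iff[of i j]
  by (auto simp: prime_exponent_def prime_multiplicity_other)

lemma torus_monomial_coordinate_prime: "torus_monomial (coordinate_prime j) z = z j"
  by (simp add: torus_monomial_def prime_exponent_coordinate_prime)

lemma prime_exponent_determines:
  assumes "m > 0" "n > 0" "\<And>i. prime_exponent m i = prime_exponent n i"
  shows "m = n"
proof (rule multiplicity_eq_nat)
  show "multiplicity q m = multiplicity q n" if "prime q" for q
  proof -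
    obtain i where "q = coordinate_prime i"
      using enumerate_Ex[OF primes_infinite, of q] \<open>prime q\<close> by auto
    then show ?thesis
      using assms(3)[of i] by (simp add: prime_exponent_def)
  qed
qed (use assms in auto)

text \<open>
  The integrand is a finite product of functions of single variables, and the mean of \<open>z\<^sub>i ^ k\<close>, or of
  \<open>z\<^sub>j ^ k * cnj z\<^sub>j\<close>, vanishes unless the exponent matches that of the prime \<open>p\<^sub>j\<close>.
\<close>

lemma torus_monomial_times_cnj_coordinate:
  assumes "n > 0"
  shows "integrable torus (\<lambda>z. torus_monomial n z * cnj (z j))"
    and "(LINT z|torus. torus_monomial n z * cnj (z j)) = (if n = coordinate_prime j then 1 else 0)"
proof -
  define I where "I = insert j {i. prime_exponent n i \<noteq> 0}"
  define g where "g i w = w ^ prime_exponent n i * (if i = j then cnj w else 1)" for i w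
  have I: "finite I" "j \<in> I"
    using finite_prime_exponent[OF assms] by (auto simp: I_def)
  have g: "integrable circle_measure (g i)" for i
    unfolding g_def by (intro integrable_circle, cases "i = j") (auto intro!: continuous_intros)
  have eq: "(\<Prod>i\<in>I. g i (restrict z I i)) = torus_monomial n z * cnj (z j)" for z
  proof -
    have "(\<Prod>i\<in>I. g i (restrict z I i)) = (\<Prod>i\<in>I. z i ^ prime_exponent n i) * (\<Prod>i\<in>I. if i = j then cnj (z i) else 1)"
      by (subst prod.distrib[symmetric], intro prod.cong) (auto simp: g_def)
    also have "(\<Prod>i\<in>I. z i ^ prime_exponent n i) = torus_monomial n z"
      unfolding torus_monomial_def using I by (intro prod.mono_neutral_right) (auto simp: I_def)
    finally show ?thesis
      using I by simp
  qed
  have int: "integrable (PiM I (\<lambda>_. circle_measure)) (\<lambda>z. \<Prod>i\<in>I. g i (z i))"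
    by (intro circle_product.product_integrable_prod I g)
  show "integrable torus (\<lambda>z. torus_monomial n z * cnj (z j))"
    by (rule integrable_torus_finite[OF I(1) int eq])
  have "(LINT z|torus. torus_monomial n z * cnj (z j)) = (LINT z|PiM I (\<lambda>_. circle_measure). (\<Prod>i\<in>I. g i (z i)))"
    by (rule integral_torus_finite[OF I(1) borel_measurable_integrable[OF int] eq])
  also have "\<dots> = (\<Prod>i\<in>I. LINT w|circle_measure. g i w)"
    by (intro circle_product.product_integral_prod I g)
  also have "\<dots> = (\<Prod>i\<in>I. if prime_exponent n i = prime_exponent (coordinate_prime j) i then 1 else 0)"
  proof (intro prod.cong refl)
    fix i
    show "(LINT w|circle_measure. g i w) = (if prime_exponent n i = prime_exponent (coordinate_prime j) i then 1 else 0)"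
      by (cases "i = j") (simp_all only: g_def prime_exponent_coordinate_prime if_True if_False mult_1_right
          integral_circle_power_cnj integral_circle_power simp_thms)
  qed
  also have "\<dots> = (if n = coordinate_prime j then 1 else 0)"
  proof (cases "n = coordinate_prime j")
    case False
    then obtain i where i: "prime_exponent n i \<noteq> prime_exponent (coordinate_prime j) i"
      using prime_exponent_determines[OF assms] prime_enumerate[of j] prime_gt_0_nat by blast
    then have "i \<in> I"
      by (auto simp: I_def prime_exponent_coordinate_prime split: if_splits)
    then show ?thesis
      using i I False by (simp add: prod_zero) (metis (mono_tags, lifting) i prod_zero)
  qed simp
  finally show "(LINT z|torus. torus_monomial n z * cnj (z j)) = (if n = coordinate_prime j then 1 else 0)" .
qed

lemma hankel_coeff_linear:
  assumes "n > 0"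
  shows "hankel_coeff (\<lambda>z. \<Sum>j<d. a j * z j) n = (\<Sum>j<d. if n = coordinate_prime j then cnj (a j) else 0)"
proof -
  have "hankel_coeff (\<lambda>z. \<Sum>j<d. a j * z j) n =
      (LINT z|torus. (\<Sum>j<d. cnj (a j) * (torus_monomial n z * cnj (z j))))"
    by (simp add: hankel_coeff_def torus_inner_def sum_distrib_left mult_ac)
  also have "\<dots> = (\<Sum>j<d. LINT z|torus. cnj (a j) * (torus_monomial n z * cnj (z j)))"
    using torus_monomial_times_cnj_coordinate[OF assms] by (intro Bochner_Integration.integral_sum) auto
  also have "\<dots> = (\<Sum>j<d. cnj (a j) * (if n = coordinate_prime j then 1 else 0))"
    by (intro sum.cong refl) (simp add: torus_monomial_times_cnj_coordinate[OF assms])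
  finally show ?thesis
    by (simp add: if_distrib cong: if_cong)
qed

lemma torus_inner_linear:
  "torus_inner (\<lambda>z. \<Sum>j<d. b j * z j) (\<lambda>z. \<Sum>j<d. a j * z j) = (\<Sum>j<d. b j * cnj (a j))"
proof -
  let ?m = "\<lambda>i j z. torus_monomial (coordinate_prime i) z * cnj (z j)"
  have pos: "coordinate_prime i > 0" for i
    using prime_enumerate[of i] by (simp add: prime_gt_0_nat)
  have "torus_inner (\<lambda>z. \<Sum>j<d. b j * z j) (\<lambda>z. \<Sum>j<d. a j * z j) =
      (LINT z|torus. (\<Sum>i<d. \<Sum>j<d. (b i * cnj (a j)) * ?m i j z))"
    by (simp add: torus_inner_def sum_product torus_monomial_coordinate_prime mult_ac)
  also have "\<dots> = (\<Sum>i<d. \<Sum>j<d. LINT z|torus. (b i * cnj (a j)) * ?m i j z)"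
    using torus_monomial_times_cnj_coordinate(1)[OF pos]
    by (simp add: Bochner_Integration.integral_sum Bochner_Integration.integrable_sum)
  also have "\<dots> = (\<Sum>i<d. \<Sum>j<d. (b i * cnj (a j)) * (if i = j then 1 else 0))"
    by (intro sum.cong refl) (simp add: torus_monomial_times_cnj_coordinate(2)[OF pos] coordinate_prime_eq_iff)
  finally show ?thesis
    by (simp add: if_distrib cong: if_cong)
qed

lemma torus_norm1_linear:
  assumes "finite I" "{j. j < d \<and> b j \<noteq> 0} \<subseteq> I" "I \<subseteq> {..<d}"
  shows "torus_norm1 (\<lambda>z. \<Sum>j<d. b j * z j) = (LINT z|PiM I (\<lambda>_. circle_measure). cmod (\<Sum>j\<in>I. b j * z j))"
  unfolding torus_norm1_def
proof (rule integral_torus_finite[OF assms(1)])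
  show "(\<lambda>z. cmod (\<Sum>j\<in>I. b j * z j)) \<in> borel_measurable (PiM I (\<lambda>_. circle_measure))"
    by measurable
  have "(\<Sum>j\<in>I. b j * z j) = (\<Sum>j<d. b j * z j)" for z
    using assms by (intro sum.mono_neutral_left) auto
  then show "cmod (\<Sum>j\<in>I. b j * restrict z I j) = cmod (\<Sum>j<d. b j * z j)" for z
    by (simp cong: sum.cong_simp)
qed

section \<open>Singular values of a weighted star\<close>

text \<open>
  The star has the index 0 as its centre; the edge to \<open>n\<close> has the weight \<open>\<alpha> n\<close>.
\<close>

definition star_matrix :: "(nat \<Rightarrow> complex) \<Rightarrow> nat \<Rightarrow> nat \<Rightarrow> complex" where
  "star_matrix \<alpha> m n = (if m = 0 then \<alpha> n else if n = 0 then \<alpha> m else 0)"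

interpretation seq: vector_space seq_scale
  by (rule vector_space_seq_scale)

locale star =
  fixes \<alpha> :: "nat \<Rightarrow> complex"
  assumes centre: "\<alpha> 0 = 0" and finite_support: "finite {n. \<alpha> n \<noteq> 0}"
begin

definition pairing :: "(nat \<Rightarrow> complex) \<Rightarrow> complex" where
  "pairing x = (\<Sum>n | \<alpha> n \<noteq> 0. \<alpha> n * x n)"

definition weight :: real where
  "weight = sqrt (\<Sum>n | \<alpha> n \<noteq> 0. (cmod (\<alpha> n))\<^sup>2)"

lemma weight_nonneg: "0 \<le> weight"
  by (simp add: weight_def sum_nonneg)

lemma weight_squared: "weight\<^sup>2 = (\<Sum>n | \<alpha> n \<noteq> 0. (cmod (\<alpha> n))\<^sup>2)"
  by (simp add: weight_def sum_nonneg)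

lemma weight_squared_complex: "(\<Sum>n | \<alpha> n \<noteq> 0. \<alpha> n * cnj (\<alpha> n)) = complex_of_real (weight\<^sup>2)"
  by (simp add: weight_squared complex_norm_square[symmetric] del: of_real_power)

lemma apply_summable: "summable (\<lambda>n. star_matrix \<alpha> m n * x n)"
  by (rule summable_finite[of "insert 0 {n. \<alpha> n \<noteq> 0}"])
    (use finite_support in \<open>auto simp: star_matrix_def\<close>)

text \<open>
  The image of a vector depends on two numbers only: its entry at the centre and its pairing with the edges.
  Compactness and the singular values are read off from this.
\<close>

lemma apply_eq: "matrix_apply (star_matrix \<alpha>) x = (\<lambda>m. if m = 0 then pairing x else \<alpha> m * x 0)"
proof
  fix m
  show "matrix_apply (star_matrix \<alpha>) x m = (if m = 0 then pairing x else \<alpha> m * x 0)"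
  proof (cases "m = 0")
    case True
    then show ?thesis
      unfolding matrix_apply_def pairing_def
      by (subst suminf_finite[OF finite_support]) (auto simp: star_matrix_def)
  next
    case False
    then show ?thesis
      unfolding matrix_apply_def
      by (subst suminf_finite[of "{0}"]) (auto simp: star_matrix_def centre)
  qed
qed

lemma range_in_ell2: "(\<lambda>m. if m = 0 then c else \<alpha> m * e) \<in> ell2"
  unfolding ell2_def mem_Collect_eq
  by (rule summable_finite[of "insert 0 {n. \<alpha> n \<noteq> 0}"]) (use finite_support in auto)

lemma ell2_norm_range:
  "ell2_norm (\<lambda>m. if m = 0 then c else \<alpha> m * e) = sqrt ((cmod c)\<^sup>2 + weight\<^sup>2 * (cmod e)\<^sup>2)"
proof -
  have "(\<Sum>m. (cmod (if m = 0 then c else \<alpha> m * e))\<^sup>2) =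
      (\<Sum>m\<in>insert 0 {n. \<alpha> n \<noteq> 0}. (cmod (if m = 0 then c else \<alpha> m * e))\<^sup>2)"
    by (rule suminf_finite) (use finite_support in auto)
  also have "\<dots> = (cmod c)\<^sup>2 + (\<Sum>m | \<alpha> m \<noteq> 0. (cmod (if m = 0 then c else \<alpha> m * e))\<^sup>2)"
    using finite_support by (subst sum.insert) (auto simp: centre)
  also have "(\<Sum>m | \<alpha> m \<noteq> 0. (cmod (if m = 0 then c else \<alpha> m * e))\<^sup>2) =
      (\<Sum>m | \<alpha> m \<noteq> 0. (cmod (\<alpha> m))\<^sup>2 * (cmod e)\<^sup>2)"
    by (intro sum.cong) (auto simp: centre norm_mult power_mult_distrib)
  finally show ?thesis
    by (simp add: ell2_norm_def weight_squared sum_distrib_right)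
qed

text \<open>
  The two numbers that determine the image stay bounded on the unit ball, so the Bolzano-Weierstrass theorem
  applies to them.
\<close>

lemma compact: "compact_matrix (star_matrix \<alpha>)"
  unfolding compact_matrix_def
proof (intro conjI allI impI)
  show "matrix_on_ell2 (star_matrix \<alpha>)"
    unfolding matrix_on_ell2_def by (simp add: apply_summable apply_eq range_in_ell2)
  fix X :: "nat \<Rightarrow> nat \<Rightarrow> complex"
  assume X: "\<forall>k. X k \<in> ell2 \<and> ell2_norm (X k) \<le> 1"
  have entry: "cmod (X k n) \<le> 1" for k n
  proof -
    have "(cmod (X k n))\<^sup>2 = (\<Sum>n\<in>{n}. (cmod (X k n))\<^sup>2)"
      by simp
    also have "\<dots> \<le> (\<Sum>n. (cmod (X k n))\<^sup>2)"
      using X by (intro sum_le_suminf) (auto simp: ell2_def)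
    also have "\<dots> \<le> 1"
      using X by (simp add: ell2_norm_def)
    finally show ?thesis
      by (simp add: power_le_one_iff)
  qed
  define f where "f k = (pairing (X k), X k 0)" for k
  have "bounded (range f)"
  proof (rule bounded_subset)
    show "bounded (cball 0 (\<Sum>n | \<alpha> n \<noteq> 0. cmod (\<alpha> n)) \<times> cball (0::complex) 1)"
      by (intro bounded_Times bounded_cball)
    have "cmod (pairing (X k)) \<le> (\<Sum>n | \<alpha> n \<noteq> 0. cmod (\<alpha> n))" for k
      unfolding pairing_def using entry
      by (intro order_trans[OF norm_sum] sum_mono) (simp add: norm_mult mult_left_le)
    then show "range f \<subseteq> cball 0 (\<Sum>n | \<alpha> n \<noteq> 0. cmod (\<alpha> n)) \<times> cball 0 1"
      using entry by (auto simp: f_def)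
  qed
  then obtain l r where r: "strict_mono r" "(f \<circ> r) \<longlonglongrightarrow> l"
    using bounded_imp_convergent_subsequence by blast
  obtain c e where l: "l = (c, e)"
    by force
  define y where "y = (\<lambda>m. if m = 0 then c else \<alpha> m * e)"
  have eq: "(\<lambda>n. matrix_apply (star_matrix \<alpha>) (X (r k)) n - y n) =
      (\<lambda>m. if m = 0 then pairing (X (r k)) - c else \<alpha> m * (X (r k) 0 - e))" for k
    by (auto simp: apply_eq y_def algebra_simps)
  have "(\<lambda>k. pairing (X (r k))) \<longlonglongrightarrow> c" "(\<lambda>k. X (r k) 0) \<longlonglongrightarrow> e"
    using tendsto_fst[OF r(2)] tendsto_snd[OF r(2)] by (simp_all add: f_def l o_def)
  then have "(\<lambda>k. sqrt ((cmod (pairing (X (r k)) - c))\<^sup>2 + weight\<^sup>2 * (cmod (X (r k) 0 - e))\<^sup>2))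
      \<longlonglongrightarrow> sqrt ((cmod (c - c))\<^sup>2 + weight\<^sup>2 * (cmod (e - e))\<^sup>2)"
    by (intro tendsto_intros)
  then have "(\<lambda>k. ell2_norm (\<lambda>n. matrix_apply (star_matrix \<alpha>) (X (r k)) n - y n)) \<longlonglongrightarrow> 0"
    by (simp add: eq ell2_norm_range)
  then show "\<exists>r. \<exists>y\<in>ell2. strict_mono r \<and>
      (\<lambda>k. ell2_norm (\<lambda>n. matrix_apply (star_matrix \<alpha>) (X (r k)) n - y n)) \<longlonglongrightarrow> 0"
    using r(1) range_in_ell2[of c e, folded y_def] by (intro exI[of _ r] bexI[of _ y] conjI)
qed

lemma adjoint_apply_eq:
  "matrix_apply (matrix_adjoint (star_matrix \<alpha>)) (matrix_apply (star_matrix \<alpha>) x) =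
    (\<lambda>m. if m = 0 then of_real (weight\<^sup>2) * x 0 else cnj (\<alpha> m) * pairing x)"
proof -
  interpret conj: star "\<lambda>n. cnj (\<alpha> n)"
    by unfold_locales (use centre finite_support in auto)
  have "matrix_adjoint (star_matrix \<alpha>) = star_matrix (\<lambda>n. cnj (\<alpha> n))"
    by (auto simp: fun_eq_iff matrix_adjoint_def star_matrix_def centre)
  moreover have "(\<Sum>n | \<alpha> n \<noteq> 0. cnj (\<alpha> n) * (if n = 0 then pairing x else \<alpha> n * x 0)) =
      (\<Sum>n | \<alpha> n \<noteq> 0. \<alpha> n * cnj (\<alpha> n) * x 0)"
    by (intro sum.cong) (auto simp: centre)
  ultimately show ?thesis
    by (simp add: conj.apply_eq apply_eq conj.pairing_def sum_distrib_right[symmetric] weight_squared_complex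
        cong: if_cong del: of_real_power)
qed

lemma singular_space_iff:
  "x \<in> singular_space (star_matrix \<alpha>) s \<longleftrightarrow> x \<in> ell2 \<and>
    of_real (weight\<^sup>2) * x 0 = of_real (s\<^sup>2) * x 0 \<and> (\<forall>m>0. cnj (\<alpha> m) * pairing x = of_real (s\<^sup>2) * x m)"
proof -
  have "(\<forall>m. (if m = 0 then u else v m) = c * x m) \<longleftrightarrow> u = c * x 0 \<and> (\<forall>m>0. v m = c * x m)"
    for u c :: complex and v :: "nat \<Rightarrow> complex"
    by (metis neq0_conv)
  then show ?thesis
    unfolding singular_space_def adjoint_apply_eq mem_Collect_eq seq_scale_def fun_eq_iff by presburger
qed

text \<open>
  An eigenvector of \<open>A\<^sup>* A\<close> for a positive eigenvalue is proportional to the conjugate edge weights off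
  the centre.
\<close>

lemma pairing_proportional:
  assumes "\<And>m. m > 0 \<Longrightarrow> x m = cnj (\<alpha> m) * c"
  shows "pairing x = of_real (weight\<^sup>2) * c"
proof -
  have "pairing x = (\<Sum>n | \<alpha> n \<noteq> 0. \<alpha> n * cnj (\<alpha> n) * c)"
    unfolding pairing_def using assms centre
    by (intro sum.cong) (auto simp: mult.assoc intro!: assms gr0I)
  then show ?thesis
    by (simp add: sum_distrib_right[symmetric] weight_squared_complex del: of_real_power)
qed

text \<open>
  For \<open>s = weight\<close> the eigenspace is spanned by the unit vector at the centre and by the vector of conjugate
  edge weights. For any other \<open>s > 0\<close> the equation at the centre forces \<open>x 0 = 0\<close>, and pairing the remaining
  equations with the edges forces \<open>pairing x = 0\<close>.
\<close>

lemma dim_singular_space: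
  assumes "s > 0"
  shows "seq.dim (singular_space (star_matrix \<alpha>) s) = (if s = weight then 2 else 0)"
proof -
  let ?V = "singular_space (star_matrix \<alpha>) s"
  have shape: "x m = cnj (\<alpha> m) * (pairing x / of_real (s\<^sup>2))" if "x \<in> ?V" "m > 0" for x m
    using that assms by (simp add: singular_space_iff field_simps)
  show ?thesis
  proof (cases "s = weight")
    case False
    have "?V \<subseteq> {0}"
    proof
      fix x assume x: "x \<in> ?V"
      have ne: "complex_of_real (weight\<^sup>2) \<noteq> of_real (s\<^sup>2)"
        using False assms weight_nonneg by (simp del: of_real_power)
      have "x 0 = 0"
        using x ne by (auto simp: singular_space_iff)
      moreover have "pairing x = of_real (weight\<^sup>2) * (pairing x / of_real (s\<^sup>2))"
        by (rule pairing_proportional) (use shape x in auto)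
      then have "pairing x = 0"
        using ne assms by (simp add: field_simps del: of_real_power)
      ultimately have "x m = 0" for m
        using shape[OF x, of m] by (cases "m = 0") auto
      then show "x \<in> {0}"
        by (simp add: fun_eq_iff zero_fun_def)
    qed
    moreover have "0 \<in> ?V"
      by (simp add: singular_space_iff ell2_def pairing_def)
    ultimately have V: "?V = {0}"
      by blast
    have "seq.dim ?V = 0"
      unfolding V by (rule seq.dim_unique[of "{}"]) (simp_all add: seq.independent_empty)
    with False show ?thesis
      by (simp only: if_False)
  next
    case True
    define e where "e = (\<lambda>n::nat. if n = 0 then 1 else 0 :: complex)"
    define u where "u = (\<lambda>n. cnj (\<alpha> n))"
    have "\<exists>n. \<alpha> n \<noteq> 0"
    proof (rule ccontr)
      assume "\<not> ?thesis"
      then have "{n. \<alpha> n \<noteq> 0} = {}"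
        by simp
      then have "weight = 0"
        by (simp only: weight_def sum.empty real_sqrt_zero)
      then show False
        using True assms by simp
    qed
    then obtain n where n: "\<alpha> n \<noteq> 0" ..
    have "e \<noteq> seq_scale k u" for k
    proof
      assume "e = seq_scale k u"
      then have "e 0 = seq_scale k u 0"
        by (rule fun_cong)
      then show False
        by (simp add: e_def u_def seq_scale_def centre)
    qed
    then have e: "e \<notin> seq.span {u}"
      by (auto simp: seq.span_singleton)
    have u: "u \<noteq> 0"
    proof
      assume "u = 0"
      then have "u n = 0 n"
        by (rule fun_cong)
      then show False
        using n by (simp add: u_def)
    qed
    have "seq.dim ?V = 2"
    proof (rule seq.dim_unique)
      show "seq.independent {e, u}"
        using e u by (simp add: seq.independent_insert)
      have "e \<noteq> u"
        using e seq.span_base by blast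
      then show "card {e, u} = 2"
        by simp
      have "e \<in> ?V"
      proof -
        have "e \<in> ell2"
          using summable_finite[of "{0}" "\<lambda>n. (cmod (e n))\<^sup>2"] by (simp add: ell2_def e_def)
        moreover have "pairing e = of_real (weight\<^sup>2) * 0"
          by (rule pairing_proportional) (simp add: e_def)
        ultimately show ?thesis
          using True by (simp add: singular_space_iff e_def)
      qed
      moreover have "u \<in> ?V"
      proof -
        have "u \<in> ell2"
          using summable_finite[OF finite_support, of "\<lambda>n. (cmod (u n))\<^sup>2"] by (simp add: ell2_def u_def)
        moreover have "pairing u = of_real (weight\<^sup>2) * 1"
          by (rule pairing_proportional) (simp add: u_def)
        ultimately show ?thesis
          using True by (simp add: singular_space_iff u_def mult.commute)
      qed
      ultimately show "{e, u} \<subseteq> ?V"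
        by simp
      show "?V \<subseteq> seq.span {e, u}"
      proof
        fix x assume x: "x \<in> ?V"
        have "x = seq_scale (x 0) e + seq_scale (pairing x / of_real (s\<^sup>2)) u"
        proof
          fix m
          show "x m = (seq_scale (x 0) e + seq_scale (pairing x / of_real (s\<^sup>2)) u) m"
            using shape[OF x, of m]
            by (cases "m = 0") (simp_all add: plus_fun_def seq_scale_def e_def u_def centre mult.commute)
        qed
        also have "\<dots> \<in> seq.span {e, u}"
          by (intro seq.span_add seq.span_scale seq.span_base) auto
        finally show "x \<in> seq.span {e, u}" .
      qed
    qed
    then show ?thesis
      using True by simp
  qed
qed

text \<open>
  The multiplicities determine the sequence: it takes no other value than 0 and \<open>weight\<close>, and as it decreases,
  the value \<open>weight\<close> occupies its first two places.
\<close>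

lemma singular_value_seq_iff:
  "is_singular_value_seq (star_matrix \<alpha>) \<Lambda> \<longleftrightarrow> \<Lambda> = (\<lambda>k. if k < 2 then weight else 0)"
proof
  assume \<Lambda>: "\<Lambda> = (\<lambda>k. if k < 2 then weight else 0)"
  have "decseq \<Lambda>"
    using weight_nonneg by (auto simp: \<Lambda> decseq_def)
  moreover have "eventually (\<lambda>k. \<Lambda> k = 0) sequentially"
    using eventually_ge_at_top[of 2] by eventually_elim (simp add: \<Lambda>)
  then have "\<Lambda> \<longlonglongrightarrow> 0"
    by (rule tendsto_eventually)
  moreover have "{k. \<Lambda> k = s} = (if s = weight then {..<2} else {})" if "s > 0" for s
    using that by (auto simp: \<Lambda>)
  ultimately show "is_singular_value_seq (star_matrix \<alpha>) \<Lambda>"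
    using weight_nonneg by (auto simp: is_singular_value_seq_def dim_singular_space \<Lambda>)
next
  assume "is_singular_value_seq (star_matrix \<alpha>) \<Lambda>"
  then have dec: "decseq \<Lambda>" and nonneg: "\<And>k. 0 \<le> \<Lambda> k" and lim: "\<Lambda> \<longlonglongrightarrow> 0"
    and card: "\<And>s. s > 0 \<Longrightarrow> card {k. \<Lambda> k = s} = (if s = weight then 2 else 0)"
    by (auto simp: is_singular_value_seq_def dim_singular_space)
  have finite: "finite {k. \<Lambda> k = s}" if "s > 0" for s
  proof -
    have "eventually (\<lambda>k. \<Lambda> k < s) sequentially"
      using lim that by (rule order_tendstoD)
    then obtain K where "\<And>k. k \<ge> K \<Longrightarrow> \<Lambda> k < s"
      by (auto simp: eventually_sequentially)
    then have "{k. \<Lambda> k = s} \<subseteq> {..<K}"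
      by (force simp: not_less[symmetric])
    then show ?thesis
      by (rule finite_subset) simp
  qed
  have two_valued: "\<Lambda> k = 0 \<or> \<Lambda> k = weight" for k
  proof (rule ccontr)
    assume "\<not> ?thesis"
    then have "\<Lambda> k > 0" "\<Lambda> k \<noteq> weight"
      using nonneg[of k] by auto
    then have "{j. \<Lambda> j = \<Lambda> k} = {}"
      using card finite by (metis card_eq_0_iff)
    then show False
      by blast
  qed
  show "\<Lambda> = (\<lambda>k. if k < 2 then weight else 0)"
  proof (cases "weight = 0")
    case True
    then show ?thesis
      using two_valued by (auto simp: fun_eq_iff)
  next
    case False
    then have pos: "weight > 0"
      using weight_nonneg by simp
    let ?S = "{k. \<Lambda> k = weight}"
    have cardS: "card ?S = 2" and finS: "finite ?S"
      using card[OF pos] finite[OF pos] by auto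
    have "?S \<subseteq> {..<2}"
    proof
      fix k assume "k \<in> ?S"
      have "{..k} \<subseteq> ?S"
      proof
        fix j assume "j \<in> {..k}"
        then have "\<Lambda> j \<ge> weight"
          using dec \<open>k \<in> ?S\<close> decseqD[OF dec, of j k] by simp
        then show "j \<in> ?S"
          using two_valued[of j] pos by auto
      qed
      then have "card {..k} \<le> 2"
        using card_mono[OF finS] cardS by metis
      then show "k \<in> {..<2}"
        by simp
    qed
    then have "?S = {..<2}"
      using cardS by (intro card_subset_eq) auto
    then show ?thesis
      using two_valued by (auto simp: fun_eq_iff set_eq_iff)
  qed
qed

lemma singular_values_eq: "singular_values (star_matrix \<alpha>) = (\<lambda>k. if k < 2 then weight else 0)"
  unfolding singular_values_def singular_value_seq_iff by simp

lemma schatten_sums: "(\<lambda>k. singular_values (star_matrix \<alpha>) k powr p) sums (2 * weight powr p)"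
proof -
  have "(\<lambda>k. singular_values (star_matrix \<alpha>) k powr p) sums
      (\<Sum>k<2. singular_values (star_matrix \<alpha>) k powr p)"
    by (rule sums_finite) (simp_all add: singular_values_eq)
  then show ?thesis
    by (simp add: singular_values_eq)
qed

lemma in_schatten_class: "star_matrix \<alpha> \<in> schatten_class p"
  unfolding schatten_class_def using compact sums_summable[OF schatten_sums] by simp

lemma schatten_norm_eq:
  assumes "p > 0"
  shows "schatten_norm p (star_matrix \<alpha>) = 2 powr (1 / p) * weight"
proof -
  have "schatten_norm p (star_matrix \<alpha>) = (2 * weight powr p) powr (1 / p)"
    unfolding schatten_norm_def using sums_unique[OF schatten_sums[of p]] by (simp only:)
  also have "\<dots> = 2 powr (1 / p) * (weight powr p) powr (1 / p)"
    by (rule powr_mult)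
  also have "(weight powr p) powr (1 / p) = weight"
    using assms weight_nonneg by (simp only: powr_powr) simp
  finally show ?thesis .
qed

end

section \<open>Integration against \<open>dt / t\<^sup>2\<close>\<close>

definition inverse_square_measure :: "real measure" where
  "inverse_square_measure = density lborel (\<lambda>t. ennreal (indicator {0<..} t / t\<^sup>2))"

lemma sets_inverse_square [simp, measurable_cong]: "sets inverse_square_measure = sets borel"
  by (simp add: inverse_square_measure_def)

lemma nn_integral_inverse_square:
  assumes [measurable]: "F \<in> borel_measurable borel"
  shows "(\<integral>\<^sup>+t. F t \<partial>inverse_square_measure) = (\<integral>\<^sup>+t. ennreal (indicator {0<..} t / t\<^sup>2) * F t \<partial>lborel)"
  unfolding inverse_square_measure_def by (rule nn_integral_density) measurable

lemma AE_inverse_square: "AE t in inverse_square_measure. t > 0"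
  unfolding inverse_square_measure_def by (subst AE_density) (auto simp: indicator_def)

lemma sigma_finite_inverse_square: "sigma_finite_measure inverse_square_measure"
  unfolding inverse_square_measure_def
  by (subst sigma_finite_measure.sigma_finite_iff_density_finite[OF sigma_finite_lborel]) auto

lemma nn_integral_inverse_square_scale:
  assumes [measurable]: "F \<in> borel_measurable borel" and "c > 0"
  shows "(\<integral>\<^sup>+t. F (c * t) \<partial>inverse_square_measure) = ennreal c * (\<integral>\<^sup>+t. F t \<partial>inverse_square_measure)"
proof -
  have "(\<integral>\<^sup>+t. F t \<partial>inverse_square_measure) = (\<integral>\<^sup>+t. ennreal (indicator {0<..} t / t\<^sup>2) * F t \<partial>lborel)"
    by (rule nn_integral_inverse_square) measurable
  also have "\<dots> = ennreal c * (\<integral>\<^sup>+t. ennreal (indicator {0<..} (c * t) / (c * t)\<^sup>2) * F (c * t) \<partial>lborel)"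
    using nn_integral_real_affine[of "\<lambda>t. ennreal (indicator {0<..} t / t\<^sup>2) * F t" c 0] \<open>c > 0\<close> by simp
  finally have "ennreal c * (\<integral>\<^sup>+t. F t \<partial>inverse_square_measure) =
      ennreal c * (ennreal c * (\<integral>\<^sup>+t. ennreal (indicator {0<..} (c * t) / (c * t)\<^sup>2) * F (c * t) \<partial>lborel))"
    by simp
  also have "\<dots> = (\<integral>\<^sup>+t. ennreal c * (ennreal c * (ennreal (indicator {0<..} (c * t) / (c * t)\<^sup>2) * F (c * t))) \<partial>lborel)"
    by (subst nn_integral_cmult[symmetric], measurable, subst nn_integral_cmult[symmetric], measurable)
  also have "\<dots> = (\<integral>\<^sup>+t. ennreal (indicator {0<..} t / t\<^sup>2) * F (c * t) \<partial>lborel)"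
  proof (rule nn_integral_cong)
    fix t :: real
    have "c * (c * (indicator {0<..} (c * t) / (c * t)\<^sup>2)) = indicator {0<..} t / t\<^sup>2"
      using \<open>c > 0\<close> by (simp add: indicator_def zero_less_mult_iff power2_eq_square)
    then have "ennreal c * (ennreal c * ennreal (indicator {0<..} (c * t) / (c * t)\<^sup>2)) = ennreal (indicator {0<..} t / t\<^sup>2)"
      using \<open>c > 0\<close> by (simp add: ennreal_mult[symmetric])
    then show "ennreal c * (ennreal c * (ennreal (indicator {0<..} (c * t) / (c * t)\<^sup>2) * F (c * t))) =
        ennreal (indicator {0<..} t / t\<^sup>2) * F (c * t)"
      by (simp only: mult.assoc[symmetric])
  qed
  also have "\<dots> = (\<integral>\<^sup>+t. F (c * t) \<partial>inverse_square_measure)"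
    by (rule nn_integral_inverse_square[symmetric]) measurable
  finally show ?thesis ..
qed

text \<open>
  The mean of \<open>g(t X)\<close> produces the mean of \<open>X\<close> for any kernel \<open>g\<close>, because rescaling \<open>t\<close> pulls a factor \<open>X\<close> out of
  the integral. It is applied to the cosine and to the Bessel function, with the Gaussian distribution,
  the circle and the torus as probability spaces.
\<close>

lemma nn_integral_inverse_square_average:
  fixes g :: "real \<Rightarrow> real"
  assumes "prob_space M" and [measurable]: "g \<in> borel_measurable borel" "X \<in> borel_measurable M"
    and bound: "\<And>t. \<bar>g t\<bar> \<le> 1" and "g 0 = 1" and nonneg: "\<And>x. X x \<ge> 0"
  shows "(\<integral>\<^sup>+t. ennreal (1 - (LINT x|M. g (t * X x))) \<partial>inverse_square_measure) =
    (\<integral>\<^sup>+t. ennreal (1 - g t) \<partial>inverse_square_measure) * (\<integral>\<^sup>+x. ennreal (X x) \<partial>M)"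
proof -
  interpret M: prob_space M by fact
  interpret sigma_finite_measure inverse_square_measure
    by (rule sigma_finite_inverse_square)
  interpret pair_sigma_finite M inverse_square_measure ..
  have int: "integrable M (\<lambda>x. g (t * X x))" for t
    by (rule M.integrable_const_bound[where B = 1]) (use bound in auto)
  have "ennreal (1 - (LINT x|M. g (t * X x))) = (\<integral>\<^sup>+x. ennreal (1 - g (t * X x)) \<partial>M)" for t
  proof -
    have "(\<integral>\<^sup>+x. ennreal (1 - g (t * X x)) \<partial>M) = ennreal (LINT x|M. 1 - g (t * X x))"
      using bound by (intro nn_integral_eq_integral Bochner_Integration.integrable_diff int AE_I2)
        (auto simp: abs_le_iff)
    also have "(LINT x|M. 1 - g (t * X x)) = 1 - (LINT x|M. g (t * X x))"
      using int by (simp add: M.prob_space)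
    finally show ?thesis ..
  qed
  then have "(\<integral>\<^sup>+t. ennreal (1 - (LINT x|M. g (t * X x))) \<partial>inverse_square_measure) =
      (\<integral>\<^sup>+t. \<integral>\<^sup>+x. ennreal (1 - g (t * X x)) \<partial>M \<partial>inverse_square_measure)"
    by simp
  also have "\<dots> = (\<integral>\<^sup>+x. \<integral>\<^sup>+t. ennreal (1 - g (t * X x)) \<partial>inverse_square_measure \<partial>M)"
    by (rule Fubini') measurable
  also have "\<dots> = (\<integral>\<^sup>+x. (\<integral>\<^sup>+t. ennreal (1 - g t) \<partial>inverse_square_measure) * ennreal (X x) \<partial>M)"
  proof (rule nn_integral_cong)
    fix x
    show "(\<integral>\<^sup>+t. ennreal (1 - g (t * X x)) \<partial>inverse_square_measure) =
        (\<integral>\<^sup>+t. ennreal (1 - g t) \<partial>inverse_square_measure) * ennreal (X x)"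
    proof (cases "X x = 0")
      case True
      then show ?thesis
        using \<open>g 0 = 1\<close> by simp
    next
      case False
      then have "X x > 0"
        using nonneg[of x] by simp
      then show ?thesis
        using nn_integral_inverse_square_scale[of "\<lambda>t. ennreal (1 - g t)" "X x"] by (simp add: mult.commute)
    qed
  qed
  also have "\<dots> = (\<integral>\<^sup>+t. ennreal (1 - g t) \<partial>inverse_square_measure) * (\<integral>\<^sup>+x. ennreal (X x) \<partial>M)"
    by (rule nn_integral_cmult) measurable
  finally show ?thesis .
qed

lemma nn_integral_gauss_half_line:
  assumes "x > 0"
  shows "(\<integral>\<^sup>+t. ennreal (indicator {0<..} t * exp (- (x * t\<^sup>2))) \<partial>lborel) = ennreal (sqrt pi / 2 * x powr (- 1 / 2))"
proof -
  have "(\<integral>\<^sup>+t. ennreal (indicator {0<..} t * exp (- t\<^sup>2)) \<partial>lborel) = (\<integral>\<^sup>+t. ennreal (indicator {0..} t *\<^sub>R exp (- t\<^sup>2)) \<partial>lborel)"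
    by (intro nn_integral_cong_AE AE_I[where N = "{0}"]) (auto simp: indicator_def)
  also have "\<dots> = ennreal (sqrt pi / 2)"
    using gaussian_moment_0 by (subst nn_integral_eq_integral) (auto simp: has_bochner_integral_iff indicator_def)
  also have "(\<integral>\<^sup>+t. ennreal (indicator {0<..} t * exp (- t\<^sup>2)) \<partial>lborel) =
      ennreal (sqrt x) * (\<integral>\<^sup>+t. ennreal (indicator {0<..} (sqrt x * t) * exp (- (sqrt x * t)\<^sup>2)) \<partial>lborel)"
    using nn_integral_real_affine[of "\<lambda>t. ennreal (indicator {0<..} t * exp (- t\<^sup>2))" "sqrt x" 0] assms by simp
  also have "(\<integral>\<^sup>+t. ennreal (indicator {0<..} (sqrt x * t) * exp (- (sqrt x * t)\<^sup>2)) \<partial>lborel) =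
      (\<integral>\<^sup>+t. ennreal (indicator {0<..} t * exp (- (x * t\<^sup>2))) \<partial>lborel)"
    using assms by (intro nn_integral_cong) (simp add: indicator_def zero_less_mult_iff power_mult_distrib)
  finally have "ennreal (inverse (sqrt x)) * (ennreal (sqrt x) * (\<integral>\<^sup>+t. ennreal (indicator {0<..} t * exp (- (x * t\<^sup>2))) \<partial>lborel)) =
      ennreal (inverse (sqrt x)) * ennreal (sqrt pi / 2)"
    by simp
  then show ?thesis
    using assms by (simp add: mult.assoc[symmetric] ennreal_mult[symmetric] powr_minus powr_half_sqrt mult.commute)
qed

text \<open>
  Write \<open>(1 - exp (- a t\<^sup>2)) / t\<^sup>2\<close> as the integral of \<open>exp (- x t\<^sup>2)\<close> over \<open>0 \<le> x \<le> a\<close> and integrate over \<open>t\<close>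
  first.
\<close>

lemma nn_integral_gauss_inverse_square:
  assumes "a > 0"
  shows "(\<integral>\<^sup>+t. ennreal (1 - exp (- (a * t\<^sup>2))) \<partial>inverse_square_measure) = ennreal (sqrt (pi * a))"
proof -
  have inner: "ennreal (indicator {0<..} t / t\<^sup>2) * ennreal (1 - exp (- (a * t\<^sup>2))) =
      (\<integral>\<^sup>+x. ennreal (indicator {0<..} t * exp (- (x * t\<^sup>2))) * indicator {0..a} x \<partial>lborel)" for t :: real
  proof (cases "t > 0")
    case True
    have "(\<integral>\<^sup>+x. ennreal (exp (- (x * t\<^sup>2))) * indicator {0..a} x \<partial>lborel) =
        ennreal (- exp (- (a * t\<^sup>2)) / t\<^sup>2 - (- exp (- (0 * t\<^sup>2)) / t\<^sup>2))"
    proof (rule nn_integral_FTC_Icc)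
      show "((\<lambda>x. - exp (- (x * t\<^sup>2)) / t\<^sup>2) has_real_derivative exp (- (x * t\<^sup>2))) (at x)" for x
        using True by (auto intro!: derivative_eq_intros simp: field_simps power2_eq_square)
    qed (use assms in auto)
    then show ?thesis
      using True by (simp add: ennreal_mult'[symmetric] diff_divide_distrib[symmetric] add_divide_distrib[symmetric])
  qed simp
  have "(\<integral>\<^sup>+t. ennreal (1 - exp (- (a * t\<^sup>2))) \<partial>inverse_square_measure) =
      (\<integral>\<^sup>+t. ennreal (indicator {0<..} t / t\<^sup>2) * ennreal (1 - exp (- (a * t\<^sup>2))) \<partial>lborel)"
    by (rule nn_integral_inverse_square) measurable
  also have "\<dots> = (\<integral>\<^sup>+t. \<integral>\<^sup>+x. ennreal (indicator {0<..} t * exp (- (x * t\<^sup>2))) * indicator {0..a} x \<partial>lborel \<partial>lborel)"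
    by (simp only: inner)
  also have "\<dots> = (\<integral>\<^sup>+x. \<integral>\<^sup>+t. ennreal (indicator {0<..} t * exp (- (x * t\<^sup>2))) * indicator {0..a} x \<partial>lborel \<partial>lborel)"
    by (rule lborel_pair.Fubini') measurable
  also have "\<dots> = (\<integral>\<^sup>+x. ennreal (indicator {0..a} x * (sqrt pi / 2 * x powr (- 1 / 2))) \<partial>lborel)"
  proof (rule nn_integral_cong_AE, rule AE_I[where N = "{0}"])
    show "{x \<in> space lborel. (\<integral>\<^sup>+t. ennreal (indicator {0<..} t * exp (- (x * t\<^sup>2))) * indicator {0..a} x \<partial>lborel) \<noteq>
        ennreal (indicator {0..a} x * (sqrt pi / 2 * x powr (- 1 / 2)))} \<subseteq> {0}"
    proof safe
      fix x :: real
      assume ne: "(\<integral>\<^sup>+t. ennreal (indicator {0<..} t * exp (- (x * t\<^sup>2))) * indicator {0..a} x \<partial>lborel) \<noteq>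
        ennreal (indicator {0..a} x * (sqrt pi / 2 * x powr (- 1 / 2)))"
      show "x = 0"
      proof (rule ccontr)
        assume "x \<noteq> 0"
        with ne nn_integral_gauss_half_line[of x] show False
          by (cases "x \<in> {0..a}") auto
      qed
    qed
  qed auto
  also have "\<dots> = ennreal (sqrt pi / 2 * (a powr (- 1 / 2 + 1) / (- 1 / 2 + 1)))"
  proof (rule nn_integral_has_integral_lborel)
    have "((\<lambda>x. sqrt pi / 2 * x powr (- 1 / 2)) has_integral (sqrt pi / 2 * (a powr (- 1 / 2 + 1) / (- 1 / 2 + 1)))) {0..a}"
      using assms by (intro has_integral_mult_right has_integral_powr_from_0) auto
    then show "((\<lambda>x. indicator {0..a} x * (sqrt pi / 2 * x powr (- 1 / 2))) has_integral
        (sqrt pi / 2 * (a powr (- 1 / 2 + 1) / (- 1 / 2 + 1)))) UNIV"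
      by (subst (asm) has_integral_restrict_UNIV[symmetric])
        (erule has_integral_eq[rotated], simp add: indicator_def)
  qed (auto simp: indicator_def)
  also have "sqrt pi / 2 * (a powr (- 1 / 2 + 1) / (- 1 / 2 + 1)) = sqrt (pi * a)"
    using assms by (simp add: powr_half_sqrt real_sqrt_mult)
  finally show ?thesis .
qed

text \<open>
  Averaging \<open>cos (t x)\<close> over a standard normal \<open>x\<close> gives \<open>exp (- t\<^sup>2 / 2)\<close>, whose integral is known. The constant
  sought is that integral divided by the mean of \<open>\<bar>x\<bar>\<close>.
\<close>

lemma nn_integral_cos_inverse_square:
  "(\<integral>\<^sup>+t. ennreal (1 - cos t) \<partial>inverse_square_measure) = ennreal (pi / 2)"
proof -
  interpret N: real_distribution std_normal_distribution
    by (rule real_dist_normal_dist)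
  let ?K = "\<integral>\<^sup>+t. ennreal (1 - cos t) \<partial>inverse_square_measure"
  have meas: "abs \<in> borel_measurable std_normal_distribution"
    by measurable
  have "(LINT x|std_normal_distribution. cos (t * \<bar>x\<bar>)) = exp (- (1 / 2 * t\<^sup>2))" for t :: real
  proof -
    have "(LINT x|std_normal_distribution. cos (t * \<bar>x\<bar>)) = (LINT x|std_normal_distribution. Re (iexp (t * x)))"
      by (intro Bochner_Integration.integral_cong) (auto simp: abs_if cis_conv_exp[symmetric] simp flip: of_real_mult)
    also have "\<dots> = Re (char std_normal_distribution t)"
      unfolding char_def by (rule integral_Re) (rule N.integrable_iexp, simp_all)
    finally show ?thesis
      by (simp add: char_std_normal_distribution)
  qed
  then have "(\<integral>\<^sup>+t. ennreal (1 - exp (- (1 / 2 * t\<^sup>2))) \<partial>inverse_square_measure) =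
      ?K * (\<integral>\<^sup>+x. ennreal \<bar>x\<bar> \<partial>std_normal_distribution)"
    using nn_integral_inverse_square_average[OF N.prob_space_axioms _ meas, of cos] by simp
  also have "(\<integral>\<^sup>+x. ennreal \<bar>x\<bar> \<partial>std_normal_distribution) = ennreal (sqrt (2 / pi))"
    using std_normal_distribution_odd_moments_abs[of 0] integrable_std_normal_distribution_moment[of 1]
    by (subst nn_integral_eq_integral) auto
  finally have eq: "?K * ennreal (sqrt (2 / pi)) = ennreal (sqrt (pi * (1 / 2)))"
    by (simp only: nn_integral_gauss_inverse_square[of "1 / 2"] zero_less_divide_1_iff zero_less_numeral simp_thms)
  have "?K = ?K * ennreal (sqrt (2 / pi) * sqrt (pi / 2))"
    by (simp add: real_sqrt_mult[symmetric])
  also have "\<dots> = ennreal (sqrt (pi * (1 / 2))) * ennreal (sqrt (pi / 2))"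
    by (simp only: eq[symmetric] ennreal_mult real_sqrt_ge_zero divide_nonneg_nonneg pi_ge_zero zero_le_numeral mult.assoc)
  also have "\<dots> = ennreal (pi / 2)"
    by (simp add: ennreal_mult[symmetric])
  finally show ?thesis .
qed

section \<open>The Bessel function of order zero\<close>

definition bessel :: "real \<Rightarrow> real" where
  "bessel t = (LINT w|circle_measure. cos (t * Re w))"

lemma bessel_0: "bessel 0 = 1"
  by (simp add: bessel_def circle.prob_space)

lemma abs_bessel_le_1: "\<bar>bessel t\<bar> \<le> 1"
proof -
  have "\<bar>bessel t\<bar> \<le> (LINT w|circle_measure. \<bar>cos (t * Re w)\<bar>)"
    unfolding bessel_def by (rule integral_abs_bound)
  also have "\<dots> \<le> (LINT w|circle_measure. 1)"
    by (intro integral_mono integrable_circle continuous_intros) simp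
  finally show ?thesis
    by (simp add: circle.prob_space)
qed

text \<open>
  Up to its sign, the Bessel function of order one.
\<close>

definition bessel_deriv :: "real \<Rightarrow> real" where
  "bessel_deriv t = (LINT w|circle_measure. - (Re w * sin (t * Re w)))"

text \<open>
  Both derivatives of the Bessel function come from differentiating under the integral sign.
\<close>

lemma leibniz_circle:
  fixes h h' :: "real \<Rightarrow> complex \<Rightarrow> real"
  assumes h: "\<And>t. continuous_on UNIV (h t)" and h': "continuous_on UNIV (\<lambda>(t, w). h' t w)"
    and deriv: "\<And>t w. ((\<lambda>t. h t w) has_real_derivative h' t w) (at t)"
  shows "((\<lambda>t. LINT w|circle_measure. h t w) has_real_derivative (LINT w|circle_measure. h' t w)) (at t)"
proof -
  have cont: "continuous_on A (\<lambda>\<theta>. g (cis \<theta>))" if "continuous_on UNIV g" for A and g :: "complex \<Rightarrow> real"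
    by (rule continuous_on_compose2[OF that]) (auto intro!: continuous_intros)
  have h't: "continuous_on UNIV (h' t)" for t
  proof -
    have "continuous_on UNIV (\<lambda>w. (\<lambda>(t, w). h' t w) (t, w))"
      by (rule continuous_on_compose2[OF h']) (auto intro!: continuous_intros)
    then show ?thesis
      by simp
  qed
  have "((\<lambda>t. integral (cbox 0 (2 * pi)) (\<lambda>\<theta>. h t (cis \<theta>))) has_real_derivative
      integral (cbox 0 (2 * pi)) (\<lambda>\<theta>. h' t (cis \<theta>))) (at t within UNIV)"
  proof (rule leibniz_rule_field_derivative)
    show "((\<lambda>t. h t (cis \<theta>)) has_real_derivative h' t (cis \<theta>)) (at t within UNIV)" for t \<theta>
      using deriv by simp
    show "(\<lambda>\<theta>. h t (cis \<theta>)) integrable_on cbox 0 (2 * pi)" for t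
      by (intro integrable_continuous cont h)
    show "continuous_on (UNIV \<times> cbox 0 (2 * pi)) (\<lambda>(t, \<theta>). h' t (cis \<theta>))"
    proof -
      have "continuous_on (UNIV \<times> cbox 0 (2 * pi)) (\<lambda>x. (\<lambda>(t, w). h' t w) (fst x, cis (snd x)))"
        by (rule continuous_on_compose2[OF h']) (auto intro!: continuous_intros)
      then show ?thesis
        by (simp add: case_prod_beta)
    qed
  qed auto
  from DERIV_cmult[OF this, of "1 / (2 * pi)"] show ?thesis
    by (simp add: integral_circle h h't)
qed

lemma bessel_has_derivative: "(bessel has_real_derivative bessel_deriv t) (at t)"
  unfolding bessel_def[abs_def] bessel_deriv_def
  by (rule leibniz_circle) (auto intro!: continuous_intros derivative_eq_intros simp: case_prod_beta)

lemma continuous_on_bessel [continuous_intros]: "continuous_on A f \<Longrightarrow> continuous_on A (\<lambda>x. bessel (f x))"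
  using DERIV_continuous_on[of UNIV bessel bessel_deriv] bessel_has_derivative
  by (metis UNIV_I continuous_on_compose2 subset_UNIV)

lemma borel_measurable_bessel [measurable]: "bessel \<in> borel_measurable borel"
  by (intro borel_measurable_continuous_onI continuous_intros)

lemma bessel_deriv_has_derivative:
  "(bessel_deriv has_real_derivative (LINT w|circle_measure. - ((Re w)\<^sup>2 * cos (t * Re w)))) (at t)"
  unfolding bessel_deriv_def[abs_def]
  by (rule leibniz_circle) (auto intro!: continuous_intros derivative_eq_intros simp: case_prod_beta power2_eq_square)

text \<open>
  This is Bessel's differential equation \<open>t J'' + J' + t J = 0\<close>: the integrand of the sum is the
  derivative of \<open>sin \<theta> * sin (t * cos \<theta>)\<close>.
\<close>

lemma bessel_equation:
  "t * (LINT w|circle_measure. - ((Re w)\<^sup>2 * cos (t * Re w))) + bessel_deriv t + t * bessel t = 0"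
proof -
  let ?h = "\<lambda>w. t * (Im w)\<^sup>2 * cos (t * Re w) - Re w * sin (t * Re w)"
  have "(LINT w|circle_measure. ?h w) = (1 / (2 * pi)) *\<^sub>R (- sin (2 * pi) * sin (t * cos (2 * pi)) - (- sin 0 * sin (t * cos 0)))"
    unfolding has_real_derivative_iff_has_vector_derivative[symmetric]
    by (rule integral_circle_FTC)
      (auto intro!: continuous_intros derivative_eq_intros
        simp: has_real_derivative_iff_has_vector_derivative[symmetric] power2_eq_square)
  then have "(LINT w|circle_measure. ?h w) = 0"
    by simp
  moreover have "(LINT w|circle_measure. ?h w) = (LINT w|circle_measure.
      t * - ((Re w)\<^sup>2 * cos (t * Re w)) + - (Re w * sin (t * Re w)) + t * cos (t * Re w))"
  proof (intro Bochner_Integration.integral_cong refl)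
    fix w assume "w \<in> space circle_measure"
    then have "(Re w)\<^sup>2 + (Im w)\<^sup>2 = 1"
      by (simp add: space_circle_measure cmod_def)
    then have "(Im w)\<^sup>2 = 1 - (Re w)\<^sup>2"
      by linarith
    then show "?h w = t * - ((Re w)\<^sup>2 * cos (t * Re w)) + - (Re w * sin (t * Re w)) + t * cos (t * Re w)"
      by (simp only:) (simp add: algebra_simps)
  qed
  moreover have int: "integrable circle_measure (\<lambda>w. t * - ((Re w)\<^sup>2 * cos (t * Re w)))"
    "integrable circle_measure (\<lambda>w. - (Re w * sin (t * Re w)))"
    "integrable circle_measure (\<lambda>w. t * cos (t * Re w))"
    by (intro integrable_circle continuous_intros)+
  then have "(LINT w|circle_measure.
      t * - ((Re w)\<^sup>2 * cos (t * Re w)) + - (Re w * sin (t * Re w)) + t * cos (t * Re w)) =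
      (LINT w|circle_measure. t * - ((Re w)\<^sup>2 * cos (t * Re w))) +
      (LINT w|circle_measure. - (Re w * sin (t * Re w))) + (LINT w|circle_measure. t * cos (t * Re w))"
    by (simp only: Bochner_Integration.integral_add Bochner_Integration.integrable_add int)
  ultimately show ?thesis
    by (simp add: bessel_def bessel_deriv_def)
qed

lemma integral_circle_Re_mult:
  fixes h :: "real \<Rightarrow> 'a::euclidean_space"
  assumes "continuous_on UNIV h"
  shows "(LINT w|circle_measure. h (Re (c * w))) = (LINT w|circle_measure. h (cmod c * Re w))"
proof -
  obtain u where u: "cmod u = 1" "c = complex_of_real (cmod c) * u"
  proof (cases "c = 0")
    case False
    then show ?thesis
      by (intro that[of "c / complex_of_real (cmod c)"]) (auto simp: norm_divide)
  qed (auto intro: that[of 1])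
  have "(LINT w|circle_measure. h (Re (c * w))) = (LINT w|circle_measure. h (cmod c * Re (u * w)))"
    by (subst u(2)) (simp add: mult.assoc)
  also have "\<dots> = (LINT w|circle_measure. h (cmod c * Re w))"
  proof (rule integral_circle_rotate[OF _ u(1)])
    show "continuous_on UNIV (\<lambda>w. h (cmod c * Re w))"
      by (rule continuous_on_compose2[OF assms]) (auto intro!: continuous_intros)
  qed
  finally show ?thesis .
qed

lemma integral_circle_cis:
  "(LINT w|circle_measure. cis (Re (c * w))) = complex_of_real (bessel (cmod c))"
proof -
  let ?r = "cmod c"
  have "(LINT w|circle_measure. cis (Re (c * w))) = (LINT w|circle_measure. cis (?r * Re w))"
    by (rule integral_circle_Re_mult) (intro continuous_intros)
  also have "\<dots> = complex_of_real (bessel ?r)"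
  proof (rule complex_eqI)
    have int: "integrable circle_measure (\<lambda>w. cis (?r * Re w))"
      by (intro integrable_circle continuous_intros)
    show "Re (LINT w|circle_measure. cis (?r * Re w)) = Re (complex_of_real (bessel ?r))"
      using integral_Re[OF int] by (simp add: bessel_def)
    have "(LINT w|circle_measure. sin (?r * Re (- 1 * w))) = (LINT w|circle_measure. sin (?r * Re w))"
      by (rule integral_circle_rotate) (auto intro!: continuous_intros)
    then have "(LINT w|circle_measure. sin (?r * Re w)) = 0"
      by simp
    then show "Im (LINT w|circle_measure. cis (?r * Re w)) = Im (complex_of_real (bessel ?r))"
      using integral_Im[OF int] by simp
  qed
  finally show ?thesis .
qed

text \<open>
  \<open>J(\<bar>c\<bar>)\<close> is the average of the characters \<open>cis (Re (c * v))\<close> over \<open>v\<close>. Each character turns the sum \<open>c + b w\<close> into a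
  product, and the average over \<open>w\<close> of its second factor depends on \<open>\<bar>b\<bar>\<close> only.
\<close>

lemma bessel_mean_value:
  "(LINT w|circle_measure. bessel (cmod (c + b * w))) = bessel (cmod c) * bessel (cmod b)"
proof -
  interpret pair_prob_space circle_measure circle_measure ..
  have meas: "(\<lambda>(w, v). cis (Re ((c + b * w) * v))) \<in> borel_measurable (circle_measure \<Otimes>\<^sub>M circle_measure)"
  proof -
    have "(\<lambda>w. w) \<in> circle_measure \<rightarrow>\<^sub>M borel"
      by (rule borel_measurable_circle) simp
    then have "(\<lambda>x. (fst x, snd x)) \<in> circle_measure \<Otimes>\<^sub>M circle_measure \<rightarrow>\<^sub>M borel \<Otimes>\<^sub>M borel"
      by (intro measurable_Pair measurable_compose[OF measurable_fst] measurable_compose[OF measurable_snd])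
    moreover have "(\<lambda>(w, v). cis (Re ((c + b * w) * v))) \<in> borel_measurable (borel \<Otimes>\<^sub>M borel)"
      unfolding borel_prod case_prod_beta
      by (intro borel_measurable_continuous_onI continuous_intros)
    ultimately have "(\<lambda>x. (\<lambda>(w, v). cis (Re ((c + b * w) * v))) (fst x, snd x)) \<in>
        borel_measurable (circle_measure \<Otimes>\<^sub>M circle_measure)"
      by (rule measurable_compose)
    then show ?thesis
      by (simp only: prod.collapse)
  qed
  have int: "integrable (circle_measure \<Otimes>\<^sub>M circle_measure) (\<lambda>(w, v). cis (Re ((c + b * w) * v)))"
    by (rule integrable_const_bound[where B = 1, OF _ meas]) auto
  have "complex_of_real (LINT w|circle_measure. bessel (cmod (c + b * w))) =
      (LINT w|circle_measure. LINT v|circle_measure. cis (Re ((c + b * w) * v)))"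
    by (simp only: integral_circle_cis integral_complex_of_real)
  also have "\<dots> = (LINT v|circle_measure. LINT w|circle_measure. cis (Re ((c + b * w) * v)))"
    by (rule Fubini_integral[symmetric, OF int])
  also have "\<dots> = (LINT v|circle_measure. cis (Re (c * v)) * complex_of_real (bessel (cmod b)))"
  proof (intro Bochner_Integration.integral_cong refl)
    fix v assume "v \<in> space circle_measure"
    then have v: "cmod v = 1"
      by (simp add: space_circle_measure)
    have "(c + b * w) * v = c * v + (b * v) * w" for w
      by (simp add: algebra_simps)
    then have "(LINT w|circle_measure. cis (Re ((c + b * w) * v))) =
        (LINT w|circle_measure. cis (Re (c * v)) * cis (Re ((b * v) * w)))"
      by (simp only: cis_mult plus_complex.sel)
    also have "\<dots> = cis (Re (c * v)) * (LINT w|circle_measure. cis (Re ((b * v) * w)))"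
      by (rule integral_mult_right_zero)
    also have "\<dots> = cis (Re (c * v)) * complex_of_real (bessel (cmod b))"
      by (simp only: integral_circle_cis norm_mult v mult_1_right)
    finally show "(LINT w|circle_measure. cis (Re ((c + b * w) * v))) = cis (Re (c * v)) * complex_of_real (bessel (cmod b))" .
  qed
  also have "\<dots> = (LINT v|circle_measure. cis (Re (c * v))) * complex_of_real (bessel (cmod b))"
    by (rule integral_mult_left_zero)
  also have "\<dots> = complex_of_real (bessel (cmod c) * bessel (cmod b))"
    by (simp only: integral_circle_cis of_real_mult)
  finally show ?thesis
    by (simp only: of_real_eq_iff)
qed

lemma bessel_steinhaus_sum:
  assumes "finite I"
  shows "(LINT z|PiM I (\<lambda>_::nat. circle_measure). bessel (t * cmod (\<Sum>i\<in>I. b i * z i))) = (\<Prod>i\<in>I. bessel (t * cmod (b i)))"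
proof -
  have abs_bessel: "bessel \<bar>x\<bar> = bessel x" for x
    by (simp add: bessel_def abs_if)
  have scale: "bessel (t * cmod s) = bessel (cmod (complex_of_real t * s))" for s
    using abs_bessel[of "t * cmod s"] by (simp add: norm_mult abs_mult)
  show ?thesis
    using assms
  proof induction
    case empty
    interpret prob_space "PiM {} (\<lambda>_::nat. circle_measure)"
      by (intro prob_space_PiM prob_space_circle_measure)
    show ?case
      by (simp add: bessel_0 prob_space)
  next
    case (insert j I)
    have step: "(LINT w|circle_measure. bessel (t * cmod (s + b j * w))) = bessel (t * cmod s) * bessel (t * cmod (b j))" for s
      using bessel_mean_value[of "complex_of_real t * s" "complex_of_real t * b j"]
      by (simp add: scale distrib_left mult.assoc)
    have "(LINT z|PiM (insert j I) (\<lambda>_. circle_measure). bessel (t * cmod (\<Sum>i\<in>insert j I. b i * z i))) =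
        (LINT z|PiM I (\<lambda>_. circle_measure). LINT w|circle_measure. bessel (t * cmod ((\<Sum>i\<in>I. b i * z i) + b j * w)))"
      by (intro integral_steinhaus_sum_insert continuous_intros insert.hyps)
    also have "\<dots> = (LINT z|PiM I (\<lambda>_. circle_measure). bessel (t * cmod (\<Sum>i\<in>I. b i * z i))) * bessel (t * cmod (b j))"
      unfolding step by simp
    finally show ?case
      using insert by (simp add: mult.commute)
  qed
qed

lemma nn_integral_circle:
  fixes h :: "complex \<Rightarrow> real"
  assumes "continuous_on UNIV h" "\<And>w. 0 \<le> h w"
  shows "(\<integral>\<^sup>+w. ennreal (h w) \<partial>circle_measure) = ennreal (LINT w|circle_measure. h w)"
  by (intro nn_integral_eq_integral integrable_circle assms AE_I2)

lemma mean_abs_Re: "(LINT w|circle_measure. \<bar>Re w\<bar>) = 2 / pi"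
proof -
  have "(LINT w|circle_measure. \<bar>Re w\<bar>) = (LINT w|circle_measure. \<bar>Re (\<i> * w)\<bar>)"
    by (rule integral_circle_rotate[symmetric]) (auto intro!: continuous_intros)
  also have "\<dots> = (1 / (2 * pi)) *\<^sub>R integral {0..2 * pi} (\<lambda>\<theta>. \<bar>sin \<theta>\<bar>)"
    by (subst integral_circle) (auto intro!: continuous_intros)
  also have "((\<lambda>\<theta>. \<bar>sin \<theta>\<bar>) has_integral ((- cos pi - - cos 0) + (cos (2 * pi) - cos pi))) {0..2 * pi}"
  proof (rule has_integral_combine[of 0 pi])
    have "(sin has_integral (- cos pi - - cos 0)) {0..pi}"
      by (rule fundamental_theorem_of_calculus)
        (auto simp: has_real_derivative_iff_has_vector_derivative[symmetric] intro!: derivative_eq_intros)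
    then show "((\<lambda>\<theta>. \<bar>sin \<theta>\<bar>) has_integral (- cos pi - - cos 0)) {0..pi}"
      by (rule has_integral_eq[rotated]) (auto simp: sin_ge_zero)
    have "((\<lambda>\<theta>. - sin \<theta>) has_integral (cos (2 * pi) - cos pi)) {pi..2 * pi}"
      by (rule fundamental_theorem_of_calculus)
        (auto simp: has_real_derivative_iff_has_vector_derivative[symmetric] intro!: derivative_eq_intros)
    then show "((\<lambda>\<theta>. \<bar>sin \<theta>\<bar>) has_integral (cos (2 * pi) - cos pi)) {pi..2 * pi}"
      by (rule has_integral_eq[rotated]) (use sin_le_zero in \<open>force simp: le_less\<close>)
  qed auto
  then have "integral {0..2 * pi} (\<lambda>\<theta>. \<bar>sin \<theta>\<bar>) = 4"
    by (simp add: integral_unique)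
  finally show ?thesis
    by simp
qed

text \<open>
  A rotation replaces \<open>1 + w\<close> by \<open>1 - w\<close>, whose modulus \<open>2 * sin (\<theta> / 2)\<close> has no absolute value on
  \<open>[0, 2 pi]\<close>.
\<close>

lemma mean_abs_one_plus: "(LINT w|circle_measure. cmod (1 + w)) = 4 / pi"
proof -
  have half: "cmod (1 - cis \<theta>) = 2 * sin (\<theta> / 2)" if "\<theta> \<in> {0..2 * pi}" for \<theta>
  proof -
    have "(cmod (1 - cis \<theta>))\<^sup>2 = (1 - cos \<theta>)\<^sup>2 + (sin \<theta>)\<^sup>2"
      by (simp add: cmod_power2)
    also have "\<dots> = 2 - 2 * cos (2 * (\<theta> / 2))"
      using sin_cos_squared_add[of \<theta>] by (simp add: power2_eq_square algebra_simps)
    also have "\<dots> = (2 * sin (\<theta> / 2))\<^sup>2"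
      by (subst cos_double_sin) (simp add: power2_eq_square)
    finally have "(cmod (1 - cis \<theta>))\<^sup>2 = (2 * sin (\<theta> / 2))\<^sup>2" .
    moreover have "0 \<le> 2 * sin (\<theta> / 2)"
      using that sin_ge_zero[of "\<theta> / 2"] by simp
    ultimately show ?thesis
      by (rule power2_eq_imp_eq[OF _ norm_ge_zero])
  qed
  have "(LINT w|circle_measure. cmod (1 + w)) = (LINT w|circle_measure. cmod (1 + (- 1) * w))"
    by (rule integral_circle_rotate[symmetric]) (auto intro!: continuous_intros)
  also have "\<dots> = (1 / (2 * pi)) *\<^sub>R integral {0..2 * pi} (\<lambda>\<theta>. cmod (1 - cis \<theta>))"
    by (subst integral_circle) (auto intro!: continuous_intros)
  also have "integral {0..2 * pi} (\<lambda>\<theta>. cmod (1 - cis \<theta>)) = integral {0..2 * pi} (\<lambda>\<theta>. 2 * sin (\<theta> / 2))"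
    by (intro Henstock_Kurzweil_Integration.integral_cong half)
  also have "\<dots> = - 4 * cos (2 * pi / 2) - (- 4 * cos (0 / 2))"
    by (intro integral_unique fundamental_theorem_of_calculus)
      (auto simp: has_real_derivative_iff_has_vector_derivative[symmetric] intro!: derivative_eq_intros)
  finally show ?thesis
    by simp
qed

text \<open>
  The Bessel function is an average of cosines, so the constant is \<open>pi / 2\<close> times the mean of \<open>\<bar>Re w\<bar>\<close>.
\<close>

lemma nn_integral_bessel: "(\<integral>\<^sup>+t. ennreal (1 - bessel t) \<partial>inverse_square_measure) = 1"
proof -
  have abs_cos: "cos (t * \<bar>x\<bar>) = cos (t * x)" for t x :: real
    by (simp add: abs_if)
  have "(\<lambda>w. \<bar>Re w\<bar>) \<in> borel_measurable circle_measure"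
    by (intro borel_measurable_circle) measurable
  then have "(\<integral>\<^sup>+t. ennreal (1 - (LINT w|circle_measure. cos (t * \<bar>Re w\<bar>))) \<partial>inverse_square_measure) =
      ennreal (pi / 2) * (\<integral>\<^sup>+w. ennreal \<bar>Re w\<bar> \<partial>circle_measure)"
    using nn_integral_inverse_square_average[OF prob_space_circle_measure, of cos "\<lambda>w. \<bar>Re w\<bar>"]
    by (simp add: nn_integral_cos_inverse_square)
  also have "(\<integral>\<^sup>+w. ennreal \<bar>Re w\<bar> \<partial>circle_measure) = ennreal (2 / pi)"
    by (subst nn_integral_circle) (auto simp: mean_abs_Re intro!: continuous_intros)
  also have "ennreal (pi / 2) * ennreal (2 / pi) = 1"
    by (simp add: ennreal_mult[symmetric])
  finally show ?thesis
    by (simp only: abs_cos bessel_def)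
qed

lemma nn_integral_bessel_average:
  assumes "prob_space M" "X \<in> borel_measurable M" "\<And>x. X x \<ge> 0"
  shows "(\<integral>\<^sup>+t. ennreal (1 - (LINT x|M. bessel (t * X x))) \<partial>inverse_square_measure) = (\<integral>\<^sup>+x. ennreal (X x) \<partial>M)"
  using nn_integral_inverse_square_average[OF assms(1) borel_measurable_bessel assms(2) abs_bessel_le_1 bessel_0 assms(3)]
  by (simp add: nn_integral_bessel)

text \<open>
  By the mean value property the square is the average of \<open>J(t \<bar>1 + w\<bar>)\<close>, so the integral is the mean of
  \<open>\<bar>1 + w\<bar>\<close>.
\<close>

lemma nn_integral_bessel_squared: "(\<integral>\<^sup>+t. ennreal (1 - (bessel t)\<^sup>2) \<partial>inverse_square_measure) = ennreal (4 / pi)"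
proof -
  have square: "(LINT w|circle_measure. bessel (t * cmod (1 + w))) = (bessel t)\<^sup>2" if "t > 0" for t
  proof -
    have "t * cmod (1 + w) = cmod (complex_of_real t + complex_of_real t * w)" for w
      using \<open>t > 0\<close> norm_mult[of "complex_of_real t" "1 + w"] by (simp add: distrib_left)
    then show ?thesis
      using bessel_mean_value[of "complex_of_real t" "complex_of_real t"] \<open>t > 0\<close>
      by (simp add: power2_eq_square)
  qed
  have "(\<integral>\<^sup>+t. ennreal (1 - (bessel t)\<^sup>2) \<partial>inverse_square_measure) =
      (\<integral>\<^sup>+t. ennreal (1 - (LINT w|circle_measure. bessel (t * cmod (1 + w)))) \<partial>inverse_square_measure)"
    by (rule nn_integral_cong_AE, rule eventually_mono[OF AE_inverse_square]) (simp only: square)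
  also have "\<dots> = (\<integral>\<^sup>+w. ennreal (cmod (1 + w)) \<partial>circle_measure)"
    by (intro nn_integral_bessel_average prob_space_circle_measure borel_measurable_circle) measurable
  also have "\<dots> = ennreal (4 / pi)"
    by (subst nn_integral_circle) (auto simp: mean_abs_one_plus intro!: continuous_intros)
  finally show ?thesis .
qed

section \<open>Comparing the Bessel function with a Gaussian\<close>

text \<open>
  Integrate the derivative of \<open>cos \<theta> ^ (n + 1) * sin \<theta>\<close> over a period.
\<close>

lemma mean_Re_power_Suc_Suc:
  "(LINT w|circle_measure. (Re w) ^ (n + 2)) = (real n + 1) / (real n + 2) * (LINT w|circle_measure. (Re w) ^ n)"
proof -
  have int: "integrable circle_measure (\<lambda>w. (Re w) ^ k)" for k
    by (intro integrable_circle continuous_intros)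
  have "((\<lambda>\<theta>. cos \<theta> ^ (n + 1) * sin \<theta>) has_vector_derivative
      (real n + 2) * Re (cis \<theta>) ^ (n + 2) - (real n + 1) * Re (cis \<theta>) ^ n) (at \<theta>)" for \<theta>
  proof -
    have "((\<lambda>\<theta>. cos \<theta> ^ (n + 1)) has_real_derivative (real n + 1) * cos \<theta> ^ n * (- sin \<theta>)) (at \<theta>)"
      using DERIV_power[OF DERIV_cos, of "n + 1" \<theta>] by (simp add: mult_ac add.commute)
    from DERIV_mult[OF this DERIV_sin]
    have "((\<lambda>\<theta>. cos \<theta> ^ (n + 1) * sin \<theta>) has_real_derivative
        cos \<theta> ^ (n + 2) - (real n + 1) * cos \<theta> ^ n * (sin \<theta>)\<^sup>2) (at \<theta>)"
      by (simp add: power2_eq_square mult_ac)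
    moreover have "cos \<theta> ^ (n + 2) - (real n + 1) * cos \<theta> ^ n * (sin \<theta>)\<^sup>2 =
        (real n + 2) * cos \<theta> ^ (n + 2) - (real n + 1) * cos \<theta> ^ n"
      unfolding sin_squared_eq power_add by (simp add: algebra_simps)
    ultimately show ?thesis
      by (simp only: has_real_derivative_iff_has_vector_derivative cis.sel)
  qed
  then have "(LINT w|circle_measure. (real n + 2) * (Re w) ^ (n + 2) - (real n + 1) * (Re w) ^ n) =
      (1 / (2 * pi)) *\<^sub>R (cos (2 * pi) ^ (n + 1) * sin (2 * pi) - cos 0 ^ (n + 1) * sin 0)"
    by (intro integral_circle_FTC continuous_intros)
  moreover have "(LINT w|circle_measure. (real n + 2) * (Re w) ^ (n + 2) - (real n + 1) * (Re w) ^ n) =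
      (real n + 2) * (LINT w|circle_measure. (Re w) ^ (n + 2)) - (real n + 1) * (LINT w|circle_measure. (Re w) ^ n)"
    by (simp only: Bochner_Integration.integral_diff integrable_mult_right int integral_mult_right_zero)
  ultimately have "(real n + 2) * (LINT w|circle_measure. (Re w) ^ (n + 2)) = (real n + 1) * (LINT w|circle_measure. (Re w) ^ n)"
    by (simp only: sin_two_pi sin_zero) simp
  then show ?thesis
    by (simp only: field_simps) (simp add: field_simps)
qed

lemma mean_Re_powers:
  "(LINT w|circle_measure. (Re w) ^ 2) = 1 / 2"
  "(LINT w|circle_measure. (Re w) ^ 4) = 3 / 8"
  "(LINT w|circle_measure. (Re w) ^ 6) = 5 / 16"
  "(LINT w|circle_measure. (Re w) ^ 8) = 35 / 128"
  "(LINT w|circle_measure. (Re w) ^ 10) = 63 / 256"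
proof -
  show 2: "(LINT w|circle_measure. (Re w) ^ 2) = 1 / 2"
    using mean_Re_power_Suc_Suc[of 0] by (simp add: circle.prob_space numeral_2_eq_2)
  show 4: "(LINT w|circle_measure. (Re w) ^ 4) = 3 / 8"
    using mean_Re_power_Suc_Suc[of 2] 2 by simp
  show 6: "(LINT w|circle_measure. (Re w) ^ 6) = 5 / 16"
    using mean_Re_power_Suc_Suc[of 4] 4 by simp
  show 8: "(LINT w|circle_measure. (Re w) ^ 8) = 35 / 128"
    using mean_Re_power_Suc_Suc[of 6] 6 by simp
  show "(LINT w|circle_measure. (Re w) ^ 10) = 63 / 256"
    using mean_Re_power_Suc_Suc[of 8] 8 by simp
qed

lemma mean_Re_polynomial:
  "(LINT w|circle_measure. c0 + c2 * (Re w) ^ 2 + c4 * (Re w) ^ 4 + c6 * (Re w) ^ 6 + c8 * (Re w) ^ 8 + c10 * (Re w) ^ 10) =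
    c0 + c2 * (1 / 2) + c4 * (3 / 8) + c6 * (5 / 16) + c8 * (35 / 128) + c10 * (63 / 256)"
proof -
  have int: "integrable circle_measure (\<lambda>w. c * (Re w) ^ k)" "integrable circle_measure (\<lambda>w. c)" for c :: real and k
    by (intro integrable_circle continuous_intros)+
  show ?thesis
    by (simp only: Bochner_Integration.integral_add Bochner_Integration.integrable_add int integral_mult_right_zero
        mean_Re_powers) (simp add: circle.prob_space)
qed

lemma cos_Taylor_bounds:
  fixes x :: real
  shows "cos x \<le> 1 - x ^ 2 / 2 + x ^ 4 / 24"
    and "cos x \<ge> 1 - x ^ 2 / 2 + x ^ 4 / 24 - x ^ 6 / 720 + x ^ 8 / 40320 - x ^ 10 / 3628800"
proof -
  obtain t where t: "cos x = (\<Sum>m<4. cos_coeff m * x ^ m) + (cos (t + 1 / 2 * real 4 * pi) / fact 4) * x ^ 4"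
    using Maclaurin_cos_expansion[of x 4] by blast
  have "cos (t + 1 / 2 * real 4 * pi) * x ^ 4 \<le> 1 * x ^ 4"
    by (intro mult_right_mono cos_le_one) simp
  moreover have "(\<Sum>m<4. cos_coeff m * x ^ m) = 1 - x ^ 2 / 2"
  proof -
    have "{..<4::nat} = {0, 1, 2, 3}"
      by auto
    then show ?thesis
      by (simp add: cos_coeff_def fact_numeral)
  qed
  ultimately show "cos x \<le> 1 - x ^ 2 / 2 + x ^ 4 / 24"
    unfolding t by (simp add: fact_numeral)
  obtain s where s: "cos x = (\<Sum>m<10. cos_coeff m * x ^ m) + (cos (s + 1 / 2 * real 10 * pi) / fact 10) * x ^ 10"
    using Maclaurin_cos_expansion[of x 10] by auto
  have "- 1 * x ^ 10 \<le> cos (s + 1 / 2 * real 10 * pi) * x ^ 10"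
    by (intro mult_right_mono cos_ge_minus_one) simp
  moreover have "(\<Sum>m<10. cos_coeff m * x ^ m) = 1 - x ^ 2 / 2 + x ^ 4 / 24 - x ^ 6 / 720 + x ^ 8 / 40320"
  proof -
    have "{..<10::nat} = {0, 1, 2, 3, 4, 5, 6, 7, 8, 9}"
      by auto
    then show ?thesis
      by (simp add: cos_coeff_def fact_numeral)
  qed
  ultimately show "cos x \<ge> 1 - x ^ 2 / 2 + x ^ 4 / 24 - x ^ 6 / 720 + x ^ 8 / 40320 - x ^ 10 / 3628800"
    unfolding s by (simp add: fact_numeral)
qed

lemma sin_Taylor_bound:
  fixes x :: real
  shows "x * sin x \<le> x ^ 2 - x ^ 4 / 6 + x ^ 6 / 120 - x ^ 8 / 5040 + x ^ 10 / 362880"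
proof -
  let ?T = "\<Sum>m<9. sin_coeff m * x ^ m"
  have "x * sin x - x * ?T \<le> \<bar>x\<bar> * \<bar>sin x - ?T\<bar>"
    unfolding abs_mult[symmetric] right_diff_distrib[symmetric] by (rule abs_ge_self)
  also have "\<dots> \<le> \<bar>x\<bar> * (inverse (fact 9) * \<bar>x\<bar> ^ 9)"
    by (intro mult_left_mono Maclaurin_sin_bound) simp
  also have "\<dots> = \<bar>x\<bar> ^ 10 / 362880"
    by (simp add: fact_numeral power_numeral_reduce)
  also have "\<bar>x\<bar> ^ 10 = x ^ 10"
    by (simp add: power_even_abs)
  also have "x * ?T = x ^ 2 - x ^ 4 / 6 + x ^ 6 / 120 - x ^ 8 / 5040"
  proof -
    have "{..<9::nat} = {0, 1, 2, 3, 4, 5, 6, 7, 8}"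
      by auto
    then have "?T = x - x ^ 3 / 6 + x ^ 5 / 120 - x ^ 7 / 5040"
      by (simp add: sin_coeff_def fact_numeral)
    then show ?thesis
      by (simp only:) (simp add: power_numeral_reduce algebra_simps)
  qed
  finally show ?thesis
    by simp
qed

lemma bessel_le_quartic: "bessel t \<le> 1 - t\<^sup>2 / 4 + t ^ 4 / 64"
proof -
  have "bessel t \<le> (LINT w|circle_measure. 1 + - (t ^ 2 / 2) * (Re w) ^ 2 + t ^ 4 / 24 * (Re w) ^ 4 +
      0 * (Re w) ^ 6 + 0 * (Re w) ^ 8 + 0 * (Re w) ^ 10)"
    unfolding bessel_def
  proof (intro integral_mono integrable_circle continuous_intros)
    fix w
    show "cos (t * Re w) \<le> 1 + - (t ^ 2 / 2) * (Re w) ^ 2 + t ^ 4 / 24 * (Re w) ^ 4 +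
      0 * (Re w) ^ 6 + 0 * (Re w) ^ 8 + 0 * (Re w) ^ 10"
      using cos_Taylor_bounds(1)[of "t * Re w"] by (simp add: power_mult_distrib)
  qed
  also have "\<dots> = 1 - t\<^sup>2 / 4 + t ^ 4 / 64"
    unfolding mean_Re_polynomial by simp
  finally show ?thesis .
qed

text \<open>
  For \<open>0 \<le> t \<le> pi\<close> the integrand \<open>- x * sin (t x)\<close> with \<open>\<bar>x\<bar> \<le> 1\<close> is nowhere positive.
\<close>

lemma bessel_deriv_nonpos:
  assumes "0 \<le> t" "t \<le> pi"
  shows "bessel_deriv t \<le> 0"
proof -
  have "bessel_deriv t \<le> (LINT w|circle_measure. 0)"
    unfolding bessel_deriv_def
  proof (intro integral_mono integrable_circle continuous_intros)
    fix w assume "w \<in> space circle_measure"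
    then have "\<bar>Re w\<bar> \<le> 1"
      using abs_Re_le_cmod[of w] by (simp add: space_circle_measure)
    then have "t * \<bar>Re w\<bar> \<le> pi"
      using assms mult_left_le[of "\<bar>Re w\<bar>" t] by linarith
    then have "0 \<le> \<bar>Re w\<bar> * sin (t * \<bar>Re w\<bar>)"
      using assms by (intro mult_nonneg_nonneg sin_ge_zero) auto
    also have "\<bar>Re w\<bar> * sin (t * \<bar>Re w\<bar>) = Re w * sin (t * Re w)"
      by (simp add: abs_if)
    finally show "- (Re w * sin (t * Re w)) \<le> 0"
      by simp
  qed
  then show ?thesis
    by simp
qed

lemma bessel_antimono:
  assumes "0 \<le> s" "s \<le> t" "t \<le> pi"
  shows "bessel t \<le> bessel s"
proof (rule DERIV_nonpos_imp_nonincreasing[OF assms(2)])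
  fix x assume "s \<le> x" "x \<le> t"
  then show "\<exists>y. (bessel has_real_derivative y) (at x) \<and> y \<le> 0"
    using assms bessel_has_derivative[of x] bessel_deriv_nonpos[of x] by (meson order_trans)
qed

text \<open>
  By Bessel's equation the derivative of \<open>J\<^sup>2 + J'\<^sup>2\<close> is \<open>- 2 J'\<^sup>2 / t\<close>. A bound at a single point
  therefore controls \<open>\<bar>J\<bar>\<close> on the whole half-line beyond it.
\<close>

lemma bessel_energy_antimono:
  assumes "0 < s" "s \<le> t"
  shows "(bessel t)\<^sup>2 + (bessel_deriv t)\<^sup>2 \<le> (bessel s)\<^sup>2 + (bessel_deriv s)\<^sup>2"
proof (rule DERIV_nonpos_imp_nonincreasing[OF assms(2)])
  fix x assume "s \<le> x" "x \<le> t"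
  then have "x > 0"
    using assms by simp
  define D where "D = (LINT w|circle_measure. - ((Re w)\<^sup>2 * cos (x * Re w)))"
  have "((\<lambda>x. (bessel x)\<^sup>2 + (bessel_deriv x)\<^sup>2) has_real_derivative
      2 * bessel_deriv x * (bessel x + D)) (at x)"
    unfolding D_def
    by (auto intro!: derivative_eq_intros bessel_has_derivative bessel_deriv_has_derivative simp: algebra_simps)
  moreover have "bessel x + D = - (bessel_deriv x / x)"
    using bessel_equation[of x] \<open>x > 0\<close> unfolding D_def[symmetric] by (simp add: field_simps)
  moreover have "2 * bessel_deriv x * - (bessel_deriv x / x) \<le> 0"
    using \<open>x > 0\<close> by (simp add: zero_le_divide_iff)
  ultimately show "\<exists>y. ((\<lambda>x. (bessel x)\<^sup>2 + (bessel_deriv x)\<^sup>2) has_real_derivative y) (at x) \<and> y \<le> 0"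
    by auto
qed

text \<open>
  The point 31/10 lies just below \<open>pi\<close>, where monotonicity is still available, and the energy there is already small
  enough. The values at this point are bounded by averaged Taylor polynomials.
\<close>

lemma bessel_ge_at_31_10: "bessel (31 / 10) \<ge> - 2925 / 10000"
proof -
  define t :: real where "t = 31 / 10"
  have "(LINT w|circle_measure. 1 + - (t ^ 2 / 2) * (Re w) ^ 2 + t ^ 4 / 24 * (Re w) ^ 4 +
      - (t ^ 6 / 720) * (Re w) ^ 6 + t ^ 8 / 40320 * (Re w) ^ 8 + - (t ^ 10 / 3628800) * (Re w) ^ 10) \<le> bessel t"
    unfolding bessel_def
  proof (intro integral_mono integrable_circle continuous_intros)
    fix w
    show "1 + - (t ^ 2 / 2) * (Re w) ^ 2 + t ^ 4 / 24 * (Re w) ^ 4 +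
      - (t ^ 6 / 720) * (Re w) ^ 6 + t ^ 8 / 40320 * (Re w) ^ 8 + - (t ^ 10 / 3628800) * (Re w) ^ 10 \<le> cos (t * Re w)"
      using cos_Taylor_bounds(2)[of "t * Re w"] by (simp add: power_mult_distrib)
  qed
  then show ?thesis
    unfolding mean_Re_polynomial by (simp add: t_def power_divide)
qed

lemma bessel_deriv_ge_at_31_10: "bessel_deriv (31 / 10) \<ge> - 3023 / 10000"
proof -
  define t :: real where "t = 31 / 10"
  have "- t * bessel_deriv t = (LINT w|circle_measure. - t * - (Re w * sin (t * Re w)))"
    unfolding bessel_deriv_def by (rule integral_mult_right_zero[symmetric])
  also have "\<dots> \<le> (LINT w|circle_measure. 0 + t ^ 2 * (Re w) ^ 2 + - (t ^ 4 / 6) * (Re w) ^ 4 +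
      t ^ 6 / 120 * (Re w) ^ 6 + - (t ^ 8 / 5040) * (Re w) ^ 8 + t ^ 10 / 362880 * (Re w) ^ 10)"
  proof (intro integral_mono integrable_circle continuous_intros)
    fix w
    show "- t * - (Re w * sin (t * Re w)) \<le> 0 + t ^ 2 * (Re w) ^ 2 + - (t ^ 4 / 6) * (Re w) ^ 4 +
      t ^ 6 / 120 * (Re w) ^ 6 + - (t ^ 8 / 5040) * (Re w) ^ 8 + t ^ 10 / 362880 * (Re w) ^ 10"
      using sin_Taylor_bound[of "t * Re w"] by (simp add: power_mult_distrib mult.assoc)
  qed
  finally show ?thesis
    unfolding mean_Re_polynomial by (simp add: t_def power_divide)
qed

lemma exp_bounds_17_10: "177 / 1000 \<le> exp (- (17 / 10 :: real))" "exp (- (17 / 10 :: real)) \<le> 187 / 1000"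
proof -
  \<comment> \<open>the powers of \<open>1 \<plusminus> x / 64\<close> approximate \<open>exp (\<plusminus> x)\<close> well enough for the margins below\<close>
  have "177 / 1000 \<le> (1 - 17 / 10 / real 64) ^ 64"
    by (simp add: power_divide)
  also have "\<dots> \<le> exp (- (17 / 10))"
    by (rule exp_ge_one_minus_x_over_n_power_n) auto
  finally show "177 / 1000 \<le> exp (- (17 / 10 :: real))" .
  have "1000 / 187 \<le> (1 + 17 / 10 / real 64) ^ 64"
    by (simp add: power_divide)
  also have "\<dots> \<le> exp (17 / 10)"
    by (rule exp_ge_one_plus_x_over_n_power_n) auto
  finally show "exp (- (17 / 10 :: real)) \<le> 187 / 1000"
    by (simp add: exp_minus field_simps)
qed

text \<open>
  The point where the two bounds on \<open>\<bar>J\<bar>\<close> are exchanged. Its square 17/5 has some freedom: it must be large enough for the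
  Gaussian tail beyond it to fit into the gap at the exponent two, and small enough for the value
  \<open>exp (- 17 / 20)\<close> of the Gaussian there to exceed all later values of \<open>\<bar>J\<bar>\<close>.
\<close>

definition crossover :: real where
  "crossover = sqrt (17 / 5)"

lemma crossover_bounds: "crossover > 0" "crossover\<^sup>2 = 17 / 5" "184 / 100 \<le> crossover" "crossover \<le> 31 / 10"
proof -
  show "184 / 100 \<le> crossover"
    unfolding crossover_def by (rule real_le_rsqrt) (simp add: power2_eq_square)
  show "crossover \<le> 31 / 10"
    unfolding crossover_def by (rule real_le_lsqrt) (simp_all add: power2_eq_square)
qed (simp_all add: crossover_def)

lemma exp_crossover: "(exp (- (crossover\<^sup>2 / 4)))\<^sup>2 = exp (- (17 / 10))"
  by (simp add: crossover_bounds exp_double[symmetric])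

text \<open>
  The averaged Taylor polynomial of degree four is the square of \<open>1 - t\<^sup>2 / 8 \<le> exp (- t\<^sup>2 / 8)\<close>.
\<close>

lemma bessel_le_gauss:
  assumes "0 \<le> t" "t \<le> 2"
  shows "bessel t \<le> exp (- (t\<^sup>2 / 4))"
proof -
  have "t\<^sup>2 \<le> 2\<^sup>2"
    using assms by (intro power_mono)
  have "bessel t \<le> (1 - t\<^sup>2 / 8)\<^sup>2"
    using bessel_le_quartic[of t] by (simp add: power2_eq_square algebra_simps eval_nat_numeral)
  also have "\<dots> \<le> (exp (- (t\<^sup>2 / 8)))\<^sup>2"
    using \<open>t\<^sup>2 \<le> 2\<^sup>2\<close> exp_ge_add_one_self[of "- (t\<^sup>2 / 8)"] by (intro power_mono) auto
  also have "\<dots> = exp (- (t\<^sup>2 / 4))"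
    by (simp add: exp_double[symmetric])
  finally show ?thesis .
qed

lemma bessel_ge_minus_crossover:
  assumes "0 \<le> t" "t \<le> 31 / 10"
  shows "bessel t \<ge> - exp (- (crossover\<^sup>2 / 4))"
proof -
  have "(2925 / 10000)\<^sup>2 \<le> (exp (- (crossover\<^sup>2 / 4)))\<^sup>2"
    unfolding exp_crossover using exp_bounds_17_10(1) by (simp add: power2_eq_square)
  then have "2925 / 10000 \<le> exp (- (crossover\<^sup>2 / 4))"
    by (rule power2_le_imp_le) simp
  moreover have "bessel (31 / 10) \<le> bessel t"
    using assms pi_approx by (intro bessel_antimono) auto
  ultimately show ?thesis
    using bessel_ge_at_31_10 by simp
qed

lemma abs_bessel_le_gauss:
  assumes "0 \<le> t" "t \<le> crossover"
  shows "\<bar>bessel t\<bar> \<le> exp (- (t\<^sup>2 / 4))"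
proof -
  have "crossover \<le> 2"
    unfolding crossover_def by (rule real_le_lsqrt) auto
  then have "bessel t \<le> exp (- (t\<^sup>2 / 4))"
    using assms by (intro bessel_le_gauss) auto
  moreover have "exp (- (crossover\<^sup>2 / 4)) \<le> exp (- (t\<^sup>2 / 4))"
    using assms by (simp add: power_mono)
  moreover have "- exp (- (crossover\<^sup>2 / 4)) \<le> bessel t"
    using assms crossover_bounds by (intro bessel_ge_minus_crossover) auto
  ultimately show ?thesis
    unfolding abs_le_iff by linarith
qed

text \<open>
  Up to 31/10 the function decreases, so its two end values bound it. Beyond 31/10 the energy does.
\<close>

lemma abs_bessel_le_crossover:
  assumes "crossover \<le> t"
  shows "\<bar>bessel t\<bar> \<le> exp (- (crossover\<^sup>2 / 4))"
proof (cases "t \<le> 31 / 10")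
  case True
  have "bessel t \<le> bessel crossover"
    using assms True pi_approx crossover_bounds by (intro bessel_antimono) auto
  also have "\<dots> \<le> exp (- (crossover\<^sup>2 / 4))"
    using abs_bessel_le_gauss[of crossover] crossover_bounds(1) by simp
  finally show ?thesis
    using bessel_ge_minus_crossover[of t] assms True crossover_bounds(1) by (simp add: abs_le_iff)
next
  case False
  have "\<bar>bessel (31 / 10)\<bar> \<le> 2925 / 10000"
    using bessel_ge_at_31_10 bessel_le_quartic[of "31 / 10"] by (simp add: abs_le_iff power_divide)
  moreover have "\<bar>bessel_deriv (31 / 10)\<bar> \<le> 3023 / 10000"
    using bessel_deriv_ge_at_31_10 bessel_deriv_nonpos[of "31 / 10"] pi_approx by (simp add: abs_le_iff)
  ultimately have "\<bar>bessel (31 / 10)\<bar>\<^sup>2 + \<bar>bessel_deriv (31 / 10)\<bar>\<^sup>2 \<le> (2925 / 10000)\<^sup>2 + (3023 / 10000)\<^sup>2"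
    by (intro add_mono power_mono) auto
  also have "\<dots> \<le> (exp (- (crossover\<^sup>2 / 4)))\<^sup>2"
    unfolding exp_crossover using exp_bounds_17_10(1) by (simp add: power2_eq_square)
  finally have "(bessel t)\<^sup>2 + (bessel_deriv t)\<^sup>2 \<le> (exp (- (crossover\<^sup>2 / 4)))\<^sup>2"
    using bessel_energy_antimono[of "31 / 10" t] False by simp
  then have "\<bar>bessel t\<bar>\<^sup>2 \<le> (exp (- (crossover\<^sup>2 / 4)))\<^sup>2"
    using zero_le_power2[of "bessel_deriv t"] unfolding power2_abs by linarith
  then show ?thesis
    by (rule power2_le_imp_le) simp
qed

section \<open>Powers of the Bessel function\<close>

text \<open>
  The antiderivative \<open>- exp (- t\<^sup>2 / 2) / (t (t\<^sup>2 + 2))\<close> has a derivative that dominates \<open>exp (- t\<^sup>2 / 2) / t\<^sup>2\<close> as soon as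
  \<open>t\<^sup>2 \<ge> 2\<close>. The simpler bound \<open>exp (- t\<^sup>2 / 2) / t ^ 3\<close> would be too large for the next lemma.
\<close>

lemma gauss_tail:
  "(\<integral>\<^sup>+t. ennreal (indicator {crossover..} t * exp (- (t\<^sup>2 / 2))) \<partial>inverse_square_measure)
    \<le> ennreal (exp (- (crossover\<^sup>2 / 2)) / (crossover * (crossover\<^sup>2 + 2)))"
proof -
  define F where "F t = - (exp (- (t\<^sup>2 / 2)) / (t * (t\<^sup>2 + 2)))" for t :: real
  define f where "f t = exp (- (t\<^sup>2 / 2)) * (1 / (t\<^sup>2 + 2) + (3 * t\<^sup>2 + 2) / (t * (t\<^sup>2 + 2))\<^sup>2)" for t :: real
  have "(\<integral>\<^sup>+t. ennreal (indicator {crossover..} t * exp (- (t\<^sup>2 / 2))) \<partial>inverse_square_measure) =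
      (\<integral>\<^sup>+t. ennreal (indicator {0<..} t / t\<^sup>2) * ennreal (indicator {crossover..} t * exp (- (t\<^sup>2 / 2))) \<partial>lborel)"
    by (rule nn_integral_inverse_square) measurable
  also have "\<dots> \<le> (\<integral>\<^sup>+t. ennreal (f t) * indicator {crossover..} t \<partial>lborel)"
  proof (rule nn_integral_mono)
    fix t :: real
    show "ennreal (indicator {0<..} t / t\<^sup>2) * ennreal (indicator {crossover..} t * exp (- (t\<^sup>2 / 2)))
      \<le> ennreal (f t) * indicator {crossover..} t"
    proof (cases "crossover \<le> t")
      case True
      then have "t > 0"
        using crossover_bounds(1) by simp
      have "2 \<le> crossover\<^sup>2"
        by (simp add: crossover_bounds(2))
      also have "\<dots> \<le> t\<^sup>2"
        using True crossover_bounds(1) by (intro power_mono) auto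
      finally have "(t\<^sup>2 + 2)\<^sup>2 \<le> t\<^sup>2 * (t\<^sup>2 + 2) + (3 * t\<^sup>2 + 2)"
        by (simp add: power2_eq_square algebra_simps)
      moreover have "t\<^sup>2 * (t\<^sup>2 + 2)\<^sup>2 > 0"
        using \<open>t > 0\<close> by (intro mult_pos_pos zero_less_power) (auto intro: add_nonneg_pos)
      ultimately have "(t\<^sup>2 + 2)\<^sup>2 / (t\<^sup>2 * (t\<^sup>2 + 2)\<^sup>2) \<le> (t\<^sup>2 * (t\<^sup>2 + 2) + (3 * t\<^sup>2 + 2)) / (t\<^sup>2 * (t\<^sup>2 + 2)\<^sup>2)"
        by (intro divide_right_mono) auto
      moreover have "(t\<^sup>2 + 2)\<^sup>2 / (t\<^sup>2 * (t\<^sup>2 + 2)\<^sup>2) = 1 / t\<^sup>2"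
        using \<open>t > 0\<close> by (simp add: add_nonneg_eq_0_iff)
      moreover have "(t\<^sup>2 * (t\<^sup>2 + 2) + (3 * t\<^sup>2 + 2)) / (t\<^sup>2 * (t\<^sup>2 + 2)\<^sup>2) =
          1 / (t\<^sup>2 + 2) + (3 * t\<^sup>2 + 2) / (t * (t\<^sup>2 + 2))\<^sup>2"
      proof -
        have "(t\<^sup>2 * A + C) / (t\<^sup>2 * A\<^sup>2) = 1 / A + C / (t * A)\<^sup>2" if "A \<noteq> 0" for A C :: real
          using that \<open>t > 0\<close> by (simp add: field_simps power2_eq_square)
        then show ?thesis
          by (simp add: add_nonneg_eq_0_iff)
      qed
      ultimately have "1 / t\<^sup>2 \<le> 1 / (t\<^sup>2 + 2) + (3 * t\<^sup>2 + 2) / (t * (t\<^sup>2 + 2))\<^sup>2"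
        by linarith
      from mult_left_mono[OF this, of "exp (- (t\<^sup>2 / 2))"] have "1 / t\<^sup>2 * exp (- (t\<^sup>2 / 2)) \<le> f t"
        by (simp add: f_def mult.commute)
      then show ?thesis
        using True \<open>t > 0\<close> by (simp add: ennreal_mult[symmetric] ennreal_leI)
    qed simp
  qed
  also have "\<dots> = ennreal (0 - F crossover)"
  proof (rule nn_integral_FTC_atLeast)
    show "f \<in> borel_measurable borel"
      unfolding f_def by measurable
    fix t assume "crossover \<le> t"
    then have "t > 0"
      using crossover_bounds(1) by simp
    then have "t * (t\<^sup>2 + 2) \<noteq> 0"
      by (simp add: add_nonneg_eq_0_iff)
    have "((\<lambda>t. t * (t\<^sup>2 + 2)) has_real_derivative 3 * t\<^sup>2 + 2) (at t)"
      by (auto intro!: derivative_eq_intros simp: power2_eq_square)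
    moreover have "((\<lambda>t. exp (- (t\<^sup>2 / 2))) has_real_derivative - t * exp (- (t\<^sup>2 / 2))) (at t)"
      by (auto intro!: derivative_eq_intros)
    ultimately have "((\<lambda>t. - (exp (- (t\<^sup>2 / 2)) / (t * (t\<^sup>2 + 2)))) has_real_derivative
        - ((- t * exp (- (t\<^sup>2 / 2)) * (t * (t\<^sup>2 + 2)) - exp (- (t\<^sup>2 / 2)) * (3 * t\<^sup>2 + 2)) /
          ((t * (t\<^sup>2 + 2)) * (t * (t\<^sup>2 + 2))))) (at t)"
      using \<open>t * (t\<^sup>2 + 2) \<noteq> 0\<close> by (intro DERIV_minus DERIV_divide)
    moreover have "- ((- t * exp (- (t\<^sup>2 / 2)) * (t * (t\<^sup>2 + 2)) - exp (- (t\<^sup>2 / 2)) * (3 * t\<^sup>2 + 2)) /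
          ((t * (t\<^sup>2 + 2)) * (t * (t\<^sup>2 + 2)))) = f t"
    proof -
      have "- ((- t * E * (t * A) - E * B) / ((t * A) * (t * A))) = E * (1 / A + B / (t * A)\<^sup>2)"
        if "A \<noteq> 0" for A B E :: real
        using that \<open>t > 0\<close> by (simp add: field_simps power2_eq_square)
      then show ?thesis
        unfolding f_def using \<open>t * (t\<^sup>2 + 2) \<noteq> 0\<close> by simp
    qed
    ultimately show "(F has_real_derivative f t) (at t)"
      unfolding F_def by simp
    show "0 \<le> f t"
      unfolding f_def by (intro mult_nonneg_nonneg add_nonneg_nonneg divide_nonneg_nonneg) auto
  next
    show "(F \<longlongrightarrow> 0) at_top"
      unfolding F_def by real_asymp
  qed
  finally show ?thesis
    by (simp add: F_def)
qed

text \<open>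
  The excess of \<open>H(2) = 4 / pi\<close> over its Gaussian value covers the Gaussian tail beyond the crossover.
\<close>

lemma gap_at_two:
  "sqrt (pi / 2) + exp (- (crossover\<^sup>2 / 2)) / (crossover * (crossover\<^sup>2 + 2)) \<le> 4 / pi"
proof -
  have "exp (- (crossover\<^sup>2 / 2)) / (crossover * (crossover\<^sup>2 + 2)) \<le> (187 / 1000) / (184 / 100 * (17 / 5 + 2))"
  proof (intro frac_le mult_mono)
    have "crossover\<^sup>2 / 2 = 17 / 10"
      by (simp add: crossover_bounds(2))
    then show "exp (- (crossover\<^sup>2 / 2)) \<le> 187 / 1000"
      using exp_bounds_17_10(2) by (simp only:)
  qed (use crossover_bounds in auto)
  moreover have "sqrt (pi / 2) \<le> 12534 / 10000"
    using pi_approx by (intro real_le_lsqrt) (auto simp: power2_eq_square)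
  moreover have "1273 / 1000 \<le> 4 / pi"
    using pi_approx by (simp add: field_simps)
  ultimately show ?thesis
    by simp
qed

text \<open>
  The function called \<open>H\<close> in the introduction.
\<close>

definition bessel_power_integral :: "real \<Rightarrow> ennreal" where
  "bessel_power_integral s = (\<integral>\<^sup>+t. ennreal (1 - \<bar>bessel t\<bar> powr s) \<partial>inverse_square_measure)"

lemma bessel_power_integral_2: "bessel_power_integral 2 = ennreal (4 / pi)"
  using nn_integral_bessel_squared by (simp add: bessel_power_integral_def)

text \<open>
  Before the crossover, \<open>g \<le> f\<close> and \<open>\<rho> \<le> f\<close> give \<open>f powr s - g powr s \<ge> f powr (s - 2) * (f\<^sup>2 - g\<^sup>2) \<ge>
  \<rho> powr (s - 2) * (f\<^sup>2 - g\<^sup>2)\<close>. Beyond it, \<open>g \<le> \<rho>\<close> gives \<open>g powr s \<le> \<rho> powr (s - 2) * g\<^sup>2\<close>, and the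
  indicator term makes up for the missing \<open>f\<^sup>2\<close>. All terms are arranged to be nonnegative, so the inequality can be
  integrated without checking integrability.
\<close>

lemma gauss_bessel_compare:
  assumes "t > 0" "s \<ge> 2"
  defines "f \<equiv> exp (- (t\<^sup>2 / 4))" and "\<rho> \<equiv> exp (- (crossover\<^sup>2 / 4))" and "g \<equiv> \<bar>bessel t\<bar>"
  shows "(1 - f powr s) + \<rho> powr (s - 2) * (1 - g\<^sup>2) \<le>
    (1 - g powr s) + \<rho> powr (s - 2) * (1 - f\<^sup>2) + \<rho> powr (s - 2) * (indicator {crossover..} t * f\<^sup>2)"
proof -
  have nonneg: "0 \<le> g" "0 < f" "0 < \<rho>"
    by (simp_all add: f_def g_def \<rho>_def)
  have split: "x powr s = x\<^sup>2 * x powr (s - 2)" if "x \<ge> 0" for x :: real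
    using that powr_add[of x 2 "s - 2"] by simp
  show ?thesis
  proof (cases "crossover \<le> t")
    case True
    then have "g powr (s - 2) \<le> \<rho> powr (s - 2)"
      using abs_bessel_le_crossover[of t] nonneg \<open>s \<ge> 2\<close> by (intro powr_mono2) (auto simp: g_def \<rho>_def)
    then have "g powr s \<le> g\<^sup>2 * \<rho> powr (s - 2)"
      unfolding split[OF nonneg(1)] by (intro mult_left_mono) auto
    then have "g powr s \<le> f powr s + g\<^sup>2 * \<rho> powr (s - 2)"
      using powr_ge_zero[of f s] by linarith
    then show ?thesis
      using True by (simp add: algebra_simps)
  next
    case False
    have "g \<le> f"
      using abs_bessel_le_gauss[of t] False \<open>t > 0\<close> by (simp add: f_def g_def)
    have "\<rho> \<le> f"
      using False \<open>t > 0\<close> by (simp add: f_def \<rho>_def power_mono)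
    have "g powr (s - 2) \<le> f powr (s - 2)" "\<rho> powr (s - 2) \<le> f powr (s - 2)"
      using \<open>g \<le> f\<close> \<open>\<rho> \<le> f\<close> nonneg \<open>s \<ge> 2\<close> by (auto intro!: powr_mono2)
    have "g powr s \<le> g\<^sup>2 * f powr (s - 2)"
      unfolding split[OF nonneg(1)] by (intro mult_left_mono) (fact, simp)
    moreover have "f powr s = f\<^sup>2 * f powr (s - 2)"
      using nonneg by (intro split) simp
    moreover have "g\<^sup>2 \<le> f\<^sup>2"
      using \<open>g \<le> f\<close> nonneg by (intro power_mono)
    then have "\<rho> powr (s - 2) * (f\<^sup>2 - g\<^sup>2) \<le> f powr (s - 2) * (f\<^sup>2 - g\<^sup>2)"
      using \<open>\<rho> powr (s - 2) \<le> f powr (s - 2)\<close> by (intro mult_right_mono) auto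
    ultimately show ?thesis
      using False by (simp add: algebra_simps)
  qed
qed

text \<open>
  Integrating the pointwise comparison bounds \<open>H(s) - sqrt (pi * s) / 2\<close> below by \<open>\<rho> powr (s - 2)\<close> times the
  gap at the exponent two, which is nonnegative.
\<close>

lemma bessel_power_integral_ge:
  assumes "s \<ge> 2"
  shows "ennreal (sqrt (pi * s) / 2) \<le> bessel_power_integral s"
proof -
  define \<rho> where "\<rho> = exp (- (crossover\<^sup>2 / 4))"
  define r where "r = \<rho> powr (s - 2)"
  define \<tau> where "\<tau> = exp (- (crossover\<^sup>2 / 2)) / (crossover * (crossover\<^sup>2 + 2))"
  have r: "r \<ge> 0"
    by (simp add: r_def)
  have gauss_powr: "exp (- (t\<^sup>2 / 4)) powr s = exp (- (s / 4 * t\<^sup>2))" for t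
    by (simp add: powr_def mult.commute)
  have gauss_square: "(exp (- (t\<^sup>2 / 4)))\<^sup>2 = exp (- (1 / 2 * t\<^sup>2))" for t :: real
    by (simp add: exp_double[symmetric])
  have bessel_le: "\<bar>bessel t\<bar>\<^sup>2 \<le> 1" "\<bar>bessel t\<bar> powr s \<le> 1" for t
    using abs_bessel_le_1[of t] assms by (simp_all add: abs_square_le_1 powr_le1)
  have "ennreal (sqrt (pi * (s / 4)) + r * (4 / pi)) =
      ennreal (sqrt (pi * (s / 4))) + ennreal r * ennreal (4 / pi)"
    using assms r by (simp add: ennreal_mult[symmetric])
  also have "\<dots> = (\<integral>\<^sup>+t. ennreal (1 - exp (- (s / 4 * t\<^sup>2))) \<partial>inverse_square_measure) +
      ennreal r * (\<integral>\<^sup>+t. ennreal (1 - (bessel t)\<^sup>2) \<partial>inverse_square_measure)"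
    using assms by (subst nn_integral_gauss_inverse_square) (auto simp: nn_integral_bessel_squared)
  also have "\<dots> = (\<integral>\<^sup>+t. ennreal (1 - exp (- (s / 4 * t\<^sup>2))) + ennreal r * ennreal (1 - (bessel t)\<^sup>2) \<partial>inverse_square_measure)"
    by (subst nn_integral_add, measurable, subst nn_integral_cmult, measurable)
  also have "\<dots> \<le> (\<integral>\<^sup>+t. ennreal (1 - \<bar>bessel t\<bar> powr s) + (ennreal r * ennreal (1 - exp (- (1 / 2 * t\<^sup>2))) +
      ennreal r * ennreal (indicator {crossover..} t * exp (- (t\<^sup>2 / 2)))) \<partial>inverse_square_measure)"
  proof (rule nn_integral_mono_AE, rule eventually_mono[OF AE_inverse_square])
    fix t :: real
    assume "t > 0"
    from gauss_bessel_compare[OF this assms]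
    have "1 - exp (- (s / 4 * t\<^sup>2)) + r * (1 - (bessel t)\<^sup>2) \<le> 1 - \<bar>bessel t\<bar> powr s +
        (r * (1 - exp (- (1 / 2 * t\<^sup>2))) + r * (indicator {crossover..} t * exp (- (t\<^sup>2 / 2))))"
      unfolding gauss_powr gauss_square \<rho>_def[symmetric] r_def[symmetric] by simp
    then have "ennreal (1 - exp (- (s / 4 * t\<^sup>2)) + r * (1 - (bessel t)\<^sup>2)) \<le> ennreal (1 - \<bar>bessel t\<bar> powr s +
        (r * (1 - exp (- (1 / 2 * t\<^sup>2))) + r * (indicator {crossover..} t * exp (- (t\<^sup>2 / 2)))))"
      by (rule ennreal_leI)
    then show "ennreal (1 - exp (- (s / 4 * t\<^sup>2))) + ennreal r * ennreal (1 - (bessel t)\<^sup>2) \<le>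
        ennreal (1 - \<bar>bessel t\<bar> powr s) + (ennreal r * ennreal (1 - exp (- (1 / 2 * t\<^sup>2))) +
      ennreal r * ennreal (indicator {crossover..} t * exp (- (t\<^sup>2 / 2))))"
      using assms r bessel_le[of t] by (simp add: ennreal_plus ennreal_mult)
  qed
  also have "\<dots> = bessel_power_integral s + (ennreal r * (\<integral>\<^sup>+t. ennreal (1 - exp (- (1 / 2 * t\<^sup>2))) \<partial>inverse_square_measure) +
      ennreal r * (\<integral>\<^sup>+t. ennreal (indicator {crossover..} t * exp (- (t\<^sup>2 / 2))) \<partial>inverse_square_measure))"
    unfolding bessel_power_integral_def
    by (subst nn_integral_add, measurable, subst nn_integral_add, measurable,
        subst nn_integral_cmult, measurable, subst nn_integral_cmult, measurable)
  also have "\<dots> \<le> bessel_power_integral s + (ennreal r * ennreal (sqrt (pi * (1 / 2))) + ennreal r * ennreal \<tau>)"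
    unfolding \<tau>_def using gauss_tail nn_integral_gauss_inverse_square[of "1 / 2"]
    by (intro add_left_mono add_mono mult_left_mono) auto
  also have "ennreal r * ennreal (sqrt (pi * (1 / 2))) + ennreal r * ennreal \<tau> = ennreal (r * (sqrt (pi / 2) + \<tau>))"
    using r crossover_bounds(1) by (simp add: \<tau>_def ennreal_mult[symmetric] ennreal_plus[symmetric] distrib_left del: ennreal_plus)
  finally have main: "ennreal (sqrt (pi * (s / 4)) + r * (4 / pi)) \<le> bessel_power_integral s + ennreal (r * (sqrt (pi / 2) + \<tau>))" .
  have "r * (sqrt (pi / 2) + \<tau>) \<le> r * (4 / pi)"
    using gap_at_two r unfolding \<tau>_def by (intro mult_left_mono) auto
  then have "ennreal (r * (sqrt (pi / 2) + \<tau>)) \<le> ennreal (r * (4 / pi))"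
    by (rule ennreal_leI)
  then have "bessel_power_integral s + ennreal (r * (sqrt (pi / 2) + \<tau>)) \<le> bessel_power_integral s + ennreal (r * (4 / pi))"
    by (rule add_left_mono)
  with main have "ennreal (sqrt (pi * (s / 4)) + r * (4 / pi)) \<le> bessel_power_integral s + ennreal (r * (4 / pi))"
    by (rule order_trans)
  also have "ennreal (sqrt (pi * (s / 4)) + r * (4 / pi)) = ennreal (sqrt (pi * (s / 4))) + ennreal (r * (4 / pi))"
    using assms r by (intro ennreal_plus) auto
  finally have "ennreal (sqrt (pi * (s / 4))) \<le> bessel_power_integral s"
    unfolding add.commute[of _ "ennreal (r * (4 / pi))"] ennreal_add_left_cancel_le by simp
  moreover have "sqrt (pi * (s / 4)) = sqrt (pi * s) / 2"
    by (simp add: real_sqrt_divide)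
  ultimately show ?thesis
    by (simp only:)
qed

section \<open>Khinchine inequality with a dominated largest coefficient\<close>

text \<open>
  Convexity of the exponential function.
\<close>

lemma weighted_am_gm:
  fixes w y :: "'a \<Rightarrow> real"
  assumes "finite I" "\<And>i. i \<in> I \<Longrightarrow> 0 < w i" "sum w I = 1" "\<And>i. i \<in> I \<Longrightarrow> 0 \<le> y i"
  shows "(\<Prod>i\<in>I. y i powr w i) \<le> (\<Sum>i\<in>I. w i * y i)"
proof (cases "\<exists>i\<in>I. y i = 0")
  case True
  then have "(\<Prod>i\<in>I. y i powr w i) = 0"
    using assms(1) by (auto intro: prod_zero)
  moreover have "0 \<le> (\<Sum>i\<in>I. w i * y i)"
    using assms by (intro sum_nonneg mult_nonneg_nonneg) (auto intro: less_imp_le)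
  ultimately show ?thesis
    by (simp only:)
next
  case False
  then have pos: "0 < y i" if "i \<in> I" for i
    using assms(4)[OF that] that by force
  have "(\<Prod>i\<in>I. y i powr w i) = exp (\<Sum>i\<in>I. w i *\<^sub>R ln (y i))"
  proof -
    have "y i powr w i = exp (w i * ln (y i))" if "i \<in> I" for i
      using pos[OF that] by (simp add: powr_def)
    then show ?thesis
      using assms(1) by (simp add: exp_sum)
  qed
  also have "\<dots> \<le> (\<Sum>i\<in>I. w i * exp (ln (y i)))"
  proof (rule convex_on_sum[OF assms(1) _ exp_convex assms(3)])
    show "I \<noteq> {}"
      using assms(3) by auto
  qed (use assms(2) in \<open>auto intro: less_imp_le\<close>)
  also have "\<dots> = (\<Sum>i\<in>I. w i * y i)"
    using pos by simp
  finally show ?thesis .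
qed

definition steinhaus_norm1 :: "nat set \<Rightarrow> (nat \<Rightarrow> complex) \<Rightarrow> real" where
  "steinhaus_norm1 I b = (LINT z|PiM I (\<lambda>_. circle_measure). cmod (\<Sum>i\<in>I. b i * z i))"

lemma steinhaus_norm1_eq_bessel:
  assumes "finite I"
  shows "ennreal (steinhaus_norm1 I b) = (\<integral>\<^sup>+t. ennreal (1 - (\<Prod>i\<in>I. bessel (t * cmod (b i)))) \<partial>inverse_square_measure)"
proof -
  have prob: "prob_space (PiM I (\<lambda>_::nat. circle_measure))"
    by (intro prob_space_PiM prob_space_circle_measure)
  have meas: "(\<lambda>z. cmod (\<Sum>i\<in>I. b i * z i)) \<in> borel_measurable (PiM I (\<lambda>_::nat. circle_measure))"
    by measurable
  have "(\<integral>\<^sup>+t. ennreal (1 - (\<Prod>i\<in>I. bessel (t * cmod (b i)))) \<partial>inverse_square_measure) =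
      (\<integral>\<^sup>+z. ennreal (cmod (\<Sum>i\<in>I. b i * z i)) \<partial>PiM I (\<lambda>_. circle_measure))"
    using nn_integral_bessel_average[OF prob meas] by (simp add: bessel_steinhaus_sum[OF assms])
  also have "\<dots> = ennreal (steinhaus_norm1 I b)"
    unfolding steinhaus_norm1_def
    by (intro nn_integral_eq_integral integrable_steinhaus_sum continuous_intros AE_I2 norm_ge_zero)
  finally show ?thesis ..
qed

text \<open>
  The weighted inequality of arithmetic and geometric means, applied to the powers \<open>\<bar>J(t \<bar>b\<^sub>i\<bar>)\<bar> powr (1 / w\<^sub>i)\<close>, separates
  the factors of the Bessel product; rescaling \<open>t\<close> then turns each summand into \<open>\<bar>b\<^sub>i\<bar> H(1 / w\<^sub>i)\<close>.
\<close>

lemma steinhaus_norm1_ge_weighted: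
  assumes "finite I" and w: "\<And>i. i \<in> I \<Longrightarrow> 0 < w i" "sum w I = 1" and b: "\<And>i. i \<in> I \<Longrightarrow> b i \<noteq> 0"
  shows "(\<Sum>i\<in>I. ennreal (w i * cmod (b i)) * bessel_power_integral (1 / w i)) \<le> ennreal (steinhaus_norm1 I b)"
proof -
  have pw: "(\<Sum>i\<in>I. w i * (1 - \<bar>bessel (cmod (b i) * t)\<bar> powr (1 / w i))) \<le> 1 - (\<Prod>i\<in>I. bessel (t * cmod (b i)))" for t
  proof -
    let ?x = "\<lambda>i. bessel (cmod (b i) * t)"
    have "(\<Prod>i\<in>I. ?x i) \<le> (\<Prod>i\<in>I. \<bar>?x i\<bar>)"
      by (metis abs_ge_self abs_prod)
    also have "\<dots> = (\<Prod>i\<in>I. (\<bar>?x i\<bar> powr (1 / w i)) powr w i)"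
    proof (rule prod.cong)
      fix i assume "i \<in> I"
      then show "\<bar>?x i\<bar> = (\<bar>?x i\<bar> powr (1 / w i)) powr w i"
        using w(1)[of i] by (simp add: powr_powr)
    qed simp
    also have "\<dots> \<le> (\<Sum>i\<in>I. w i * \<bar>?x i\<bar> powr (1 / w i))"
      using assms(1) w by (intro weighted_am_gm) auto
    finally show ?thesis
      using w(2) by (simp add: right_diff_distrib sum_subtractf mult.commute[of t])
  qed
  have nonneg: "0 \<le> 1 - \<bar>bessel x\<bar> powr (1 / w i)" if "i \<in> I" for i x
    using abs_bessel_le_1[of x] w(1)[OF that] by (simp add: powr_le1)
  have "(\<Sum>i\<in>I. ennreal (w i * cmod (b i)) * bessel_power_integral (1 / w i)) =
      (\<Sum>i\<in>I. ennreal (w i) * (\<integral>\<^sup>+t. ennreal (1 - \<bar>bessel (cmod (b i) * t)\<bar> powr (1 / w i)) \<partial>inverse_square_measure))"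
  proof (rule sum.cong[OF refl])
    fix i assume i: "i \<in> I"
    have "(\<integral>\<^sup>+t. ennreal (1 - \<bar>bessel (cmod (b i) * t)\<bar> powr (1 / w i)) \<partial>inverse_square_measure) =
        ennreal (cmod (b i)) * bessel_power_integral (1 / w i)"
      unfolding bessel_power_integral_def
      using b[OF i] by (intro nn_integral_inverse_square_scale[of "\<lambda>t. ennreal (1 - \<bar>bessel t\<bar> powr (1 / w i))"]) auto
    then show "ennreal (w i * cmod (b i)) * bessel_power_integral (1 / w i) =
        ennreal (w i) * (\<integral>\<^sup>+t. ennreal (1 - \<bar>bessel (cmod (b i) * t)\<bar> powr (1 / w i)) \<partial>inverse_square_measure)"
      using w(1)[OF i] by (simp add: ennreal_mult mult.assoc)
  qed
  also have "\<dots> = (\<Sum>i\<in>I. \<integral>\<^sup>+t. ennreal (w i) * ennreal (1 - \<bar>bessel (cmod (b i) * t)\<bar> powr (1 / w i)) \<partial>inverse_square_measure)"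
    by (intro sum.cong refl nn_integral_cmult[symmetric]) measurable
  also have "\<dots> = (\<integral>\<^sup>+t. (\<Sum>i\<in>I. ennreal (w i) * ennreal (1 - \<bar>bessel (cmod (b i) * t)\<bar> powr (1 / w i))) \<partial>inverse_square_measure)"
    by (intro nn_integral_sum[symmetric]) measurable
  also have "\<dots> \<le> (\<integral>\<^sup>+t. ennreal (1 - (\<Prod>i\<in>I. bessel (t * cmod (b i)))) \<partial>inverse_square_measure)"
  proof (rule nn_integral_mono)
    fix t
    have "(\<Sum>i\<in>I. ennreal (w i) * ennreal (1 - \<bar>bessel (cmod (b i) * t)\<bar> powr (1 / w i))) =
        (\<Sum>i\<in>I. ennreal (w i * (1 - \<bar>bessel (cmod (b i) * t)\<bar> powr (1 / w i))))"
      using w(1) nonneg by (intro sum.cong refl ennreal_mult[symmetric]) (auto intro: less_imp_le)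
    also have "\<dots> = ennreal (\<Sum>i\<in>I. w i * (1 - \<bar>bessel (cmod (b i) * t)\<bar> powr (1 / w i)))"
      using w(1) nonneg by (intro sum_ennreal mult_nonneg_nonneg) (auto intro: less_imp_le)
    also have "\<dots> \<le> ennreal (1 - (\<Prod>i\<in>I. bessel (t * cmod (b i))))"
      using pw by (rule ennreal_leI)
    finally show "(\<Sum>i\<in>I. ennreal (w i) * ennreal (1 - \<bar>bessel (cmod (b i) * t)\<bar> powr (1 / w i)))
        \<le> ennreal (1 - (\<Prod>i\<in>I. bessel (t * cmod (b i))))" .
  qed
  also have "\<dots> = ennreal (steinhaus_norm1 I b)"
    by (rule steinhaus_norm1_eq_bessel[symmetric, OF assms(1)])
  finally show ?thesis .
qed

text \<open>
  With \<open>w\<^sub>i = \<bar>b\<^sub>i\<bar>\<^sup>2 / V\<close> every exponent \<open>1 / w\<^sub>i\<close> is at least 2, and each summand is \<open>w\<^sub>i\<close> times the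
  bound \<open>sqrt (pi * V) / 2\<close>.
\<close>

lemma khinchine_small_coefficients:
  assumes "finite I" "I \<noteq> {}" and b: "\<And>i. i \<in> I \<Longrightarrow> b i \<noteq> 0"
    and small: "\<And>i. i \<in> I \<Longrightarrow> 2 * (cmod (b i))\<^sup>2 \<le> (\<Sum>i\<in>I. (cmod (b i))\<^sup>2)"
  shows "sqrt (pi * (\<Sum>i\<in>I. (cmod (b i))\<^sup>2)) / 2 \<le> steinhaus_norm1 I b"
proof -
  define V where "V = (\<Sum>i\<in>I. (cmod (b i))\<^sup>2)"
  define w where "w i = (cmod (b i))\<^sup>2 / V" for i
  have "V > 0"
    unfolding V_def using assms by (intro sum_pos) auto
  have w: "0 < w i" if "i \<in> I" for i
    using b[OF that] \<open>V > 0\<close> by (simp add: w_def)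
  have "sum w I = 1"
    using \<open>V > 0\<close> by (simp add: w_def V_def sum_divide_distrib[symmetric])
  have summand: "ennreal (w i * (sqrt (pi * V) / 2)) \<le> ennreal (w i * cmod (b i)) * bessel_power_integral (1 / w i)" if "i \<in> I" for i
  proof -
    have "2 \<le> 1 / w i"
      using small[OF that] b[OF that] \<open>V > 0\<close> by (simp add: w_def V_def[symmetric] field_simps)
    then have "ennreal (w i * cmod (b i)) * ennreal (sqrt (pi * (1 / w i)) / 2) \<le> ennreal (w i * cmod (b i)) * bessel_power_integral (1 / w i)"
      by (intro mult_left_mono bessel_power_integral_ge) auto
    moreover have "cmod (b i) * sqrt (pi * (1 / w i)) = sqrt (pi * V)"
      using b[OF that] by (simp add: w_def real_sqrt_mult real_sqrt_divide)
    then have "w i * cmod (b i) * (sqrt (pi * (1 / w i)) / 2) = w i * (sqrt (pi * V) / 2)"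
      by (metis mult.assoc times_divide_eq_right)
    moreover have "ennreal (w i * cmod (b i)) * ennreal (sqrt (pi * (1 / w i)) / 2) =
        ennreal (w i * cmod (b i) * (sqrt (pi * (1 / w i)) / 2))"
      using w[of i] that by (intro ennreal_mult[symmetric]) auto
    ultimately show ?thesis
      by (simp only:)
  qed
  have "sqrt (pi * V) / 2 = (\<Sum>i\<in>I. w i * (sqrt (pi * V) / 2))"
    by (simp only: sum_distrib_right[symmetric] \<open>sum w I = 1\<close> mult_1)
  then have "ennreal (sqrt (pi * V) / 2) = ennreal (\<Sum>i\<in>I. w i * (sqrt (pi * V) / 2))"
    by (rule arg_cong)
  also have "\<dots> = (\<Sum>i\<in>I. ennreal (w i * (sqrt (pi * V) / 2)))"
    using w \<open>V > 0\<close> by (intro sum_ennreal[symmetric]) (auto intro: less_imp_le)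
  also have "\<dots> \<le> (\<Sum>i\<in>I. ennreal (w i * cmod (b i)) * bessel_power_integral (1 / w i))"
    by (intro sum_mono summand)
  also have "\<dots> \<le> ennreal (steinhaus_norm1 I b)"
    by (intro steinhaus_norm1_ge_weighted assms w \<open>sum w I = 1\<close>)
  finally show ?thesis
    unfolding V_def steinhaus_norm1_def by (subst (asm) ennreal_le_iff) auto
qed

text \<open>
  The large coefficient gets the weight 1/2 and the exact value \<open>H(2) = 4 / pi\<close>, the others share the rest in
  proportion to \<open>\<bar>b\<^sub>i\<bar>\<^sup>2\<close>. The resulting bound \<open>2 / pi + sqrt (pi * (2 * V)) / 4\<close> is good enough only for \<open>V\<close>
  not too far from 1.
\<close>

lemma khinchine_medium_coefficient:
  assumes "finite I" "j \<notin> I" and b: "\<And>i. i \<in> I \<Longrightarrow> b i \<noteq> 0" and "cmod (b j) = 1"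
    and V: "3 / 5 \<le> (\<Sum>i\<in>I. (cmod (b i))\<^sup>2)" "(\<Sum>i\<in>I. (cmod (b i))\<^sup>2) \<le> 1"
  shows "sqrt (pi * (1 + (\<Sum>i\<in>I. (cmod (b i))\<^sup>2))) / 2 \<le> steinhaus_norm1 (insert j I) b"
proof -
  define V where "V = (\<Sum>i\<in>I. (cmod (b i))\<^sup>2)"
  define w where "w i = (if i = j then 1 / 2 else (cmod (b i))\<^sup>2 / (2 * V))" for i
  have V': "3 / 5 \<le> V" "V \<le> 1" "V > 0"
    using V by (auto simp: V_def)
  have w: "0 < w i" if "i \<in> insert j I" for i
    using b that V' by (auto simp: w_def)
  have wI: "(\<Sum>i\<in>I. w i) = 1 / 2"
  proof -
    have "(\<Sum>i\<in>I. w i) = (\<Sum>i\<in>I. (cmod (b i))\<^sup>2 / (2 * V))"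
      using assms(2) by (intro sum.cong) (auto simp: w_def)
    also have "\<dots> = V / (2 * V)"
      by (simp only: sum_divide_distrib[symmetric] V_def)
    finally show ?thesis
      using V' by simp
  qed
  have wj: "w j = 1 / 2"
    by (simp add: w_def)
  have sum_w: "sum w (insert j I) = 1"
    using assms(1,2) wI wj by simp
  have summand: "ennreal (w i * (sqrt (pi * (2 * V)) / 2)) \<le> ennreal (w i * cmod (b i)) * bessel_power_integral (1 / w i)" if "i \<in> I" for i
  proof -
    have wi: "w i = (cmod (b i))\<^sup>2 / (2 * V)"
      using that assms(2) by (auto simp: w_def)
    have "(cmod (b i))\<^sup>2 \<le> V"
      unfolding V_def using that assms(1) by (intro member_le_sum) auto
    then have "2 \<le> 1 / w i"
      using b[OF that] V' by (simp add: wi field_simps)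
    then have "ennreal (w i * cmod (b i)) * ennreal (sqrt (pi * (1 / w i)) / 2) \<le> ennreal (w i * cmod (b i)) * bessel_power_integral (1 / w i)"
      by (intro mult_left_mono bessel_power_integral_ge) auto
    moreover have "cmod (b i) * sqrt (pi * (1 / w i)) = sqrt (pi * (2 * V))"
      using b[OF that] by (simp add: wi real_sqrt_mult real_sqrt_divide)
    then have "w i * cmod (b i) * (sqrt (pi * (1 / w i)) / 2) = w i * (sqrt (pi * (2 * V)) / 2)"
      by (metis mult.assoc times_divide_eq_right)
    moreover have "ennreal (w i * cmod (b i)) * ennreal (sqrt (pi * (1 / w i)) / 2) =
        ennreal (w i * cmod (b i) * (sqrt (pi * (1 / w i)) / 2))"
      using w[of i] that by (intro ennreal_mult[symmetric]) auto
    ultimately show ?thesis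
      by (simp only:)
  qed
  have "ennreal (2 / pi + sqrt (pi * (2 * V)) / 4) = ennreal (2 / pi) + ennreal (\<Sum>i\<in>I. w i * (sqrt (pi * (2 * V)) / 2))"
  proof -
    have "(\<Sum>i\<in>I. w i * (sqrt (pi * (2 * V)) / 2)) = sqrt (pi * (2 * V)) / 4"
      by (simp only: sum_distrib_right[symmetric] wI)
    moreover have "ennreal (2 / pi + sqrt (pi * (2 * V)) / 4) = ennreal (2 / pi) + ennreal (sqrt (pi * (2 * V)) / 4)"
      using V' by (intro ennreal_plus) auto
    ultimately show ?thesis
      by (simp only:)
  qed
  also have "ennreal (\<Sum>i\<in>I. w i * (sqrt (pi * (2 * V)) / 2)) = (\<Sum>i\<in>I. ennreal (w i * (sqrt (pi * (2 * V)) / 2)))"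
    using w V' by (intro sum_ennreal[symmetric]) (auto intro: less_imp_le)
  also have "ennreal (2 / pi) + (\<Sum>i\<in>I. ennreal (w i * (sqrt (pi * (2 * V)) / 2))) \<le>
      ennreal (w j * cmod (b j)) * bessel_power_integral (1 / w j) +
      (\<Sum>i\<in>I. ennreal (w i * cmod (b i)) * bessel_power_integral (1 / w i))"
  proof (rule add_mono[OF _ sum_mono[OF summand]])
    show "ennreal (2 / pi) \<le> ennreal (w j * cmod (b j)) * bessel_power_integral (1 / w j)"
    proof -
      have "1 / w j = 2" "w j * cmod (b j) = 1 / 2"
        by (simp_all add: wj assms(4))
      moreover have "ennreal (1 / 2) * ennreal (4 / pi) = ennreal (1 / 2 * (4 / pi))"
        by (rule ennreal_mult[symmetric]) auto
      moreover have "1 / 2 * (4 / pi) = 2 / pi"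
        by simp
      ultimately show ?thesis
        by (simp only: bessel_power_integral_2 order_refl)
    qed
  qed
  also have "\<dots> = (\<Sum>i\<in>insert j I. ennreal (w i * cmod (b i)) * bessel_power_integral (1 / w i))"
    using assms(1,2) by simp
  also have "\<dots> \<le> ennreal (steinhaus_norm1 (insert j I) b)"
    using assms by (intro steinhaus_norm1_ge_weighted w sum_w) auto
  finally have "2 / pi + sqrt (pi * (2 * V)) / 4 \<le> steinhaus_norm1 (insert j I) b"
    unfolding steinhaus_norm1_def by (subst (asm) ennreal_le_iff) auto
  moreover have "sqrt (pi * (1 + V)) / 2 \<le> 2 / pi + sqrt (pi * (2 * V)) / 4"
  proof -
    \<comment> \<open>both sides are multiples of \<open>sqrt pi\<close> up to \<open>2 / pi\<close>; it remains to see that \<open>sqrt (1 + V) - sqrt (V / 2)\<close> is at most 0.7174\<close>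
    define y where "y = sqrt (V / 2)"
    have y: "547 / 1000 \<le> y" "y \<le> 8878 / 10000" "V = 2 * y\<^sup>2" "0 \<le> y"
    proof -
      show "547 / 1000 \<le> y"
        unfolding y_def using V' by (intro real_le_rsqrt) (simp add: power2_eq_square)
      show "y \<le> 8878 / 10000"
        unfolding y_def using V' by (intro real_le_lsqrt) (simp_all add: power2_eq_square)
    qed (use V' in \<open>simp_all add: y_def\<close>)
    \<comment> \<open>the numbers are close to the roots of the quadratic polynomial in \<open>y\<close> that arises by squaring\<close>
    have "(y - 547 / 1000) * (y - 8878 / 10000) \<le> 0"
      using y by (intro mult_nonneg_nonpos) auto
    moreover have "(y - 547 / 1000) * (y - 8878 / 10000) = y\<^sup>2 - 14348 / 10000 * y + 4856266 / 10000000"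
      by (simp add: power2_eq_square field_simps)
    moreover have "(7174 / 10000 + y)\<^sup>2 = y\<^sup>2 + 14348 / 10000 * y + 51466276 / 100000000"
      by (simp add: power2_eq_square field_simps)
    ultimately have "1 + V \<le> (7174 / 10000 + y)\<^sup>2"
      using y(3) by linarith
    then have "sqrt (1 + V) \<le> 7174 / 10000 + y"
      using y V' by (intro real_le_lsqrt) auto
    then have "sqrt pi * sqrt (1 + V) \<le> sqrt pi * (7174 / 10000) + sqrt pi * y"
      unfolding distrib_left[symmetric] by (intro mult_left_mono) auto
    moreover have "sqrt pi \<le> 177246 / 100000"
      using pi_approx by (intro real_le_lsqrt) (auto simp: power2_eq_square)
    moreover have "63661 / 100000 \<le> 2 / pi"
      using pi_approx by (simp add: field_simps)
    moreover have "sqrt (pi * (2 * V)) = sqrt pi * (2 * y)"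
      unfolding y(3) real_sqrt_mult using y(4) by (simp add: real_sqrt_mult)
    ultimately show ?thesis
      by (simp only: real_sqrt_mult)
  qed
  ultimately show ?thesis
    unfolding V_def by linarith
qed

section \<open>Khinchine inequality with a dominating coefficient\<close>

lemma mean_Re: "(LINT w|circle_measure. Re w) = 0"
proof -
  have "(LINT w|circle_measure. Re (- 1 * w)) = (LINT w|circle_measure. Re w)"
    by (rule integral_circle_rotate) (auto intro!: continuous_intros)
  then show ?thesis
    by simp
qed

text \<open>
  On the circle \<open>\<bar>s + b w\<bar>\<^sup>2\<close> is a constant plus \<open>2 * Re (cnj s * b * w)\<close>, and the last term behaves like
  \<open>2 * \<bar>s\<bar> * \<bar>b\<bar> * Re w\<close>.
\<close>

lemma mean_norm_powers_add:
  "(LINT w|circle_measure. (cmod (s + b * w)) ^ 2) = (cmod s)\<^sup>2 + (cmod b)\<^sup>2"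
  "(LINT w|circle_measure. (cmod (s + b * w)) ^ 4) = (cmod s) ^ 4 + 4 * (cmod b)\<^sup>2 * (cmod s)\<^sup>2 + (cmod b) ^ 4"
proof -
  define c where "c = cnj s * b"
  define N where "N = (cmod s)\<^sup>2 + (cmod b)\<^sup>2"
  have c: "cmod c = cmod s * cmod b"
    by (simp add: c_def norm_mult)
  have expand: "(cmod (s + b * w))\<^sup>2 = N + 2 * Re (c * w)" if "w \<in> space circle_measure" for w
  proof -
    have "(Re w)\<^sup>2 + (Im w)\<^sup>2 = 1"
      using that by (simp add: space_circle_measure cmod_def)
    then have "(Re (b * w))\<^sup>2 + (Im (b * w))\<^sup>2 = (cmod b)\<^sup>2"
      using that by (simp only: cmod_power2[symmetric] norm_mult space_circle_measure) simp
    then show ?thesis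
      unfolding N_def cmod_power2[of s] cmod_power2[of "s + b * w"] c_def
      by (simp add: power2_eq_square algebra_simps)
  qed
  have int: "integrable circle_measure (\<lambda>w. a * Re w)" "integrable circle_measure (\<lambda>w. a * (Re w) ^ k)"
    "integrable circle_measure (\<lambda>w. a)" for a :: real and k
    by (intro integrable_circle continuous_intros)+
  have "(LINT w|circle_measure. (cmod (s + b * w)) ^ 2) = (LINT w|circle_measure. N + 2 * Re (c * w))"
    by (intro Bochner_Integration.integral_cong refl expand)
  also have "\<dots> = (LINT w|circle_measure. N + 2 * (cmod c * Re w))"
    by (rule integral_circle_Re_mult) (intro continuous_intros)
  also have "\<dots> = (LINT w|circle_measure. N + (2 * cmod c) * Re w)"
    by (simp only: mult.assoc)
  also have "\<dots> = N"
    by (simp only: Bochner_Integration.integral_add int integral_mult_right_zero mean_Re)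
      (simp add: circle.prob_space)
  finally show "(LINT w|circle_measure. (cmod (s + b * w)) ^ 2) = (cmod s)\<^sup>2 + (cmod b)\<^sup>2"
    by (simp only: N_def)
  have "(LINT w|circle_measure. (cmod (s + b * w)) ^ 4) = (LINT w|circle_measure. (N + 2 * Re (c * w))\<^sup>2)"
  proof (intro Bochner_Integration.integral_cong refl)
    fix w assume "w \<in> space circle_measure"
    have "(cmod (s + b * w)) ^ 4 = ((cmod (s + b * w))\<^sup>2)\<^sup>2"
      by simp
    then show "(cmod (s + b * w)) ^ 4 = (N + 2 * Re (c * w))\<^sup>2"
      by (simp only: expand[OF \<open>w \<in> space circle_measure\<close>])
  qed
  also have "\<dots> = (LINT w|circle_measure. (N + 2 * (cmod c * Re w))\<^sup>2)"
    by (rule integral_circle_Re_mult) (intro continuous_intros)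
  also have "\<dots> = (LINT w|circle_measure. N\<^sup>2 + (4 * N * cmod c) * Re w + (4 * (cmod c)\<^sup>2) * (Re w) ^ 2)"
    by (intro Bochner_Integration.integral_cong refl) (simp add: power2_eq_square algebra_simps)
  also have "\<dots> = N\<^sup>2 + 2 * (cmod c)\<^sup>2"
    by (simp only: Bochner_Integration.integral_add Bochner_Integration.integrable_add int
        integral_mult_right_zero mean_Re mean_Re_powers) (simp add: circle.prob_space)
  also have "\<dots> = (cmod s) ^ 4 + 4 * (cmod b)\<^sup>2 * (cmod s)\<^sup>2 + (cmod b) ^ 4"
    unfolding c N_def by (simp add: power2_eq_square power4_eq_xxxx algebra_simps)
  finally show "(LINT w|circle_measure. (cmod (s + b * w)) ^ 4) = (cmod s) ^ 4 + 4 * (cmod b)\<^sup>2 * (cmod s)\<^sup>2 + (cmod b) ^ 4" .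
qed

lemma steinhaus_second_moment:
  assumes "finite I"
  shows "(LINT z|PiM I (\<lambda>_::nat. circle_measure). (cmod (\<Sum>i\<in>I. b i * z i)) ^ 2) = (\<Sum>i\<in>I. (cmod (b i))\<^sup>2)"
  using assms
proof induction
  case (insert j I)
  interpret prob_space "PiM I (\<lambda>_::nat. circle_measure)"
    by (intro prob_space_PiM prob_space_circle_measure)
  have "(LINT z|PiM (insert j I) (\<lambda>_. circle_measure). (cmod (\<Sum>i\<in>insert j I. b i * z i)) ^ 2) =
      (LINT z|PiM I (\<lambda>_. circle_measure). LINT w|circle_measure. (cmod ((\<Sum>i\<in>I. b i * z i) + b j * w)) ^ 2)"
    by (intro integral_steinhaus_sum_insert continuous_intros insert.hyps)
  also have "\<dots> = (LINT z|PiM I (\<lambda>_. circle_measure). (cmod (\<Sum>i\<in>I. b i * z i)) ^ 2 + (cmod (b j))\<^sup>2)"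
    unfolding mean_norm_powers_add ..
  also have "\<dots> = (LINT z|PiM I (\<lambda>_. circle_measure). (cmod (\<Sum>i\<in>I. b i * z i)) ^ 2) + (cmod (b j))\<^sup>2"
    by (subst Bochner_Integration.integral_add)
      (rule integrable_steinhaus_sum[of "\<lambda>s. (cmod s)\<^sup>2"], intro continuous_intros, simp_all add: prob_space)
  finally show ?case
    using insert by simp
qed simp

lemma steinhaus_fourth_moment:
  assumes "finite I"
  shows "(LINT z|PiM I (\<lambda>_::nat. circle_measure). (cmod (\<Sum>i\<in>I. b i * z i)) ^ 4) \<le> 2 * (\<Sum>i\<in>I. (cmod (b i))\<^sup>2)\<^sup>2"
  using assms
proof induction
  case (insert j I)
  interpret prob_space "PiM I (\<lambda>_::nat. circle_measure)"
    by (intro prob_space_PiM prob_space_circle_measure)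
  let ?V = "\<Sum>i\<in>I. (cmod (b i))\<^sup>2" and ?B = "(cmod (b j))\<^sup>2"
  have int: "integrable (PiM I (\<lambda>_::nat. circle_measure)) (\<lambda>z. (cmod (\<Sum>i\<in>I. b i * z i)) ^ k)"
    "integrable (PiM I (\<lambda>_::nat. circle_measure)) (\<lambda>z. c)" for k and c :: real
    by (rule integrable_steinhaus_sum[of "\<lambda>s. (cmod s) ^ k"], intro continuous_intros) simp
  have "(LINT z|PiM (insert j I) (\<lambda>_. circle_measure). (cmod (\<Sum>i\<in>insert j I. b i * z i)) ^ 4) =
      (LINT z|PiM I (\<lambda>_. circle_measure). LINT w|circle_measure. (cmod ((\<Sum>i\<in>I. b i * z i) + b j * w)) ^ 4)"
    by (intro integral_steinhaus_sum_insert continuous_intros insert.hyps)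
  also have "\<dots> = (LINT z|PiM I (\<lambda>_. circle_measure).
      (cmod (\<Sum>i\<in>I. b i * z i)) ^ 4 + (4 * ?B) * (cmod (\<Sum>i\<in>I. b i * z i)) ^ 2 + (cmod (b j)) ^ 4)"
    unfolding mean_norm_powers_add ..
  also have "\<dots> = (LINT z|PiM I (\<lambda>_. circle_measure). (cmod (\<Sum>i\<in>I. b i * z i)) ^ 4) + (4 * ?B) * ?V + ?B\<^sup>2"
    using insert.hyps
    by (simp only: Bochner_Integration.integral_add Bochner_Integration.integrable_add int integrable_mult_right
        integral_mult_right_zero steinhaus_second_moment) (simp add: prob_space)
  also have "\<dots> \<le> 2 * ?V\<^sup>2 + (4 * ?B) * ?V + 2 * ?B\<^sup>2"
    using insert.IH zero_le_power2[of ?B] by linarith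
  also have "\<dots> = 2 * (?B + ?V)\<^sup>2"
    by (simp add: power2_eq_square algebra_simps)
  finally show ?case
    using insert.hyps by simp
qed simp

lemma cos_ge_quadratic: "1 - x\<^sup>2 / 2 \<le> cos x" for x :: real
proof -
  have "(sin (x / 2))\<^sup>2 \<le> (x / 2)\<^sup>2"
    using abs_sin_x_le_abs_x[of "x / 2"] by (rule abs_le_square_iff[THEN iffD1])
  then show ?thesis
    using cos_double_sin[of "x / 2"] by (simp add: power_divide)
qed

lemma sin_ge_cubic: "x\<^sup>2 - x ^ 4 / 6 \<le> x * sin x" for x :: real
proof -
  have "{..<3::nat} = {0, 1, 2}"
    by auto
  then have "\<bar>sin x - x\<bar> \<le> \<bar>x\<bar> ^ 3 / 6"
    using Maclaurin_sin_bound[of x 3] by (simp add: sin_coeff_def fact_numeral)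
  then have "\<bar>x\<bar> * \<bar>sin x - x\<bar> \<le> \<bar>x\<bar> * (\<bar>x\<bar> ^ 3 / 6)"
    by (rule mult_left_mono) simp
  also have "\<dots> = \<bar>x\<bar> ^ 4 / 6"
    by (simp add: power_numeral_reduce)
  also have "\<bar>x\<bar> ^ 4 = x ^ 4"
    by (simp add: power_even_abs)
  finally have "\<bar>x * (sin x - x)\<bar> \<le> x ^ 4 / 6"
    by (simp only: abs_mult)
  then have "- (x * (sin x - x)) \<le> x ^ 4 / 6"
    by (rule abs_le_D2)
  then show ?thesis
    by (simp add: right_diff_distrib power2_eq_square)
qed

text \<open>
  By rotation \<open>s\<close> may be taken real. The modulus of \<open>s + w\<close> is then that of \<open>1 + s * w\<close>, which is at least
  the real part of \<open>(1 + s * w) * cis (- \<theta>)\<close> for any angle \<open>\<theta>\<close>. For small \<open>s\<close> the argument of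
  \<open>1 + s * w\<close> is about \<open>s * Im w\<close>; the angle used is \<open>\<kappa> * s * Im w\<close>, and its sine and cosine
  are bounded by Taylor polynomials. The value \<open>\<kappa> = 3 / 4\<close> is chosen to make the averaged bound good for
  second moments up to 3/5.
\<close>

lemma mean_norm_add_lower:
  "1 + 15 / 64 * (cmod s)\<^sup>2 - 27 / 1024 * (cmod s) ^ 4 \<le> (LINT w|circle_measure. cmod (s + w))"
proof -
  define r where "r = cmod s"
  define \<kappa> :: real where "\<kappa> = 3 / 4"
  obtain u where u: "cmod u = 1" "s = u * complex_of_real r"
  proof (cases "s = 0")
    case False
    then show ?thesis
      by (intro that[of "s / complex_of_real r"]) (auto simp: r_def norm_divide)
  qed (auto intro: that[of 1] simp: r_def)
  have Im: "(LINT w|circle_measure. (Im w) ^ k) = (LINT w|circle_measure. (Re w) ^ k)" for k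
  proof -
    have "(LINT w|circle_measure. (Im w) ^ k) = (LINT w|circle_measure. (Im (\<i> * w)) ^ k)"
      by (rule integral_circle_rotate[symmetric]) (auto intro!: continuous_intros)
    then show ?thesis
      by simp
  qed
  have "(LINT w|circle_measure. cmod (s + w)) = (LINT w|circle_measure. cmod (s + u * w))"
    by (rule integral_circle_rotate[OF _ u(1), symmetric]) (intro continuous_intros)
  also have "\<dots> = (LINT w|circle_measure. cmod (complex_of_real r + w))"
    unfolding u(2) distrib_left[symmetric] norm_mult u(1) by simp
  finally have reduce: "(LINT w|circle_measure. cmod (s + w)) = (LINT w|circle_measure. cmod (complex_of_real r + w))" .
  have "(LINT w|circle_measure. 1 + (r * Re w * cos (\<kappa> * r * Im w)) + (\<kappa> - \<kappa>\<^sup>2 / 2) * r\<^sup>2 * (Im w) ^ 2 + - (\<kappa> ^ 3 / 6) * r ^ 4 * (Im w) ^ 4)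
      \<le> (LINT w|circle_measure. cmod (complex_of_real r + w))"
  proof (intro integral_mono integrable_circle continuous_intros)
    fix w assume "w \<in> space circle_measure"
    then have w: "(Re w)\<^sup>2 + (Im w)\<^sup>2 = 1"
      by (simp add: space_circle_measure cmod_def)
    define \<theta> where "\<theta> = \<kappa> * r * Im w"
    let ?z = "Complex (1 + r * Re w) (r * Im w)"
    have "Re (?z * cis (- \<theta>)) \<le> cmod (?z * cis (- \<theta>))"
      by (rule complex_Re_le_cmod)
    also have "\<dots> = cmod ?z"
      by (simp add: norm_mult)
    also have "(cmod ?z)\<^sup>2 = 1 + 2 * r * Re w + r\<^sup>2 * ((Re w)\<^sup>2 + (Im w)\<^sup>2)"
      unfolding cmod_power2 complex.sel by (simp add: power2_eq_square algebra_simps)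
    then have "(cmod ?z)\<^sup>2 = (cmod (complex_of_real r + w))\<^sup>2"
    proof -
      have "(cmod (complex_of_real r + w))\<^sup>2 = r\<^sup>2 + 2 * r * Re w + ((Re w)\<^sup>2 + (Im w)\<^sup>2)"
        unfolding cmod_power2 by (simp add: power2_eq_square algebra_simps)
      then show ?thesis
        unfolding \<open>(cmod ?z)\<^sup>2 = _\<close> w by simp
    qed
    then have "cmod ?z = cmod (complex_of_real r + w)"
      by (rule power2_eq_imp_eq) auto
    finally have "(1 + r * Re w) * cos \<theta> + r * Im w * sin \<theta> \<le> cmod (complex_of_real r + w)"
      by simp
    moreover have "1 - \<theta>\<^sup>2 / 2 \<le> cos \<theta>"
      by (rule cos_ge_quadratic)
    moreover have "r * Im w * sin \<theta> \<ge> \<kappa> * r\<^sup>2 * (Im w)\<^sup>2 - \<kappa> ^ 3 / 6 * r ^ 4 * (Im w) ^ 4"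
      using sin_ge_cubic[of \<theta>] by (simp add: \<theta>_def \<kappa>_def power_mult_distrib power_divide field_simps)
    moreover have "\<theta>\<^sup>2 = \<kappa>\<^sup>2 * r\<^sup>2 * (Im w)\<^sup>2"
      by (simp add: \<theta>_def power_mult_distrib)
    ultimately show "1 + (r * Re w * cos (\<kappa> * r * Im w)) + (\<kappa> - \<kappa>\<^sup>2 / 2) * r\<^sup>2 * (Im w) ^ 2 + - (\<kappa> ^ 3 / 6) * r ^ 4 * (Im w) ^ 4
        \<le> cmod (complex_of_real r + w)"
      unfolding \<theta>_def[symmetric] by (simp add: algebra_simps)
  qed
  also have "(LINT w|circle_measure. 1 + (r * Re w * cos (\<kappa> * r * Im w)) + (\<kappa> - \<kappa>\<^sup>2 / 2) * r\<^sup>2 * (Im w) ^ 2 + - (\<kappa> ^ 3 / 6) * r ^ 4 * (Im w) ^ 4) =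
      1 + (LINT w|circle_measure. r * Re w * cos (\<kappa> * r * Im w)) + (\<kappa> - \<kappa>\<^sup>2 / 2) * r\<^sup>2 * (LINT w|circle_measure. (Im w) ^ 2) +
      - (\<kappa> ^ 3 / 6) * r ^ 4 * (LINT w|circle_measure. (Im w) ^ 4)"
  proof -
    have int: "integrable circle_measure (\<lambda>w. r * Re w * cos (\<kappa> * r * Im w))" "integrable circle_measure (\<lambda>w. c * (Im w) ^ k)"
      "integrable circle_measure (\<lambda>w. c)" for c :: real and k
      by (intro integrable_circle continuous_intros)+
    show ?thesis
      by (simp only: Bochner_Integration.integral_add Bochner_Integration.integrable_add int integral_mult_right_zero)
        (simp add: circle.prob_space)
  qed
  also have "(LINT w|circle_measure. r * Re w * cos (\<kappa> * r * Im w)) = 0"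
  proof -
    have "(LINT w|circle_measure. r * Re w * cos (\<kappa> * r * Im w)) =
        (1 / (2 * pi)) *\<^sub>R (sin (\<kappa> * r * sin (2 * pi)) / \<kappa> - sin (\<kappa> * r * sin 0) / \<kappa>)"
    proof (rule integral_circle_FTC)
      show "((\<lambda>\<theta>. sin (\<kappa> * r * sin \<theta>) / \<kappa>) has_vector_derivative r * Re (cis \<theta>) * cos (\<kappa> * r * Im (cis \<theta>))) (at \<theta>)" for \<theta>
        unfolding has_real_derivative_iff_has_vector_derivative[symmetric]
        by (auto intro!: derivative_eq_intros simp: \<kappa>_def)
    qed (intro continuous_intros)
    then show ?thesis
      by simp
  qed
  finally show ?thesis
    unfolding reduce r_def[symmetric] by (simp add: Im mean_Re_powers \<kappa>_def power_divide)
qed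

lemma continuous_on_mean_norm_add: "continuous_on UNIV (\<lambda>s. LINT w|circle_measure. cmod (s + w))"
proof (unfold continuous_on_iff, intro ballI allI impI)
  fix s :: complex and e :: real
  assume "e > 0"
  have "dist (LINT w|circle_measure. cmod (s' + w)) (LINT w|circle_measure. cmod (s + w)) \<le> dist s' s" for s'
  proof -
    have int: "integrable circle_measure (\<lambda>w. cmod (t + w))" "integrable circle_measure (\<lambda>w. a)" for t and a :: real
      by (intro integrable_circle continuous_intros)+
    have "\<bar>(LINT w|circle_measure. cmod (s' + w)) - (LINT w|circle_measure. cmod (s + w))\<bar> =
        \<bar>LINT w|circle_measure. cmod (s' + w) - cmod (s + w)\<bar>"
      by (simp only: Bochner_Integration.integral_diff int)
    also have "\<dots> \<le> (LINT w|circle_measure. \<bar>cmod (s' + w) - cmod (s + w)\<bar>)"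
      by (rule integral_abs_bound)
    also have "\<dots> \<le> (LINT w|circle_measure. cmod (s' - s))"
    proof (intro integral_mono integrable_circle continuous_intros)
      fix w
      show "\<bar>cmod (s' + w) - cmod (s + w)\<bar> \<le> cmod (s' - s)"
        using norm_triangle_ineq3[of "s' + w" "s + w"] by simp
    qed
    finally show ?thesis
      by (simp add: circle.prob_space dist_norm)
  qed
  with \<open>e > 0\<close> show "\<exists>d>0. \<forall>s'\<in>UNIV. dist s' s < d \<longrightarrow>
      dist (LINT w|circle_measure. cmod (s' + w)) (LINT w|circle_measure. cmod (s + w)) < e"
    by (meson le_less_trans)
qed

text \<open>
  Average the lower bound for the large variable over the others. The fourth moment enters with a negative sign, so its
  upper bound \<open>2 * V\<^sup>2\<close> is what is needed.
\<close>

lemma khinchine_large_coefficient: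
  assumes "finite I" "j \<notin> I" "cmod (b j) = 1" and V: "(\<Sum>i\<in>I. (cmod (b i))\<^sup>2) \<le> 3 / 5"
  shows "sqrt (pi * (1 + (\<Sum>i\<in>I. (cmod (b i))\<^sup>2))) / 2 \<le> steinhaus_norm1 (insert j I) b"
proof -
  interpret prob_space "PiM I (\<lambda>_::nat. circle_measure)"
    by (intro prob_space_PiM prob_space_circle_measure)
  define V where "V = (\<Sum>i\<in>I. (cmod (b i))\<^sup>2)"
  define P where "P = 1 + 15 / 64 * V - 27 / 512 * V\<^sup>2"
  have V': "0 \<le> V" "V \<le> 3 / 5"
    using V by (auto simp: V_def sum_nonneg)
  let ?S = "\<lambda>z. \<Sum>i\<in>I. b i * z i"
  have rotate: "(LINT w|circle_measure. cmod (s + b j * w)) = (LINT w|circle_measure. cmod (s + w))" for s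
    by (rule integral_circle_rotate[OF _ assms(3)]) (intro continuous_intros)
  have int: "integrable (PiM I (\<lambda>_::nat. circle_measure)) (\<lambda>z. c * (cmod (?S z)) ^ k)"
    "integrable (PiM I (\<lambda>_::nat. circle_measure)) (\<lambda>z. c)" for k and c :: real
    by (rule integrable_steinhaus_sum[of "\<lambda>s. c * (cmod s) ^ k"], intro continuous_intros) simp
  have "P \<le> 1 + 15 / 64 * (LINT z|PiM I (\<lambda>_. circle_measure). (cmod (?S z)) ^ 2) +
      - (27 / 1024) * (LINT z|PiM I (\<lambda>_. circle_measure). (cmod (?S z)) ^ 4)"
    using steinhaus_fourth_moment[OF assms(1), of b]
    by (simp add: P_def steinhaus_second_moment[OF assms(1)] V_def[symmetric])
  also have "\<dots> = (LINT z|PiM I (\<lambda>_. circle_measure). 1 + 15 / 64 * (cmod (?S z)) ^ 2 + - (27 / 1024) * (cmod (?S z)) ^ 4)"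
    by (simp only: Bochner_Integration.integral_add Bochner_Integration.integrable_add int integral_mult_right_zero)
      (simp add: prob_space)
  also have "\<dots> \<le> (LINT z|PiM I (\<lambda>_. circle_measure). LINT w|circle_measure. cmod (?S z + w))"
  proof (rule integral_mono)
    show "integrable (PiM I (\<lambda>_. circle_measure)) (\<lambda>z. LINT w|circle_measure. cmod (?S z + w))"
      by (rule integrable_steinhaus_sum[OF continuous_on_mean_norm_add])
    show "integrable (PiM I (\<lambda>_. circle_measure)) (\<lambda>z. 1 + 15 / 64 * (cmod (?S z)) ^ 2 + - (27 / 1024) * (cmod (?S z)) ^ 4)"
      by (intro Bochner_Integration.integrable_add int)
    show "1 + 15 / 64 * (cmod (?S z)) ^ 2 + - (27 / 1024) * (cmod (?S z)) ^ 4 \<le> (LINT w|circle_measure. cmod (?S z + w))" for z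
      using mean_norm_add_lower[of "?S z"] by simp
  qed
  also have "\<dots> = steinhaus_norm1 (insert j I) b"
    unfolding steinhaus_norm1_def rotate[symmetric]
    by (intro integral_steinhaus_sum_insert[symmetric] continuous_intros assms)
  finally have "P \<le> steinhaus_norm1 (insert j I) b" .
  moreover have "sqrt (pi * (1 + V)) \<le> 2 * P"
  proof (rule real_le_lsqrt)
    \<comment> \<open>15/64 - 27/512 * 3/5 is slightly larger than 0.2027\<close>
    have "V * V \<le> 3 / 5 * V"
      using V' by (intro mult_right_mono)
    then have P: "1 + 2027 / 10000 * V \<le> P"
      using V'(1) by (simp add: P_def power2_eq_square)
    show "0 \<le> 2 * P"
      using P V' by simp
    \<comment> \<open>the tangent of \<open>V\<^sup>2\<close> at 3/5 makes the remaining inequality linear in \<open>V\<close>\<close>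
    have "0 \<le> (V - 3 / 5)\<^sup>2"
      by simp
    then have "31416 / 10000 * (1 + V) \<le> (2 * (1 + 2027 / 10000 * V))\<^sup>2"
      using V' by (simp add: power2_eq_square algebra_simps)
    also have "\<dots> \<le> (2 * P)\<^sup>2"
      using P V' by (intro power_mono) auto
    finally have "31416 / 10000 * (1 + V) \<le> (2 * P)\<^sup>2" .
    moreover have "pi * (1 + V) \<le> 31416 / 10000 * (1 + V)"
      using pi_approx V' by (intro mult_right_mono) auto
    ultimately show "pi * (1 + V) \<le> (2 * P)\<^sup>2"
      by linarith
  qed
  ultimately show ?thesis
    unfolding V_def by linarith
qed

lemma steinhaus_norm1_divide:
  "steinhaus_norm1 I (\<lambda>i. b i / complex_of_real c) = steinhaus_norm1 I b / \<bar>c\<bar>"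
  by (simp add: steinhaus_norm1_def sum_divide_distrib[symmetric] norm_divide)

text \<open>
  The inequality is homogeneous, so a coefficient that carries more than half of the total may be normalised to
  modulus 1; the others then sum to less than 1.
\<close>

theorem khinchine_steinhaus:
  assumes "finite I" and b: "\<And>i. i \<in> I \<Longrightarrow> b i \<noteq> 0"
  shows "sqrt pi / 2 * sqrt (\<Sum>i\<in>I. (cmod (b i))\<^sup>2) \<le> steinhaus_norm1 I b"
proof (cases "\<exists>j\<in>I. (\<Sum>i\<in>I. (cmod (b i))\<^sup>2) < 2 * (cmod (b j))\<^sup>2")
  case False
  show ?thesis
  proof (cases "I = {}")
    case True
    then show ?thesis
      by (simp add: steinhaus_norm1_def)
  next
    case nonempty: False
    have "2 * (cmod (b i))\<^sup>2 \<le> (\<Sum>i\<in>I. (cmod (b i))\<^sup>2)" if "i \<in> I" for i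
      using False that by force
    then show ?thesis
      using khinchine_small_coefficients[OF assms(1) nonempty b] by (simp add: real_sqrt_mult)
  qed
next
  case True
  then obtain j where j: "j \<in> I" "(\<Sum>i\<in>I. (cmod (b i))\<^sup>2) < 2 * (cmod (b j))\<^sup>2"
    by blast
  define V where "V = (\<Sum>i\<in>I. (cmod (b i))\<^sup>2)"
  define c where "c = cmod (b j)"
  define b' where "b' i = b i / complex_of_real c" for i
  have c: "c > 0"
    using b[OF j(1)] by (simp add: c_def)
  have I: "insert j (I - {j}) = I"
    using j(1) by auto
  have sum: "1 + (\<Sum>i\<in>I - {j}. (cmod (b' i))\<^sup>2) = V / c\<^sup>2"
  proof -
    have "V = c\<^sup>2 + (\<Sum>i\<in>I - {j}. (cmod (b i))\<^sup>2)"
      unfolding V_def c_def by (rule sum.remove[OF assms(1) j(1)])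
    moreover have "(\<Sum>i\<in>I - {j}. (cmod (b' i))\<^sup>2) = (\<Sum>i\<in>I - {j}. (cmod (b i))\<^sup>2) / c\<^sup>2"
      using c by (simp add: b'_def norm_divide power_divide sum_divide_distrib)
    ultimately show ?thesis
      using c by (simp add: add_divide_distrib)
  qed
  have "V / c\<^sup>2 < 2"
    using j(2) c by (simp add: V_def[symmetric] c_def[symmetric] field_simps)
  then have le_1: "(\<Sum>i\<in>I - {j}. (cmod (b' i))\<^sup>2) \<le> 1"
    using sum by linarith
  have unit: "cmod (b' j) = 1"
    using c by (simp add: b'_def norm_divide c_def[symmetric])
  have nz: "b' i \<noteq> 0" if "i \<in> I - {j}" for i
    using b[of i] that c by (simp add: b'_def)
  have "sqrt (pi * (1 + (\<Sum>i\<in>I - {j}. (cmod (b' i))\<^sup>2))) / 2 \<le> steinhaus_norm1 (insert j (I - {j})) b'"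
  proof (cases "(\<Sum>i\<in>I - {j}. (cmod (b' i))\<^sup>2) \<le> 3 / 5")
    case True
    then show ?thesis
      by (intro khinchine_large_coefficient unit) (use assms(1) in auto)
  next
    case False
    then show ?thesis
      by (intro khinchine_medium_coefficient unit nz le_1) (use assms(1) in auto)
  qed
  moreover have "steinhaus_norm1 I b' = steinhaus_norm1 I b / c"
    unfolding b'_def[abs_def] using steinhaus_norm1_divide[of I b c] c by simp
  ultimately have "sqrt (pi * (V / c\<^sup>2)) / 2 \<le> steinhaus_norm1 I b / c"
    unfolding I sum by simp
  then have "sqrt pi * sqrt V / c / 2 \<le> steinhaus_norm1 I b / c"
    using c by (simp add: real_sqrt_mult real_sqrt_divide)
  then show ?thesis
    using c by (simp add: V_def[symmetric] divide_le_cancel field_simps)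
qed

section \<open>Hankel forms of linear functions\<close>

text \<open>
  The edge weights for \<open>\<phi> = \<Sum> a\<^sub>j z\<^sub>j\<close>. The shift comes from the numbering of rows and columns, where the index \<open>n\<close>
  belongs to the integer \<open>n + 1\<close>.
\<close>

definition star_edge :: "nat \<Rightarrow> (nat \<Rightarrow> complex) \<Rightarrow> nat \<Rightarrow> complex" where
  "star_edge d a n = (\<Sum>j<d. if Suc n = coordinate_prime j then cnj (a j) else 0)"

lemma star_edge_prime: "star_edge d a (coordinate_prime j - 1) = (if j < d then cnj (a j) else 0)"
proof -
  have "Suc (coordinate_prime j - 1) = coordinate_prime j"
    using prime_gt_0_nat[OF prime_enumerate[of j]] by simp
  then show ?thesis
    by (simp add: star_edge_def coordinate_prime_eq_iff)
qed

lemma star_edge_nonzero: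
  assumes "star_edge d a n \<noteq> 0"
  obtains j where "j < d" "n = coordinate_prime j - 1" "a j \<noteq> 0"
proof -
  obtain j where "j \<in> {..<d}" and j: "(if Suc n = coordinate_prime j then cnj (a j) else 0) \<noteq> 0"
    by (rule sum.not_neutral_contains_not_neutral[OF assms[unfolded star_edge_def]])
  have n: "Suc n = coordinate_prime j"
    by (rule ccontr) (use j in simp)
  then have "n = coordinate_prime j - 1"
    by linarith
  then show ?thesis
    using \<open>j \<in> {..<d}\<close> j n by (intro that[of j]) simp_all
qed

text \<open>
  Off the first row and column the index \<open>(m + 1) (n + 1)\<close> is a proper product, hence not a prime.
\<close>

lemma hankel_matrix_linear:
  "hankel_matrix (\<lambda>z. \<Sum>j<d. a j * z j) = star_matrix (star_edge d a)"
proof (intro ext)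
  fix m n
  show "hankel_matrix (\<lambda>z. \<Sum>j<d. a j * z j) m n = star_matrix (star_edge d a) m n"
  proof (cases "m = 0 \<or> n = 0")
    case True
    then show ?thesis
      by (auto simp: hankel_matrix_def hankel_coeff_linear star_matrix_def star_edge_def)
  next
    case False
    have "Suc m * Suc n \<noteq> coordinate_prime j" for j
    proof
      assume "Suc m * Suc n = coordinate_prime j"
      then have "prime (Suc m * Suc n)"
        using prime_enumerate[of j] by simp
      then show False
        using False prime_product by (metis One_nat_def Suc_inject)
    qed
    then show ?thesis
      using False by (simp add: hankel_matrix_def hankel_coeff_linear star_matrix_def del: mult_Suc mult_Suc_right)
  qed
qed

lemma star_star_edge: "star (star_edge d a)"
proof
  have "Suc 0 \<noteq> coordinate_prime j" for j
    using prime_gt_1_nat[OF prime_enumerate[of j]] by linarith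
  then show "star_edge d a 0 = 0"
    by (simp add: star_edge_def)
  have "{n. star_edge d a n \<noteq> 0} \<subseteq> (\<lambda>j. coordinate_prime j - 1) ` {..<d}"
  proof
    fix n assume "n \<in> {n. star_edge d a n \<noteq> 0}"
    then have "star_edge d a n \<noteq> 0"
      by simp
    then obtain j where "j < d" "n = coordinate_prime j - 1"
      by (rule star_edge_nonzero)
    then show "n \<in> (\<lambda>j. coordinate_prime j - 1) ` {..<d}"
      by blast
  qed
  then show "finite {n. star_edge d a n \<noteq> 0}"
    by (rule finite_subset) simp
qed

lemma weight_star_edge: "star.weight (star_edge d a) = sqrt (\<Sum>j<d. (cmod (a j))\<^sup>2)"
proof -
  have inj: "inj_on (\<lambda>j. coordinate_prime j - 1) A" for A
  proof (rule inj_onI)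
    fix i j assume "coordinate_prime i - 1 = coordinate_prime j - 1"
    then have "coordinate_prime i = coordinate_prime j"
      using prime_gt_0_nat[OF prime_enumerate[of i]] prime_gt_0_nat[OF prime_enumerate[of j]] by linarith
    then show "i = j"
      by (simp add: coordinate_prime_eq_iff)
  qed
  have "(\<Sum>n | star_edge d a n \<noteq> 0. (cmod (star_edge d a n))\<^sup>2) =
      (\<Sum>n\<in>(\<lambda>j. coordinate_prime j - 1) ` {..<d}. (cmod (star_edge d a n))\<^sup>2)"
  proof (rule sum.mono_neutral_left)
    show "{n. star_edge d a n \<noteq> 0} \<subseteq> (\<lambda>j. coordinate_prime j - 1) ` {..<d}"
      using star_edge_nonzero[of d a] by blast
  qed auto
  also have "\<dots> = (\<Sum>j<d. (cmod (a j))\<^sup>2)"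
    unfolding sum.reindex[OF inj] o_def star_edge_prime by (intro sum.cong) simp_all
  finally show ?thesis
    by (simp add: star.weight_def[OF star_star_edge])
qed

lemma khinchine_torus_norm1:
  "sqrt pi / 2 * sqrt (\<Sum>j<d. (cmod (b j))\<^sup>2) \<le> torus_norm1 (\<lambda>z. \<Sum>j<d. b j * z j)"
proof -
  let ?I = "{j. j < d \<and> b j \<noteq> 0}"
  have "(\<Sum>j<d. (cmod (b j))\<^sup>2) = (\<Sum>j\<in>?I. (cmod (b j))\<^sup>2)"
    by (rule sum.mono_neutral_right) auto
  moreover have "sqrt pi / 2 * sqrt (\<Sum>j\<in>?I. (cmod (b j))\<^sup>2) \<le> steinhaus_norm1 ?I b"
    by (rule khinchine_steinhaus) auto
  moreover have "torus_norm1 (\<lambda>z. \<Sum>j<d. b j * z j) = steinhaus_norm1 ?I b"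
    unfolding steinhaus_norm1_def by (rule torus_norm1_linear) auto
  ultimately show ?thesis
    by (simp only:)
qed

text \<open>
  After taking logarithms both sides agree for the largest admissible \<open>p\<close>.
\<close>

lemma constant_le_two_powr:
  assumes "0 < p" "p \<le> 1 / (1 - ln pi / ln 4)"
  shows "2 / sqrt pi \<le> 2 powr (1 / p)"
proof -
  have "ln pi < ln 4"
    using pi_less_4 by simp
  then have pos: "0 < 1 - ln pi / ln 4"
    by simp
  have "1 - ln pi / ln 4 \<le> 1 / p"
    using assms pos by (simp add: field_simps)
  moreover have "ln 4 = 2 * ln (2::real)"
    using ln_realpow[of 2 2] by simp
  ultimately have "ln 2 - ln pi / 2 \<le> 1 / p * ln 2"
    using mult_right_mono[of "1 - ln pi / ln 4" "1 / p" "ln 2"] by (simp add: field_simps)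
  moreover have "ln (2 / sqrt pi) = ln 2 - ln pi / 2"
    by (simp add: ln_div ln_sqrt)
  ultimately have "ln (2 / sqrt pi) \<le> ln (2 powr (1 / p))"
    by (simp add: ln_powr)
  then show ?thesis
    by (subst (asm) ln_le_cancel_iff) auto
qed

theorem theorem4:
  fixes p :: real and d :: nat and a b :: "nat \<Rightarrow> complex"
    and \<phi> f :: "(nat \<Rightarrow> complex) \<Rightarrow> complex"
  assumes "0 < p" and "p \<le> 1 / (1 - ln pi / ln 4)"
    and "d \<ge> 1"
    and "\<phi> = (\<lambda>z. \<Sum>j<d. a j * z j)"
    and "f = (\<lambda>z. \<Sum>j<d. b j * z j)"
  shows "hankel_matrix \<phi> \<in> schatten_class p \<and>
    cmod (torus_inner f \<phi>) \<le> schatten_norm p (hankel_matrix \<phi>) * torus_norm1 f"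
proof
  interpret star "star_edge d a"
    by (rule star_star_edge)
  have M: "hankel_matrix \<phi> = star_matrix (star_edge d a)"
    unfolding assms(4) by (rule hankel_matrix_linear)
  show "hankel_matrix \<phi> \<in> schatten_class p"
    unfolding M by (rule in_schatten_class)
  define A where "A = sqrt (\<Sum>j<d. (cmod (a j))\<^sup>2)"
  define B where "B = sqrt (\<Sum>j<d. (cmod (b j))\<^sup>2)"
  have nonneg: "0 \<le> A" "0 \<le> B"
    by (simp_all add: A_def B_def sum_nonneg)
  have "cmod (torus_inner f \<phi>) \<le> (\<Sum>j<d. cmod (b j * cnj (a j)))"
    unfolding assms(4,5) torus_inner_linear by (rule norm_sum)
  also have "\<dots> = (\<Sum>j<d. \<bar>cmod (b j)\<bar> * \<bar>cmod (a j)\<bar>)"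
    by (simp add: norm_mult)
  also have "\<dots> \<le> L2_set (\<lambda>j. cmod (b j)) {..<d} * L2_set (\<lambda>j. cmod (a j)) {..<d}"
    by (rule L2_set_mult_ineq)
  also have "\<dots> = (2 / sqrt pi * A) * (sqrt pi / 2 * B)"
    by (simp add: A_def B_def L2_set_def)
  also have "\<dots> \<le> (2 powr (1 / p) * A) * torus_norm1 f"
  proof (intro mult_mono mult_right_mono)
    show "sqrt pi / 2 * B \<le> torus_norm1 f"
      unfolding B_def assms(5) by (rule khinchine_torus_norm1)
  qed (use nonneg constant_le_two_powr[OF assms(1,2)] in auto)
  also have "2 powr (1 / p) * A = schatten_norm p (hankel_matrix \<phi>)"
    unfolding M A_def weight_star_edge[symmetric] by (rule schatten_norm_eq[OF assms(1), symmetric])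
  finally show "cmod (torus_inner f \<phi>) \<le> schatten_norm p (hankel_matrix \<phi>) * torus_norm1 f" .
qed

end
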